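(* Let $W:[0,1]^2\to[0,\Lambda]$ be a normalized graphon, let $0<\rho\Lambda\le1$, let $G=G_n(\rho W)$, $\lambda\ge1$, and let $k$ be an integer. Let $\hat B\in\operatorname{argmin}_{B\in\mathcal B_\mu}\hat\delta_2(B,G)$ with $\mu=\lambda\rho(G)$ (the restricted least-squares estimator). If $2\Lambda\le\lambda\le\sqrt n$ and $2\le k\le\min\{n\sqrt{\rho/2},e^{\rho n/2}\}$, then $$\delta_2\Bigl(W,\tfrac1{\rho(G)}W[\hat B]\Bigr)\le\epsilon_k^{(O)}(W)+2\epsilon_n(W)+O_P\left(\sqrt[4]{\lambda^2\left(\frac{\log k}{\rho n}+\frac{k^2}{\rho n^2}\right)}\right).$$ In particular (for fixed $W$, with $\rho,\lambda,k$ depending on $n$), $\delta_2\bigl(W,\frac1{\rho(G)}W[\hat B]\bigr)\to0$ in probability as $n\to\infty$ if $k\to\infty$ and $\lambda^2\bigl(\frac{\log k}{\rho n}+\frac{k^2}{\rho n^2}\bigr)\to0$.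
   Context: **Graphons and norms.** A graphon is a bounded measurable function $W:[0,1]^2\to[0,\infty)$ with $W(x,y)=W(y,x)$; it is normalized if $\int W=1$. For an $m\times m$ matrix $A$, $\|A\|_p^p=\frac1{m^2}\sum_{i,j}|A_{ij}|^p$; for functions on $[0,1]^2$, $\|f\|_p$ is the usual $L_p$ norm. For an $m\times m$ matrix $A$, $W[A]$ is the step function on $[0,1]^2$ equal to $A_{ij}$ on $I_i\times I_j$, where $I_1,\dots,I_m$ are the consecutive intervals of length $1/m$ partitioning $[0,1]$. $\delta_2(U,V)=\inf_\phi\|U^\phi-V\|_2$, over measure-preserving bijections $\phi$ of $[0,1]$, with $U^\phi(x,y)=U(\phi(x),\phi(y))$. **Random graphs.** Let $x_1,\dots,x_n$ be i.i.d. uniform on $[0,1]$, $H_n(W)_{ij}=W(x_i,x_j)$. Given the $x_i$, $G=G_n(\rho W)$ is the random graph on $[n]$ in which each pair $i<j$ is joined independently with probability $\rho W(x_i,x_j)$. The edge density $\rho(G)$ is the number of edges divided by $\binom n2$. **Error terms.** $\epsilon_n(W)=\min_\sigma\|W[H_n(W)^\sigma]-W\|_2$, the minimum over permutations $\sigma$ of $[n]$, $H^\sigma_{ij}=H_{\sigma(i)\sigma(j)}$ (a random variable, computed from the same $x_i$ that generate $G$). $\epsilon_k^{(O)}(W)=\min_B\|W-W[B]\|_2$ over $k\times k$ matrices $B$. **Least squares.** An equipartition is a map $\pi:[n]\to[k]$ with $\bigl||\pi^{-1}(i)|-n/k\bigr|<1$ for all $i$. For a $k\times k$ matrix $B$,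 $(B_\pi)_{xy}=B_{\pi(x)\pi(y)}$, and $\hat\delta_2(B,G)=\min_\pi\|B_\pi-A(G)\|_2$ over equipartitions $\pi$, where $A(G)$ is the adjacency matrix. $\mathcal B_\mu$ is the set of $B\in[0,\mu]^{k\times k}$ all of whose entries are multiples of $1/n$. If $\rho(G)=0$ then $\hat B=0$ and $\frac1{\rho(G)}W[\hat B]$ is read as $0$. **Meaning of $O_P$.** For every $\eta>0$ there is a constant $M$ such that for all admissible $n,W,\Lambda,\rho,\lambda,k$, with probability at least $1-\eta$ the inequality holds with $O_P(\cdot)$ replaced by $M\cdot(\cdot)$. *)

theory Defs
  imports "HOL-Probability.Probability" "HOL-Probability.Product_PMF"
    "HOL-Combinatorics.Permutations"
begin

(* An m x m matrix is a function nat => nat => real of which only the entries with both indices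
   below m matter; [m] is {..<m}.  Kernels are curried functions that matter on the unit square
   only. *)

definition unit_interval :: "real measure" where
  "unit_interval = restrict_space lborel {0..1}"

(* Measurability is Borel measurability: the diagonal values W(x_i,x_i) enter the sampled matrix
   below, and for a merely Lebesgue measurable W they need not be random variables. *)
definition graphon :: "(real \<Rightarrow> real \<Rightarrow> real) \<Rightarrow> bool" where
  "graphon W \<longleftrightarrow>
     (\<lambda>(x, y). W x y) \<in> borel_measurable (unit_interval \<Otimes>\<^sub>M unit_interval) \<and>
     (\<forall>x\<in>{0..1}. \<forall>y\<in>{0..1}. 0 \<le> W x y \<and> W x y = W y x) \<and>
     (\<exists>C. \<forall>x\<in>{0..1}. \<forall>y\<in>{0..1}. W x y \<le> C)"

definition normalized :: "(real \<Rightarrow> real \<Rightarrow> real) \<Rightarrow> bool" where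
  "normalized W \<longleftrightarrow> (\<integral>(x, y). W x y \<partial>(unit_interval \<Otimes>\<^sub>M unit_interval)) = 1"

definition kernel_norm2 :: "(real \<Rightarrow> real \<Rightarrow> real) \<Rightarrow> real" where
  "kernel_norm2 f = sqrt (\<integral>(x, y). (f x y)\<^sup>2 \<partial>(unit_interval \<Otimes>\<^sub>M unit_interval))"

definition matrix_norm2 :: "nat \<Rightarrow> (nat \<Rightarrow> nat \<Rightarrow> real) \<Rightarrow> real" where
  "matrix_norm2 m A = sqrt ((\<Sum>i<m. \<Sum>j<m. (A i j)\<^sup>2) / (real m)\<^sup>2)"

(* The index of the interval of length 1/m containing x; the intervals are closed on the left,
   and the last one also contains 1. *)
definition cell :: "nat \<Rightarrow> real \<Rightarrow> nat" where
  "cell m x = min (nat \<lfloor>real m * x\<rfloor>) (m - 1)"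

definition step_kernel :: "nat \<Rightarrow> (nat \<Rightarrow> nat \<Rightarrow> real) \<Rightarrow> real \<Rightarrow> real \<Rightarrow> real" where
  "step_kernel m A x y = A (cell m x) (cell m y)"

definition measure_preserving_bijections :: "(real \<Rightarrow> real) set" where
  "measure_preserving_bijections =
     {\<phi>. bij_betw \<phi> {0..1} {0..1} \<and>
         \<phi> \<in> unit_interval \<rightarrow>\<^sub>M unit_interval \<and>
         distr unit_interval unit_interval \<phi> = unit_interval}"

definition delta2 :: "(real \<Rightarrow> real \<Rightarrow> real) \<Rightarrow> (real \<Rightarrow> real \<Rightarrow> real) \<Rightarrow> real" where
  "delta2 U V =
     (INF \<phi>\<in>measure_preserving_bijections. kernel_norm2 (\<lambda>x y. U (\<phi> x) (\<phi> y) - V x y))"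

definition sampled_matrix ::
    "(real \<Rightarrow> real \<Rightarrow> real) \<Rightarrow> (nat \<Rightarrow> real) \<Rightarrow> nat \<Rightarrow> nat \<Rightarrow> real" where
  "sampled_matrix W x i j = W (x i) (x j)"

definition eps_sample :: "nat \<Rightarrow> (real \<Rightarrow> real \<Rightarrow> real) \<Rightarrow> (nat \<Rightarrow> real) \<Rightarrow> real" where
  "eps_sample n W x =
     Min ((\<lambda>\<sigma>. kernel_norm2 (\<lambda>u v.
              step_kernel n (\<lambda>i j. sampled_matrix W x (\<sigma> i) (\<sigma> j)) u v - W u v))
          ` {\<sigma>. \<sigma> permutes {..<n}})"

(* The infimum is attained, by the matrix of averages of W over the cells. *)
definition eps_oracle :: "nat \<Rightarrow> (real \<Rightarrow> real \<Rightarrow> real) \<Rightarrow> real" where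
  "eps_oracle k W = (INF B. kernel_norm2 (\<lambda>u v. W u v - step_kernel k B u v))"

(* A graph on [n] is given by its set of edges, a subset of vertex_pairs n. *)
definition vertex_pairs :: "nat \<Rightarrow> (nat \<times> nat) set" where
  "vertex_pairs n = {(i, j). i < j \<and> j < n}"

definition adjacency :: "(nat \<times> nat) set \<Rightarrow> nat \<Rightarrow> nat \<Rightarrow> real" where
  "adjacency G i j = of_bool ((i, j) \<in> G \<or> (j, i) \<in> G)"

definition edge_density :: "nat \<Rightarrow> (nat \<times> nat) set \<Rightarrow> real" where
  "edge_density n G = real (card G) / real (n choose 2)"

definition random_graph_pmf :: "nat \<Rightarrow> (nat \<Rightarrow> nat \<Rightarrow> real) \<Rightarrow> (nat \<times> nat) set pmf" where
  "random_graph_pmf n P =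
     map_pmf (\<lambda>f. {e \<in> vertex_pairs n. f e})
       (Pi_pmf (vertex_pairs n) False (\<lambda>(i, j). bernoulli_pmf (P i j)))"

(* The joint law of the sample points x and of the graph G: the x_i are independent and uniform,
   and the conditional law of G given x is random_graph_pmf n (\<rho> W(x_i,x_j)). *)
definition graph_model ::
    "nat \<Rightarrow> real \<Rightarrow> (real \<Rightarrow> real \<Rightarrow> real) \<Rightarrow> ((nat \<Rightarrow> real) \<times> (nat \<times> nat) set) measure" where
  "graph_model n \<rho> W =
     density (PiM {..<n} (\<lambda>_. unit_interval) \<Otimes>\<^sub>M count_space (Pow (vertex_pairs n)))
       (\<lambda>(x, G). ennreal (pmf (random_graph_pmf n (\<lambda>i j. \<rho> * sampled_matrix W x i j)) G))"

definition equipartitions :: "nat \<Rightarrow> nat \<Rightarrow> (nat \<Rightarrow> nat) set" where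
  "equipartitions n k =
     {\<pi> \<in> {..<n} \<rightarrow>\<^sub>E {..<k}.
        \<forall>i<k. \<bar>real (card {v \<in> {..<n}. \<pi> v = i}) - real n / real k\<bar> < 1}"

definition delta2_hat ::
    "nat \<Rightarrow> nat \<Rightarrow> (nat \<Rightarrow> nat \<Rightarrow> real) \<Rightarrow> (nat \<times> nat) set \<Rightarrow> real" where
  "delta2_hat n k B G =
     Min ((\<lambda>\<pi>. matrix_norm2 n (\<lambda>u v. B (\<pi> u) (\<pi> v) - adjacency G u v)) ` equipartitions n k)"

definition grid_matrices :: "nat \<Rightarrow> nat \<Rightarrow> real \<Rightarrow> (nat \<Rightarrow> nat \<Rightarrow> real) set" where
  "grid_matrices n k \<mu> =
     {B. \<forall>i<k. \<forall>j<k. 0 \<le> B i j \<and> B i j \<le> \<mu> \<and> (\<exists>m::int. B i j = of_int m / real n)}"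

definition least_squares ::
    "nat \<Rightarrow> nat \<Rightarrow> real \<Rightarrow> (nat \<times> nat) set \<Rightarrow> (nat \<Rightarrow> nat \<Rightarrow> real) set" where
  "least_squares n k \<mu> G =
     {B. is_arg_min (\<lambda>B. delta2_hat n k B G) (\<lambda>B. B \<in> grid_matrices n k \<mu>) B}"

(* If G has no edges, the factor 1 / edge_density n G is 1 / 0 = 0, so the estimate is 0. *)
definition estimated_kernel ::
    "nat \<Rightarrow> nat \<Rightarrow> (nat \<times> nat) set \<Rightarrow> (nat \<Rightarrow> nat \<Rightarrow> real) \<Rightarrow> real \<Rightarrow> real \<Rightarrow> real" where
  "estimated_kernel n k G B u v = 1 / edge_density n G * step_kernel k B u v"

definition admissible ::
    "nat \<Rightarrow> nat \<Rightarrow> (real \<Rightarrow> real \<Rightarrow> real) \<Rightarrow> real \<Rightarrow> real \<Rightarrow> real \<Rightarrow> bool" where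
  "admissible n k W \<Lambda> \<rho> lam \<longleftrightarrow>
     graphon W \<and> normalized W \<and> (\<forall>x\<in>{0..1}. \<forall>y\<in>{0..1}. W x y \<le> \<Lambda>) \<and>
     0 < \<rho> * \<Lambda> \<and> \<rho> * \<Lambda> \<le> 1 \<and> 1 \<le> lam \<and>
     2 * \<Lambda> \<le> lam \<and> lam \<le> sqrt (real n) \<and>
     2 \<le> k \<and> real k \<le> min (real n * sqrt (\<rho> / 2)) (exp (\<rho> * real n / 2))"

definition rate :: "nat \<Rightarrow> nat \<Rightarrow> real \<Rightarrow> real \<Rightarrow> real" where
  "rate n k \<rho> lam =
     lam\<^sup>2 * (ln (real k) / (\<rho> * real n) + (real k)\<^sup>2 / (\<rho> * (real n)\<^sup>2))"

end

(* The least-squares matrix \<open>Bh\<close> with its equipartition is compared with a competitor built from a nearly optimal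
   k-step approximation of W and the permutation attaining \<open>eps_sample\<close>.  Expanding squares, the squared distance of
   \<open>Bh\<close> to the edge probability matrix exceeds that of the competitor by at most twice the inner products of the noise
   (adjacency minus edge probability) with block matrices.  These are linear in the block matrix, so only 0/1 matrices
   and all maps from [n] to [k] enter a Chernoff union bound over at most exp(n ln k + k^2) events; this produces the
   rate.  Everything else is a lower-order error: rounding to multiples of 1/n, the diagonal, replacing \<open>\<rho>\<close> by the
   edge density (Chebyshev for the U-statistic of W), and comparing n-step with k-step kernels, where a permutation of
   the n intervals aligns an arbitrary equipartition with the k intervals up to O(1/n) per class.  When n is bounded
   in terms of \<open>\<eta>\<close> the trivial bound \<open>delta2 \<le> lam\<close> suffices, because \<open>lam / sqrt n\<close> is at most twice the rate.
   For consistency, \<open>eps_oracle\<close> tends to 0 by approximation with continuous kernels, and \<open>eps_sample\<close> by approximating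
   W with a step kernel and aligning the sample points of each cell. *)

theory Submission
  imports Defs
begin

section \<open>Kernels and step kernels\<close>

text \<open>The L2 norms of \<open>W\<close>, of the sampled matrix and of the normalised estimate
  are all of order \<open>sqrt lam\<close>, not \<open>lam\<close>: W^2 \<le> \<Lambda> W and W has
  mean 1, so the square integral is at most \<Lambda>. Lower-order errors are relative errors times
  such a norm; with pointwise bounds instead, the alignment and density errors could exceed the
  rate. The fourth root appears because noise controls the square of the distance. A union bound
  over at most exp(n ln k + k^2) events allows block sums of order \<rho> n^2 sqrt(noise); matrix
  entries of order lam \<rho> multiply this, and division by (\<rho> n)^2 leaves lam sqrt(noise),
  which is R^2. The sampling error is paid twice: once by the competitor, once when \<open>W\<close>
  is replaced by its n-step kernel inside \<open>delta2\<close>. The hypotheses act at definite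
  places. 2 \<Lambda> \<le> lam keeps the competitor inside the grid as soon as the edge density is
  at least \<rho>/2; lam \<le> sqrt n absorbs the diagonal and the fluctuation of the edge sum; the
  upper bounds on k give noise \<le> 1, so that sqrt(noise) is a legitimate Chernoff
  parameter.\<close>

lemma space_unit_interval [simp]: "space unit_interval = {0..1}"
  by (simp add: unit_interval_def)

lemma measurable_unit_interval_borel: "f \<in> borel_measurable borel \<Longrightarrow> f \<in> borel_measurable unit_interval"
  unfolding unit_interval_def by (simp add: measurable_restrict_space1)

lemma sets_unit_intervalI: "A \<in> sets borel \<Longrightarrow> A \<subseteq> {0..1} \<Longrightarrow> A \<in> sets unit_interval"
  by (simp add: unit_interval_def sets_restrict_space_iff)

lemma emeasure_unit_interval: "A \<in> sets unit_interval \<Longrightarrow> emeasure unit_interval A = emeasure lborel A"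
  unfolding unit_interval_def by (subst emeasure_restrict_space) (auto simp: sets_restrict_space)

lemma prob_space_unit_interval: "prob_space unit_interval"
  by (rule prob_spaceI) (simp add: emeasure_unit_interval sets_unit_intervalI)

interpretation UI: prob_space unit_interval
  by (rule prob_space_unit_interval)

abbreviation unit_square :: "(real \<times> real) measure" where
  "unit_square \<equiv> unit_interval \<Otimes>\<^sub>M unit_interval"

interpretation UI2: pair_prob_space unit_interval unit_interval ..

lemma measurable_cell [measurable]: "cell m \<in> unit_interval \<rightarrow>\<^sub>M count_space UNIV"
proof -
  have "(\<lambda>x::real. min (nat \<lfloor>real m * x\<rfloor>) (m - 1)) \<in> borel \<rightarrow>\<^sub>M count_space UNIV"
    by measurable
  then show ?thesis
    unfolding unit_interval_def cell_def [abs_def]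
    by (intro measurable_restrict_space1) simp
qed

lemma cell_event: "{x \<in> {0..1}. cell m x = i} \<in> sets unit_interval"
  using measurable_sets[OF measurable_cell, of "{i}" m] by (simp add: vimage_def Int_def conj_commute)

lemma cell_less: "0 < m \<Longrightarrow> cell m x < m"
  by (auto simp: cell_def)

lemma cell_eq:
  assumes "0 \<le> x" "x < 1" "0 < m"
  shows "cell m x = nat \<lfloor>real m * x\<rfloor>"
proof -
  have "real m * x < real m" using assms by simp
  hence "\<lfloor>real m * x\<rfloor> < int m" by linarith
  then show ?thesis unfolding cell_def using assms by (auto simp: min_def)
qed

lemma cell_iff:
  assumes "0 \<le> x" "x < 1" "0 < m"
  shows "cell m x = i \<longleftrightarrow> real i \<le> real m * x \<and> real m * x < real i + 1"
proof -
  have "0 \<le> \<lfloor>real m * x\<rfloor>" using assms by simp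
  hence "cell m x = i \<longleftrightarrow> \<lfloor>real m * x\<rfloor> = int i" using cell_eq[OF assms] by auto
  then show ?thesis by (simp add: floor_eq_iff)
qed

lemma AE_unit_interval_less_1: "AE x in unit_interval. x < 1"
proof -
  have "{1::real} \<in> null_sets unit_interval"
    by (auto simp: null_sets_def emeasure_unit_interval sets_unit_intervalI)
  then have "AE x in unit_interval. x \<notin> {1}" by (rule AE_not_in)
  then show ?thesis by (rule AE_mp) (auto intro!: AE_I2)
qed

lemma prob_cell_eq:
  assumes "i < m"
  shows "measure unit_interval {x \<in> {0..1}. cell m x = i} = 1 / real m"
proof -
  let ?I = "{real i / real m ..< (real i + 1) / real m}"
  have m: "0 < m" using assms by simp
  have i: "(real i + 1) / real m \<le> 1" using assms by (simp add: field_simps)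
  have sub: "?I \<subseteq> {0..1}"
    using i by (auto intro: order_trans[OF _ order_less_imp_le])
       (meson divide_nonneg_nonneg of_nat_0_le_iff order_trans)
  have I: "?I \<in> sets unit_interval" by (rule sets_unit_intervalI) (use sub in auto)
  \<comment> \<open>The two sets can differ only at the point 1, which \<open>cell\<close> assigns
    to the last interval.\<close>
  have "measure unit_interval {x \<in> {0..1}. cell m x = i} = measure unit_interval ?I"
  proof (rule UI.finite_measure_eq_AE)
    show "AE x in unit_interval. (x \<in> {x \<in> {0..1}. cell m x = i}) = (x \<in> ?I)"
      using AE_unit_interval_less_1
    proof (rule AE_mp, intro AE_I2 impI)
      fix x assume "x \<in> space unit_interval" "x < 1"
      then show "(x \<in> {x \<in> {0..1}. cell m x = i}) = (x \<in> ?I)"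
        using m by (auto simp: cell_iff field_simps)
    qed
  qed (rule cell_event I)+
  also have "\<dots> = measure lborel ?I" by (simp add: measure_def emeasure_unit_interval I)
  also have "\<dots> = 1 / real m" using m by (simp add: field_simps)
  finally show ?thesis .
qed

lemma integrable_unit_bounded:
  assumes "f \<in> borel_measurable unit_interval" "\<And>x. x \<in> {0..1} \<Longrightarrow> \<bar>f x\<bar> \<le> (C::real)"
  shows "integrable unit_interval f"
  by (rule UI.integrable_const_bound[of _ C]) (use assms in \<open>auto intro!: AE_I2\<close>)

lemma integral_cell:
  fixes h :: "nat \<Rightarrow> real"
  assumes "0 < m"
  shows "(\<integral>u. h (cell m u) \<partial>unit_interval) = (\<Sum>i<m. h i) / real m"
proof -
  have eq: "h (cell m u) = (\<Sum>i<m. h i * indicator {x \<in> {0..1}. cell m x = i} u)" if "u \<in> {0..1}" for u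
  proof -
    have "(\<Sum>i<m. h i * indicator {x \<in> {0..1}. cell m x = i} u) = (\<Sum>i<m. if i = cell m u then h i else 0)"
      using that by (intro sum.cong) (auto simp: indicator_def)
    then show ?thesis using cell_less[OF assms, of u] by simp
  qed
  have int: "integrable unit_interval (\<lambda>u. h i * indicator {x \<in> {0..1}. cell m x = i} u)" for i
    by (intro integrable_mult_right integrable_unit_bounded[of _ 1] borel_measurable_indicator cell_event)
      (auto simp: indicator_def)
  have "(\<integral>u. h (cell m u) \<partial>unit_interval) = (\<integral>u. (\<Sum>i<m. h i * indicator {x \<in> {0..1}. cell m x = i} u) \<partial>unit_interval)"
    by (intro Bochner_Integration.integral_cong) (use eq in auto)
  also have "\<dots> = (\<Sum>i<m. h i * measure unit_interval {x \<in> {0..1}. cell m x = i})"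
    by (subst Bochner_Integration.integral_sum)
      (rule int, simp add: Int_def conj_ac)
  also have "\<dots> = (\<Sum>i<m. h i / real m)"
    by (intro sum.cong refl) (subst prob_cell_eq, auto)
  finally show ?thesis by (simp add: sum_divide_distrib)
qed

text \<open>The Bochner integral of a non-integrable function is 0 by convention, so
  \<open>kernel_norm2\<close> obeys the triangle inequality only where squares are integrable.
  Bounded measurable kernels contain graphons and step kernels and are closed under all operations
  applied to them here.\<close>

definition bounded_kernel :: "(real \<Rightarrow> real \<Rightarrow> real) \<Rightarrow> bool" where
  "bounded_kernel f \<longleftrightarrow>
     (\<lambda>(x, y). f x y) \<in> borel_measurable unit_square \<and>
     (\<exists>C. \<forall>x\<in>{0..1}. \<forall>y\<in>{0..1}. \<bar>f x y\<bar> \<le> C)"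

lemma bounded_kernelE:
  assumes "bounded_kernel f"
  obtains C where "0 \<le> C" "\<And>x y. x \<in> {0..1} \<Longrightarrow> y \<in> {0..1} \<Longrightarrow> \<bar>f x y\<bar> \<le> C"
proof -
  obtain C where C: "\<forall>x\<in>{0..1}. \<forall>y\<in>{0..1}. \<bar>f x y\<bar> \<le> C" using assms by (auto simp: bounded_kernel_def)
  from C[rule_format, of 0 0] have "0 \<le> C" by simp
  show ?thesis by (rule that[OF \<open>0 \<le> C\<close>]) (use C in blast)
qed

lemma bounded_kernel_measurable:
  "bounded_kernel f \<Longrightarrow> (\<lambda>p. f (fst p) (snd p)) \<in> borel_measurable unit_square"
  by (simp add: bounded_kernel_def case_prod_beta')

lemma bounded_kernelI:
  assumes "(\<lambda>p. f (fst p) (snd p)) \<in> borel_measurable unit_square"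
    "\<And>x y. x \<in> {0..1} \<Longrightarrow> y \<in> {0..1} \<Longrightarrow> \<bar>f x y\<bar> \<le> C"
  shows "bounded_kernel f"
  unfolding bounded_kernel_def case_prod_beta' using assms by blast

lemma bounded_kernel_diff:
  assumes f: "bounded_kernel f" and g: "bounded_kernel g"
  shows "bounded_kernel (\<lambda>x y. f x y - g x y)"
proof -
  obtain C where C: "0 \<le> C" "\<And>x y. x \<in> {0..1} \<Longrightarrow> y \<in> {0..1} \<Longrightarrow> \<bar>f x y\<bar> \<le> C"
    by (rule bounded_kernelE[OF f]) (rule that)
  obtain D where D: "0 \<le> D" "\<And>x y. x \<in> {0..1} \<Longrightarrow> y \<in> {0..1} \<Longrightarrow> \<bar>g x y\<bar> \<le> D"
    by (rule bounded_kernelE[OF g]) (rule that)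
  show ?thesis
  proof (rule bounded_kernelI)
    fix x y :: real assume xy: "x \<in> {0..1}" "y \<in> {0..1}"
    show "\<bar>f x y - g x y\<bar> \<le> C + D"
      using C(2)[OF xy] D(2)[OF xy] by linarith
  qed (use bounded_kernel_measurable[OF f] bounded_kernel_measurable[OF g] in measurable)
qed

lemma bounded_kernel_scale:
  assumes f: "bounded_kernel f"
  shows "bounded_kernel (\<lambda>x y. c * f x y)"
proof -
  obtain C where C: "0 \<le> C" "\<And>x y. x \<in> {0..1} \<Longrightarrow> y \<in> {0..1} \<Longrightarrow> \<bar>f x y\<bar> \<le> C"
    by (rule bounded_kernelE[OF f]) (rule that)
  show ?thesis
  proof (rule bounded_kernelI)
    fix x y :: real assume xy: "x \<in> {0..1}" "y \<in> {0..1}"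
    show "\<bar>c * f x y\<bar> \<le> \<bar>c\<bar> * C"
      using C(2)[OF xy] by (simp add: abs_mult mult_left_mono)
  qed (use bounded_kernel_measurable[OF f] in measurable)
qed

lemma bounded_kernel_step:
  assumes "0 < m"
  shows "bounded_kernel (step_kernel m A)"
proof (rule bounded_kernelI)
  show "(\<lambda>p. step_kernel m A (fst p) (snd p)) \<in> borel_measurable unit_square"
    unfolding step_kernel_def by measurable
  show "\<bar>step_kernel m A x y\<bar> \<le> (\<Sum>i<m. \<Sum>j<m. \<bar>A i j\<bar>)" for x y
  proof -
    have "\<bar>A (cell m x) (cell m y)\<bar> \<le> (\<Sum>j<m. \<bar>A (cell m x) j\<bar>)"
      using assms by (intro member_le_sum) (auto simp: cell_less)
    also have "\<dots> \<le> (\<Sum>i<m. \<Sum>j<m. \<bar>A i j\<bar>)"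
      using assms by (intro member_le_sum[of _ _ "\<lambda>i. \<Sum>j<m. \<bar>A i j\<bar>"]) (auto simp: cell_less sum_nonneg)
    finally show ?thesis by (simp add: step_kernel_def)
  qed
qed

lemma graphon_bounded_kernel:
  assumes "graphon W" shows "bounded_kernel W"
proof -
  obtain C where "\<forall>x\<in>{0..1}. \<forall>y\<in>{0..1}. W x y \<le> C" using assms by (auto simp: graphon_def)
  then show ?thesis using assms
    by (auto simp: bounded_kernel_def graphon_def)
qed

lemma integrable_bounded_kernel:
  assumes f: "bounded_kernel f"
  shows "integrable unit_square (\<lambda>p. f (fst p) (snd p))"
proof -
  obtain C where C: "0 \<le> C" "\<And>x y. x \<in> {0..1} \<Longrightarrow> y \<in> {0..1} \<Longrightarrow> \<bar>f x y\<bar> \<le> C"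
    by (rule bounded_kernelE[OF f]) (rule that)
  show ?thesis
    by (rule UI2.P.integrable_const_bound[of _ C])
      (auto intro!: AE_I2 C(2) bounded_kernel_measurable f simp: space_pair_measure)
qed

lemma bounded_kernel_square:
  assumes f: "bounded_kernel f"
  shows "bounded_kernel (\<lambda>x y. (f x y)\<^sup>2)"
proof -
  obtain C where C: "0 \<le> C" "\<And>x y. x \<in> {0..1} \<Longrightarrow> y \<in> {0..1} \<Longrightarrow> \<bar>f x y\<bar> \<le> C"
    by (rule bounded_kernelE[OF f]) (rule that)
  show ?thesis
  proof (rule bounded_kernelI)
    fix x y :: real assume xy: "x \<in> {0..1}" "y \<in> {0..1}"
    show "\<bar>(f x y)\<^sup>2\<bar> \<le> C\<^sup>2"
      using C(2)[OF xy] C(1) by (simp add: abs_le_square_iff[symmetric])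
  qed (use bounded_kernel_measurable[OF f] in measurable)
qed

lemma kernel_norm2_alt: "kernel_norm2 f = sqrt (\<integral>p. (f (fst p) (snd p))\<^sup>2 \<partial>unit_square)"
  by (simp add: kernel_norm2_def case_prod_beta')

lemma kernel_norm2_nonneg [simp]: "0 \<le> kernel_norm2 f"
  by (simp add: kernel_norm2_alt)

lemma kernel_norm2_square: "(kernel_norm2 f)\<^sup>2 = (\<integral>p. (f (fst p) (snd p))\<^sup>2 \<partial>unit_square)"
  by (simp add: kernel_norm2_alt)

lemma kernel_norm2_mono:
  assumes "bounded_kernel g" "bounded_kernel f"
    "\<And>x y. x \<in> {0..1} \<Longrightarrow> y \<in> {0..1} \<Longrightarrow> \<bar>f x y\<bar> \<le> \<bar>g x y\<bar>"
  shows "kernel_norm2 f \<le> kernel_norm2 g"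
  unfolding kernel_norm2_alt real_sqrt_le_iff
  by (rule integral_mono[OF integrable_bounded_kernel[OF bounded_kernel_square[OF assms(2)]]
        integrable_bounded_kernel[OF bounded_kernel_square[OF assms(1)]]])
     (use assms(3) in \<open>auto simp: space_pair_measure abs_le_square_iff\<close>)

text \<open>The convention for \<open>cell\<close> at 1 breaks identities between permuted step
  kernels there. The lines on which a coordinate equals 1 are null, so the half-open square
  decides.\<close>

lemma kernel_norm2_cong_AE:
  assumes "bounded_kernel g" "bounded_kernel f"
    "\<And>x y. 0 \<le> x \<Longrightarrow> x < 1 \<Longrightarrow> 0 \<le> y \<Longrightarrow> y < 1 \<Longrightarrow> f x y = g x y"
  shows "kernel_norm2 f = kernel_norm2 g"
proof -
  have 1: "AE p in unit_square. fst p < 1 \<and> snd p < 1"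
  proof (rule UI2.AE_pair_measure)
    have [measurable]: "(\<lambda>x. x) \<in> borel_measurable unit_interval"
      by (rule measurable_unit_interval_borel) simp
    show "{p \<in> space unit_square. fst p < 1 \<and> snd p < 1} \<in> sets unit_square"
      by measurable
    show "AE x in unit_interval. AE y in unit_interval. fst (x, y) < 1 \<and> snd (x, y) < 1"
    proof (rule AE_mp[OF AE_unit_interval_less_1], rule AE_I2, rule impI)
      fix x :: real assume "x < 1"
      then show "AE y in unit_interval. fst (x, y) < 1 \<and> snd (x, y) < 1"
        using AE_unit_interval_less_1 by simp
    qed
  qed
  show ?thesis
    unfolding kernel_norm2_alt
  proof (rule arg_cong[of _ _ sqrt], rule integral_cong_AE)
    show "(\<lambda>p. (f (fst p) (snd p))\<^sup>2) \<in> borel_measurable unit_square"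
      using bounded_kernel_measurable[OF assms(2)] by measurable
    show "(\<lambda>p. (g (fst p) (snd p))\<^sup>2) \<in> borel_measurable unit_square"
      using bounded_kernel_measurable[OF assms(1)] by measurable
    show "AE p in unit_square. (f (fst p) (snd p))\<^sup>2 = (g (fst p) (snd p))\<^sup>2"
      by (rule AE_mp[OF 1], rule AE_I2) (use assms(3) in \<open>auto simp: space_pair_measure\<close>)
  qed
qed

lemma kernel_norm2_le_const:
  assumes "bounded_kernel f" "\<And>x y. x \<in> {0..1} \<Longrightarrow> y \<in> {0..1} \<Longrightarrow> \<bar>f x y\<bar> \<le> C"
  shows "kernel_norm2 f \<le> C"
proof -
  have C: "0 \<le> C" using assms(2)[of 0 0] by simp
  have "kernel_norm2 f \<le> kernel_norm2 (\<lambda>x y. C)"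
  proof (rule kernel_norm2_mono)
    show "bounded_kernel (\<lambda>x y. C)"
      by (rule bounded_kernelI[of _ "\<bar>C\<bar>"]) auto
    show "\<bar>f x y\<bar> \<le> \<bar>C\<bar>" if "x \<in> {0..1}" "y \<in> {0..1}" for x y
      using assms(2)[OF that] C by simp
  qed (rule assms(1))
  also have "\<dots> = C" using C by (simp add: kernel_norm2_alt UI2.P.prob_space)
  finally show ?thesis .
qed

abbreviation kernel_dist :: "(real \<Rightarrow> real \<Rightarrow> real) \<Rightarrow> (real \<Rightarrow> real \<Rightarrow> real) \<Rightarrow> real" where
  "kernel_dist f g \<equiv> kernel_norm2 (\<lambda>x y. f x y - g x y)"

text \<open>Integrating (u - v)^2 \<le> (1 + b/a) u^2 + (1 + a/b) v^2, with a and b slightly above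
  the two norms, yields (a + b)^2. The excess e/2 keeps the divisors positive when a norm
  vanishes.\<close>

lemma kernel_norm2_triangle:
  assumes f: "bounded_kernel f" and g: "bounded_kernel g"
  shows "kernel_dist f g \<le> kernel_norm2 f + kernel_norm2 g"
proof (rule field_le_epsilon)
  fix e :: real assume e: "0 < e"
  define a b where "a = kernel_norm2 f + e / 2" and "b = kernel_norm2 g + e / 2"
  have ab: "0 < a" "0 < b" using e kernel_norm2_nonneg[of f] kernel_norm2_nonneg[of g]
    unfolding a_def b_def by linarith+
  have pt: "(u - v)\<^sup>2 \<le> (1 + b / a) * u\<^sup>2 + (1 + a / b) * v\<^sup>2" for u v :: real
  proof -
    have "(1 + b / a) * u\<^sup>2 + (1 + a / b) * v\<^sup>2 - (u - v)\<^sup>2 = (b * u + a * v)\<^sup>2 / (a * b)"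
      using ab by (simp add: field_simps power2_eq_square)
    also have "\<dots> \<ge> 0" using ab by simp
    finally show ?thesis by simp
  qed
  have i: "integrable unit_square (\<lambda>p. (f (fst p) (snd p))\<^sup>2)"
     "integrable unit_square (\<lambda>p. (g (fst p) (snd p))\<^sup>2)"
    by (rule integrable_bounded_kernel[OF bounded_kernel_square[OF f]] integrable_bounded_kernel[OF bounded_kernel_square[OF g]])+
  have "(kernel_dist f g)\<^sup>2
     \<le> (\<integral>p. (1 + b / a) * (f (fst p) (snd p))\<^sup>2 + (1 + a / b) * (g (fst p) (snd p))\<^sup>2 \<partial>unit_square)"
    unfolding kernel_norm2_square
    by (rule integral_mono[OF integrable_bounded_kernel[OF bounded_kernel_square[OF bounded_kernel_diff[OF f g]]]
          Bochner_Integration.integrable_add[OF integrable_mult_right[OF i(1)] integrable_mult_right[OF i(2)]] pt])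
  also have "\<dots> = (1 + b / a) * (kernel_norm2 f)\<^sup>2 + (1 + a / b) * (kernel_norm2 g)\<^sup>2"
    using i by (simp add: kernel_norm2_square)
  also have "\<dots> \<le> (1 + b / a) * a\<^sup>2 + (1 + a / b) * b\<^sup>2"
    using ab e by (intro add_mono mult_left_mono power_mono) (auto simp: a_def b_def)
  also have "\<dots> = (a + b)\<^sup>2"
  proof -
    have "(1 + b / a) * a\<^sup>2 = a\<^sup>2 + a * b" "(1 + a / b) * b\<^sup>2 = b\<^sup>2 + a * b"
      using ab by (simp_all add: distrib_right power2_eq_square)
    then show ?thesis by (simp add: power2_sum)
  qed
  finally have "kernel_dist f g \<le> a + b"
    by (rule power2_le_imp_le) (use ab in simp)
  then show "kernel_dist f g \<le> kernel_norm2 f + kernel_norm2 g + e"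
    by (simp add: a_def b_def)
qed

lemma kernel_norm2_minus_commute: "kernel_dist f g = kernel_dist g f"
  by (simp add: kernel_norm2_alt power2_commute)

lemma kernel_norm2_dist_triangle:
  assumes "bounded_kernel f" "bounded_kernel g" "bounded_kernel h"
  shows "kernel_dist f h \<le> kernel_dist f g + kernel_dist g h"
  using kernel_norm2_triangle[OF bounded_kernel_diff[OF assms(1,2)] bounded_kernel_diff[OF assms(3,2)]]
  by (simp add: kernel_norm2_minus_commute[of h g])

lemma kernel_norm2_step:
  assumes "0 < m"
  shows "kernel_norm2 (step_kernel m A) = matrix_norm2 m A"
proof -
  have "(\<integral>p. (step_kernel m A (fst p) (snd p))\<^sup>2 \<partial>unit_square)
    = (\<integral>x. (\<integral>y. (step_kernel m A x y)\<^sup>2 \<partial>unit_interval) \<partial>unit_interval)"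
    using UI2.integral_fst'[OF integrable_bounded_kernel[OF bounded_kernel_square[OF bounded_kernel_step[OF assms, of A]]]]
    by (simp add: case_prod_beta')
  also have "\<dots> = (\<integral>x. (\<Sum>j<m. (A (cell m x) j)\<^sup>2) / real m \<partial>unit_interval)"
    unfolding step_kernel_def by (subst integral_cell[OF assms]) simp
  also have "\<dots> = (\<Sum>i<m. \<Sum>j<m. (A i j)\<^sup>2) / (real m)\<^sup>2"
    by (subst integral_cell[OF assms, of "\<lambda>i. (\<Sum>j<m. (A i j)\<^sup>2) / real m"])
      (simp add: sum_divide_distrib power2_eq_square)
  finally show ?thesis by (simp add: kernel_norm2_alt matrix_norm2_def)
qed

text \<open>Each of the m intervals is cut into k consecutive ones. Applied with the factors in both
  orders, this makes the n*k intervals a common refinement on which an n-step and a k-step kernel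
  are compared.\<close>

lemma cell_mult:
  assumes "0 < m" "0 < k" "x \<in> {0..1}"
  shows "cell m x = cell (m * k) x div k"
proof (cases "x = 1")
  case True
  obtain m' k' where "m = Suc m'" "k = Suc k'" using assms by (metis gr0_conv_Suc)
  then have "m * k - 1 = k' + m' * k" "k' < k" "m - 1 = m'" by simp_all
  then have "(m * k - 1) div k = m - 1" by simp
  moreover have "cell j 1 = j - 1" for j by (simp add: cell_def)
  ultimately show ?thesis using True by simp
next
  case False
  then have x: "0 \<le> x" "x < 1" using assms by auto
  have "\<lfloor>real m * x\<rfloor> = \<lfloor>real (m * k) * x\<rfloor> div int k"
    using floor_divide_real_eq_div[of "int k" "real (m * k) * x"] assms by simp
  then show ?thesis using x assms by (simp add: cell_eq nat_div_distrib)
qed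

lemma matrix_norm2_triangle:
  assumes "0 < m"
  shows "matrix_norm2 m (\<lambda>i j. A i j - C i j) \<le> matrix_norm2 m (\<lambda>i j. A i j - B i j) + matrix_norm2 m (\<lambda>i j. B i j - C i j)"
  using kernel_norm2_dist_triangle[OF bounded_kernel_step bounded_kernel_step bounded_kernel_step, OF assms assms assms, of A C B]
    kernel_norm2_step[OF assms, of "\<lambda>i j. A i j - C i j"] kernel_norm2_step[OF assms, of "\<lambda>i j. B i j - C i j"]
    kernel_norm2_step[OF assms, of "\<lambda>i j. A i j - B i j"]
  by (simp add: step_kernel_def[abs_def])

section \<open>Interval permutations as measure-preserving bijections\<close>

lemma delta2_le:
  assumes "\<phi> \<in> measure_preserving_bijections"
  shows "delta2 U V \<le> kernel_norm2 (\<lambda>x y. U (\<phi> x) (\<phi> y) - V x y)"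
  unfolding delta2_def by (rule cINF_lower[OF bdd_belowI2[of _ 0] assms]) simp

lemma id_measure_preserving: "(\<lambda>x. x) \<in> measure_preserving_bijections"
  by (auto simp: measure_preserving_bijections_def bij_betw_def distr_id2)

lemma bounded_kernel_compose:
  assumes f: "bounded_kernel f" and \<phi>: "\<phi> \<in> measure_preserving_bijections"
  shows "bounded_kernel (\<lambda>x y. f (\<phi> x) (\<phi> y))"
proof -
  obtain C where C: "0 \<le> C" "\<And>x y. x \<in> {0..1} \<Longrightarrow> y \<in> {0..1} \<Longrightarrow> \<bar>f x y\<bar> \<le> C"
    by (rule bounded_kernelE[OF f]) (rule that)
  have m [measurable]: "\<phi> \<in> unit_interval \<rightarrow>\<^sub>M unit_interval" and b: "\<And>x. x \<in> {0..1} \<Longrightarrow> \<phi> x \<in> {0..1}"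
    using \<phi> by (auto simp: measure_preserving_bijections_def bij_betw_def)
  show ?thesis
  proof (rule bounded_kernelI)
    fix x y :: real assume "x \<in> {0..1}" "y \<in> {0..1}"
    then show "\<bar>f (\<phi> x) (\<phi> y)\<bar> \<le> C" by (intro C(2) b)
  next
    have "(\<lambda>p. (\<phi> (fst p), \<phi> (snd p))) \<in> unit_square \<rightarrow>\<^sub>M unit_square"
      by measurable
    from measurable_compose[OF this bounded_kernel_measurable[OF f]]
    show "(\<lambda>p. f (\<phi> (fst p)) (\<phi> (snd p))) \<in> borel_measurable unit_square"
      by simp
  qed
qed

lemma kernel_norm2_compose:
  assumes f: "bounded_kernel f" and \<phi>: "\<phi> \<in> measure_preserving_bijections"
  shows "kernel_norm2 (\<lambda>x y. f (\<phi> x) (\<phi> y)) = kernel_norm2 f"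
proof -
  have m [measurable]: "\<phi> \<in> unit_interval \<rightarrow>\<^sub>M unit_interval" and d: "distr unit_interval unit_interval \<phi> = unit_interval"
    using \<phi> by (auto simp: measure_preserving_bijections_def)
  have "unit_square
      = distr unit_square unit_square (\<lambda>(x, y). (\<phi> x, \<phi> y))"
    using pair_measure_distr[OF m m] UI.sigma_finite_measure_axioms by (simp add: d)
  then have "(\<integral>p. (f (fst p) (snd p))\<^sup>2 \<partial>unit_square)
    = (\<integral>p. (f (fst p) (snd p))\<^sup>2 \<partial>distr unit_square unit_square (\<lambda>(x, y). (\<phi> x, \<phi> y)))"
    by simp
  also have "\<dots> = (\<integral>p. (f (\<phi> (fst p)) (\<phi> (snd p)))\<^sup>2 \<partial>unit_square)"
    using bounded_kernel_measurable[OF f]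
    by (subst integral_distr) (auto simp: case_prod_beta')
  finally show ?thesis by (simp add: kernel_norm2_alt)
qed

text \<open>The intervals of length \<open>1/n\<close> are half open except for the last one, so that an interval
  permutation has to fix the point 1 in order to be a bijection of the closed unit interval.\<close>

definition interval_perm :: "nat \<Rightarrow> (nat \<Rightarrow> nat) \<Rightarrow> real \<Rightarrow> real" where
  "interval_perm n \<tau> u = (if u < 1 then u + (real (\<tau> (cell n u)) - real (cell n u)) / real n else u)"

lemma interval_perm_bounds:
  assumes "\<tau> permutes {..<n}" "0 < n" "0 \<le> u" "u < 1"
  shows "0 \<le> interval_perm n \<tau> u" "interval_perm n \<tau> u < 1" "cell n (interval_perm n \<tau> u) = \<tau> (cell n u)"
proof -
  let ?i = "cell n u" and ?v = "interval_perm n \<tau> u"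
  have i: "real ?i \<le> real n * u" "real n * u < real ?i + 1"
    using cell_iff[of u n ?i] assms by auto
  have t: "\<tau> ?i < n" using permutes_in_image[OF assms(1), of ?i] cell_less[OF assms(2), of u] by simp
  have v: "real n * ?v = real n * u + (real (\<tau> ?i) - real ?i)"
    using assms by (simp add: interval_perm_def field_simps)
  have nv: "real (\<tau> ?i) \<le> real n * ?v" "real n * ?v < real (\<tau> ?i) + 1" using i v by linarith+
  have "0 \<le> real n * ?v" using nv(1) by (meson of_nat_0_le_iff order_trans)
  then show 0: "0 \<le> ?v" using assms(2) by (simp add: zero_le_mult_iff)
  have "real (\<tau> ?i) + 1 \<le> real n" using t by linarith
  then have "real n * ?v < real n * 1" using nv(2) by linarith
  then show 1: "?v < 1" using assms(2) by (simp only: mult_less_cancel_left_pos of_nat_0_less_iff)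
  show "cell n ?v = \<tau> ?i" using cell_iff[of ?v n] 0 1 nv assms(2) by blast
qed

lemma interval_perm_inverse:
  assumes "\<tau> permutes {..<n}" "0 < n" "u \<in> {0..1}"
  shows "interval_perm n (inv \<tau>) (interval_perm n \<tau> u) = u"
proof (cases "u < 1")
  case True
  have "interval_perm n \<tau> u < 1" "cell n (interval_perm n \<tau> u) = \<tau> (cell n u)"
    using interval_perm_bounds[OF assms(1,2) _ True] assms(3) by auto
  then show ?thesis using True assms
    by (simp add: interval_perm_def[of n "inv \<tau>"] permutes_inverses[OF assms(1)])
       (simp add: interval_perm_def diff_divide_distrib)
qed (simp add: interval_perm_def)

lemma measurable_interval_perm:
  assumes "\<tau> permutes {..<n}" "0 < n"
  shows "interval_perm n \<tau> \<in> unit_interval \<rightarrow>\<^sub>M unit_interval"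
proof -
  have [measurable]: "(\<lambda>x. x) \<in> borel_measurable unit_interval"
    by (rule measurable_unit_interval_borel) simp
  have [measurable]: "(\<lambda>u. real (\<tau> (cell n u))) \<in> borel_measurable unit_interval"
    "(\<lambda>u. real (cell n u)) \<in> borel_measurable unit_interval"
    by (rule measurable_compose[OF measurable_cell], simp)+
  have m: "interval_perm n \<tau> \<in> borel_measurable unit_interval"
    unfolding interval_perm_def[abs_def] by measurable
  have "interval_perm n \<tau> \<in> space unit_interval \<rightarrow> {0..1}"
  proof
    fix u assume "u \<in> space unit_interval"
    then show "interval_perm n \<tau> u \<in> {0..1}"
      using interval_perm_bounds[OF assms, of u] by (cases "u < 1") (auto simp: interval_perm_def)
  qed
  with m show ?thesis
    by (subst (2) unit_interval_def) (simp add: measurable_restrict_space2_iff)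
qed

lemma emeasure_unit_interval_split:
  assumes A: "A \<in> sets unit_interval" and n: "0 < n"
  shows "emeasure unit_interval A = (\<Sum>i<n. emeasure lborel (A \<inter> {real i / real n ..< (real i + 1) / real n}))"
proof -
  let ?I = "\<lambda>i. {real i / real n ..< (real i + 1) / real n}"
  have A': "A \<in> sets borel" "A \<subseteq> {0..1}" using A by (auto simp: unit_interval_def sets_restrict_space_iff)
  have "emeasure unit_interval A = emeasure lborel A" using A by (rule emeasure_unit_interval)
  \<comment> \<open>The half-open intervals miss the point 1, which is null.\<close>
  also have "\<dots> = emeasure lborel (A - {1})"
    using A' by (intro emeasure_Diff_null_set[symmetric]) auto
  also have "A - {1} = (\<Union>i\<in>{..<n}. A \<inter> ?I i)"
  proof (intro equalityI subsetI)
    fix x assume x: "x \<in> A - {1}"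
    then have "0 \<le> x" "x < 1" using A' by auto
    then have "x \<in> ?I (cell n x)" using cell_iff[of x n "cell n x"] n by (auto simp: field_simps)
    then show "x \<in> (\<Union>i\<in>{..<n}. A \<inter> ?I i)" using x cell_less[OF n] by blast
  next
    fix x assume "x \<in> (\<Union>i\<in>{..<n}. A \<inter> ?I i)"
    then obtain i where i: "i < n" "x \<in> A" "x < (real i + 1) / real n" by auto
    have "(real i + 1) / real n \<le> 1" using i by simp
    then show "x \<in> A - {1}" using i by auto
  qed
  also have "emeasure lborel \<dots> = (\<Sum>i<n. emeasure lborel (A \<inter> ?I i))"
  proof (rule sum_emeasure[symmetric])
    show "(\<lambda>i. A \<inter> ?I i) ` {..<n} \<subseteq> sets lborel" using A' by auto
    show "disjoint_family_on (\<lambda>i. A \<inter> ?I i) {..<n}"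
    proof (unfold disjoint_family_on_def, intro ballI impI)
      fix i j assume ij: "i \<in> {..<n}" "j \<in> {..<n}" "i \<noteq> j"
      show "(A \<inter> ?I i) \<inter> (A \<inter> ?I j) = {}"
      proof (rule ccontr)
        assume "\<not> ?thesis"
        then obtain x where "x \<in> ?I i" "x \<in> ?I j" by blast
        then have "real i < real j + 1" "real j < real i + 1" using n by (auto simp: field_simps intro: le_less_trans)
        with ij show False by linarith
      qed
    qed
  qed simp
  finally show ?thesis .
qed

text \<open>On interval i the map is a translation onto interval \<open>\<tau> i\<close>.
  Translation invariance of \<open>lborel\<close> treats each summand of
  \<open>emeasure_unit_interval_split\<close>, and permuting the summands by \<open>\<tau>\<close>
  restores the measure.\<close>

lemma interval_perm_measure_preserving:
  assumes \<tau>: "\<tau> permutes {..<n}" and n: "0 < n"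
  shows "interval_perm n \<tau> \<in> measure_preserving_bijections"
proof -
  let ?\<phi> = "interval_perm n \<tau>"
  let ?I = "\<lambda>i. {real i / real n ..< (real i + 1) / real n}"
  have I: "x \<in> ?I i \<longleftrightarrow> real i \<le> real n * x \<and> real n * x < real i + 1" for x i
    using n by (auto simp: field_simps)
  note m = measurable_interval_perm[OF \<tau> n]
  note \<tau>' = permutes_inv[OF \<tau>]
  have in01: "interval_perm n t u \<in> {0..1}" if "u \<in> {0..1}" "t permutes {..<n}" for t u
    using measurable_space[OF measurable_interval_perm[OF that(2) n], of u] that(1) by simp
  have bij: "bij_betw ?\<phi> {0..1} {0..1}"
  proof (rule bij_betw_byWitness[of _ "interval_perm n (inv \<tau>)"])
    show "\<forall>a\<in>{0..1}. interval_perm n (inv \<tau>) (?\<phi> a) = a" using interval_perm_inverse[OF \<tau> n] by blast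
    show "\<forall>a\<in>{0..1}. ?\<phi> (interval_perm n (inv \<tau>) a) = a"
      using interval_perm_inverse[OF \<tau>' n] by (simp add: permutes_inv_inv[OF \<tau>])
  qed (use in01 \<tau> \<tau>' in blast)+
  have "distr unit_interval unit_interval ?\<phi> = unit_interval"
  proof (rule measure_eqI)
    fix A assume "A \<in> sets (distr unit_interval unit_interval ?\<phi>)"
    then have A: "A \<in> sets unit_interval" by simp
    then have A': "A \<in> sets borel" "A \<subseteq> {0..1}" by (auto simp: unit_interval_def sets_restrict_space_iff)
    let ?B = "?\<phi> -` A \<inter> space unit_interval"
    have B: "?B \<in> sets unit_interval" using m A by (rule measurable_sets)
    have shift: "emeasure lborel (?B \<inter> ?I i) = emeasure lborel (A \<inter> ?I (\<tau> i))" if i: "i < n" for i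
    proof -
      let ?c = "(real (\<tau> i) - real i) / real n"
      have i1: "(real i + 1) / real n \<le> 1" using i by simp
      have "?B \<inter> ?I i = (+) ?c -` (A \<inter> ?I (\<tau> i))"
      proof (intro equalityI subsetI)
        fix x assume x: "x \<in> ?B \<inter> ?I i"
        then have x01: "0 \<le> x" "x < 1" using i1 by auto
        have xi: "x \<in> ?I i" using x by blast
        then have c: "cell n x = i" using x01 n I by (subst cell_iff) auto
        then have "?\<phi> x = ?c + x" using x01 by (simp add: interval_perm_def)
        moreover have "real n * (?c + x) = real (\<tau> i) - real i + real n * x" using n by (simp add: distrib_left)
        ultimately show "x \<in> (+) ?c -` (A \<inter> ?I (\<tau> i))"
          using x xi unfolding vimage_eq Int_iff I by auto
      next
        fix x assume x: "x \<in> (+) ?c -` (A \<inter> ?I (\<tau> i))"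
        have "real n * (?c + x) = real (\<tau> i) - real i + real n * x" using n by (simp add: distrib_left)
        then have xi: "x \<in> ?I i" using x unfolding vimage_eq Int_iff I by auto
        moreover have "0 \<le> real i / real n" by simp
        ultimately have x01: "0 \<le> x" "x < 1" using i1 by (auto simp del: divide_nonneg_nonneg zero_le_divide_iff)
        then have c: "cell n x = i" using xi n I by (subst cell_iff) auto
        then have "?\<phi> x = ?c + x" using x01 by (simp add: interval_perm_def)
        then show "x \<in> ?B \<inter> ?I i" using x xi x01 by auto
      qed
      moreover have "emeasure lborel ((+) ?c -` (A \<inter> ?I (\<tau> i))) = emeasure (distr lborel borel ((+) ?c)) (A \<inter> ?I (\<tau> i))"
        using A' by (subst emeasure_distr) auto
      ultimately show ?thesis by (simp add: lborel_distr_plus)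
    qed
    have "emeasure (distr unit_interval unit_interval ?\<phi>) A = emeasure unit_interval ?B"
      using m A by (rule emeasure_distr)
    also have "\<dots> = (\<Sum>i<n. emeasure lborel (A \<inter> ?I (\<tau> i)))"
      by (subst emeasure_unit_interval_split[OF B n]) (rule sum.cong[OF refl], rule shift, simp)
    also have "\<dots> = (\<Sum>i<n. emeasure lborel (A \<inter> ?I i))"
      using sum.permute[OF \<tau>, of "\<lambda>i. emeasure lborel (A \<inter> ?I i)"] by (simp add: o_def)
    also have "\<dots> = emeasure unit_interval A" by (rule emeasure_unit_interval_split[OF A n, symmetric])
    finally show "emeasure (distr unit_interval unit_interval ?\<phi>) A = emeasure unit_interval A" .
  qed simp
  with bij m show ?thesis by (simp add: measure_preserving_bijections_def)
qed

text \<open>Composition with the interval permutation does not change the distance of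
  \<open>W\<close> to the step kernel, and it turns that step kernel into the one of the permuted
  matrix off a null set. In use \<open>A\<close> is the optimally sorted sample matrix, so the first
  summand is \<open>eps_sample\<close>, while \<open>\<tau>\<close> reorders it to fit the estimated
  partition.\<close>

lemma delta2_le_step_permuted:
  assumes W: "bounded_kernel W" and V: "bounded_kernel V" and \<tau>: "\<tau> permutes {..<n}" and n: "0 < n"
  shows "delta2 W V \<le> kernel_dist (step_kernel n A) W
      + kernel_dist (step_kernel n (\<lambda>i j. A (\<tau> i) (\<tau> j))) V"
proof -
  let ?\<phi> = "interval_perm n \<tau>" and ?At = "\<lambda>i j. A (\<tau> i) (\<tau> j)"
  note \<phi> = interval_perm_measure_preserving[OF \<tau> n]
  have bs: "bounded_kernel (step_kernel n B)" for B using n by (rule bounded_kernel_step)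
  have A\<phi>: "bounded_kernel (\<lambda>x y. step_kernel n A (?\<phi> x) (?\<phi> y))"
    by (rule bounded_kernel_compose[OF bs \<phi>])
  have W\<phi>: "bounded_kernel (\<lambda>x y. W (?\<phi> x) (?\<phi> y))"
    by (rule bounded_kernel_compose[OF W \<phi>])
  have "delta2 W V \<le> kernel_norm2 (\<lambda>x y. W (?\<phi> x) (?\<phi> y) - V x y)" by (rule delta2_le[OF \<phi>])
  also have "\<dots> \<le> kernel_norm2 (\<lambda>x y. W (?\<phi> x) (?\<phi> y) - step_kernel n A (?\<phi> x) (?\<phi> y))
     + kernel_norm2 (\<lambda>x y. step_kernel n A (?\<phi> x) (?\<phi> y) - V x y)"
    by (rule kernel_norm2_dist_triangle[OF W\<phi> A\<phi> V])
  also have "kernel_norm2 (\<lambda>x y. W (?\<phi> x) (?\<phi> y) - step_kernel n A (?\<phi> x) (?\<phi> y))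
     = kernel_dist W (step_kernel n A)"
    by (rule kernel_norm2_compose[OF bounded_kernel_diff[OF W bs] \<phi>])
  also have "\<dots> = kernel_dist (step_kernel n A) W" by (rule kernel_norm2_minus_commute)
  also have "kernel_norm2 (\<lambda>x y. step_kernel n A (?\<phi> x) (?\<phi> y) - V x y) = kernel_dist (step_kernel n ?At) V"
    by (rule kernel_norm2_cong_AE[OF bounded_kernel_diff[OF bs V] bounded_kernel_diff[OF A\<phi> V]])
       (simp add: step_kernel_def interval_perm_bounds[OF \<tau> n])
  finally show ?thesis .
qed

section \<open>Aligning partitions\<close>

lemma card_permuted:
  assumes \<nu>: "\<nu> permutes {..<n}"
  shows "card {v\<in>{..<n}. P (\<nu> v)} = card {v\<in>{..<n}. P v}"
proof -
  have "\<nu> ` {v\<in>{..<n}. P (\<nu> v)} = {v\<in>{..<n}. P v}"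
  proof (intro equalityI subsetI)
    fix w assume w: "w \<in> {v\<in>{..<n}. P v}"
    then have "inv \<nu> w \<in> {v\<in>{..<n}. P (\<nu> v)}"
      using permutes_in_image[OF permutes_inv[OF \<nu>], of w] by (simp add: permutes_inverses[OF \<nu>])
    then show "w \<in> \<nu> ` {v\<in>{..<n}. P (\<nu> v)}" by (metis (no_types, lifting) image_eqI permutes_inverses(1)[OF \<nu>])
  qed (use permutes_in_image[OF \<nu>] in auto)
  then show ?thesis by (metis (no_types, lifting) card_image inj_on_subset permutes_inj[OF \<nu>] subset_UNIV)
qed

text \<open>Among all permutations take one with the most agreements \<open>f (\<nu> v) = g v\<close>: if both classes of \<open>i\<close>
  had an unmatched element, swapping two images would produce a further agreement.\<close>

lemma exists_matching_permutation:
  fixes f g :: "nat \<Rightarrow> nat"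
  obtains \<nu> where "\<nu> permutes {..<n}"
    "\<And>i. card {v\<in>{..<n}. f (\<nu> v) = i \<and> g v \<noteq> i} \<le> card {v\<in>{..<n}. f v = i} - card {v\<in>{..<n}. g v = i}"
    "\<And>i. card {v\<in>{..<n}. g v = i \<and> f (\<nu> v) \<noteq> i} \<le> card {v\<in>{..<n}. g v = i} - card {v\<in>{..<n}. f v = i}"
proof -
  define c where "c = (\<lambda>\<nu>. card {v\<in>{..<n}. f (\<nu> v) = g v})"
  let ?P = "{\<nu>. \<nu> permutes {..<n}}"
  have "finite (c ` ?P)" "c ` ?P \<noteq> {}" using permutes_id[of "{..<n}"] by (blast intro: finite_imageI finite_permutations)+
  then have "Max (c ` ?P) \<in> c ` ?P" by (rule Max_in)
  then obtain \<nu> where \<nu>: "\<nu> permutes {..<n}" and "c \<nu> = Max (c ` ?P)" by auto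
  then have max: "c \<nu>' \<le> c \<nu>" if "\<nu>' permutes {..<n}" for \<nu>'
    using that by (simp add: finite_permutations)
  have one_sided: "f (\<nu> v) \<noteq> i \<or> g v = i \<or> g w \<noteq> i \<or> f (\<nu> w) = i" if "v < n" "w < n" for v w i
  proof (rule ccontr)
    assume "\<not> ?thesis"
    then have a: "f (\<nu> v) = i" "g v \<noteq> i" "g w = i" "f (\<nu> w) \<noteq> i" by auto
    let ?\<nu>' = "\<nu> \<circ> Transposition.transpose v w"
    have p: "?\<nu>' permutes {..<n}"
      by (rule permutes_compose[OF permutes_swap_id \<nu>]) (use that in auto)
    have "insert w {v\<in>{..<n}. f (\<nu> v) = g v} \<subseteq> {v\<in>{..<n}. f (?\<nu>' v) = g v}"
      using a that by (auto simp: Transposition.transpose_def)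
    then have "card (insert w {v\<in>{..<n}. f (\<nu> v) = g v}) \<le> c ?\<nu>'"
      unfolding c_def by (rule card_mono[rotated]) simp
    then have "c \<nu> < c ?\<nu>'" using a by (simp add: c_def)
    with max[OF p] show False by simp
  qed
  have ca: "card {v\<in>{..<n}. f (\<nu> v) = i} = card {v\<in>{..<n}. f v = i}" for i
    by (rule card_permuted[OF \<nu>])
  \<comment> \<open>\<open>one_sided\<close> makes the two classes of \<open>i\<close> nested; the
    size of their set difference is then 0 or the difference of their sizes, and truncated
    subtraction covers both cases.\<close>
  have diff: "card {v\<in>{..<n}. P v \<and> \<not> Q v} = 0 \<or> card {v\<in>{..<n}. P v \<and> \<not> Q v} = card {v\<in>{..<n}. P v} - card {v\<in>{..<n}. Q v}"
    if "(\<forall>v<n. P v \<longrightarrow> Q v) \<or> (\<forall>v<n. Q v \<longrightarrow> P v)" for P Q :: "nat \<Rightarrow> bool"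
    using that
  proof
    assume "\<forall>v<n. P v \<longrightarrow> Q v"
    then have "{v\<in>{..<n}. P v \<and> \<not> Q v} = {}" by auto
    then show ?thesis by simp
  next
    assume a: "\<forall>v<n. Q v \<longrightarrow> P v"
    have "{v\<in>{..<n}. P v \<and> \<not> Q v} = {v\<in>{..<n}. P v} - {v\<in>{..<n}. Q v}" by auto
    moreover have "card \<dots> = card {v\<in>{..<n}. P v} - card {v\<in>{..<n}. Q v}"
      by (rule card_Diff_subset) (use a in auto)
    ultimately show ?thesis by simp
  qed
  show thesis
  proof (rule that[OF \<nu>])
    fix i
    have o: "(\<forall>v<n. f (\<nu> v) = i \<longrightarrow> g v = i) \<or> (\<forall>v<n. g v = i \<longrightarrow> f (\<nu> v) = i)"
      using one_sided by blast
    show "card {v\<in>{..<n}. f (\<nu> v) = i \<and> g v \<noteq> i} \<le> card {v\<in>{..<n}. f v = i} - card {v\<in>{..<n}. g v = i}"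
      using diff[of "\<lambda>v. f (\<nu> v) = i" "\<lambda>v. g v = i", OF o] ca[of i] by linarith
    show "card {v\<in>{..<n}. g v = i \<and> f (\<nu> v) \<noteq> i} \<le> card {v\<in>{..<n}. g v = i} - card {v\<in>{..<n}. f v = i}"
      using diff[of "\<lambda>v. g v = i" "\<lambda>v. f (\<nu> v) = i", OF o[THEN disj_commute[THEN iffD1]]] ca[of i] by linarith
  qed
qed

text \<open>Grouping the indices by their values under \<open>F\<close> gives \<open>h i j\<close>
  the weight of a product of two fibre sizes.\<close>

lemma sum_sum_comp_le:
  fixes h :: "nat \<Rightarrow> nat \<Rightarrow> real"
  assumes "finite A" "finite B" "F ` A \<subseteq> {..<k}" "F ` B \<subseteq> {..<k}"
    and h: "\<And>i j. 0 \<le> h i j"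
    and c: "\<And>i. i < k \<Longrightarrow> real (card {a\<in>A. F a = i}) \<le> c" "\<And>i. i < k \<Longrightarrow> real (card {a\<in>B. F a = i}) \<le> d"
  shows "(\<Sum>a\<in>A. \<Sum>b\<in>B. h (F a) (F b)) \<le> c * d * (\<Sum>i<k. \<Sum>j<k. h i j)"
proof -
  have "(\<Sum>a\<in>A. \<Sum>b\<in>B. h (F a) (F b)) = (\<Sum>a\<in>A. \<Sum>j<k. real (card {a\<in>B. F a = j}) * h (F a) j)"
    by (intro sum.cong refl) (rule sum_fun_comp, use assms in auto)
  also have "\<dots> = (\<Sum>i<k. real (card {a\<in>A. F a = i}) * (\<Sum>j<k. real (card {a\<in>B. F a = j}) * h i j))"
    by (rule sum_fun_comp) (use assms in auto)
  also have "\<dots> \<le> (\<Sum>i<k. c * (\<Sum>j<k. d * h i j))"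
  proof (intro sum_mono)
    fix i assume i: "i \<in> {..<k}"
    have *: "(\<Sum>j<k. real (card {a\<in>B. F a = j}) * h i j) \<le> (\<Sum>j<k. d * h i j)"
      by (intro sum_mono mult_right_mono c h) auto
    have "0 \<le> c" using c(1)[of i] i by (meson lessThan_iff of_nat_0_le_iff order_trans)
    with * show "real (card {a\<in>A. F a = i}) * (\<Sum>j<k. real (card {a\<in>B. F a = j}) * h i j) \<le> c * (\<Sum>j<k. d * h i j)"
      using i by (intro mult_mono c sum_nonneg mult_nonneg_nonneg h) auto
  qed
  also have "\<dots> = c * d * (\<Sum>i<k. \<Sum>j<k. h i j)"
    by (simp add: sum_distrib_left mult.assoc)
  finally show ?thesis .
qed

text \<open>A summand vanishes unless \<open>F\<close> and \<open>F'\<close> disagree at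
  \<open>a\<close> or at \<open>b\<close>. Elsewhere (u - v)^2 \<le> 2 u^2 + 2 v^2 splits it, and
  one index runs over the disagreement set, whose fibres have size at most \<open>d\<close>. This
  leaves four double sums, each with factor 2 and fibre weight \<open>c * d\<close>.\<close>

lemma sum_square_block_diff_le:
  fixes B :: "nat \<Rightarrow> nat \<Rightarrow> real" and F F' :: "nat \<Rightarrow> nat"
  assumes F: "F ` {..<N} \<subseteq> {..<k}" and F': "F' ` {..<N} \<subseteq> {..<k}"
    and c: "\<And>i. i < k \<Longrightarrow> real (card {a\<in>{..<N}. F a = i}) \<le> c" "\<And>i. i < k \<Longrightarrow> real (card {a\<in>{..<N}. F' a = i}) \<le> c"
    and d: "\<And>i. i < k \<Longrightarrow> real (card {a\<in>{..<N}. F a = i \<and> F' a \<noteq> i}) \<le> d"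
           "\<And>i. i < k \<Longrightarrow> real (card {a\<in>{..<N}. F' a = i \<and> F a \<noteq> i}) \<le> d"
  shows "(\<Sum>a<N. \<Sum>b<N. (B (F a) (F b) - B (F' a) (F' b))\<^sup>2) \<le> 8 * c * d * (\<Sum>i<k. \<Sum>j<k. (B i j)\<^sup>2)"
proof -
  let ?D = "{a\<in>{..<N}. F a \<noteq> F' a}" and ?S = "\<Sum>i<k. \<Sum>j<k. (B i j)\<^sup>2"
  define x where "x = (\<lambda>a b. 2 * (B (F a) (F b))\<^sup>2 + 2 * (B (F' a) (F' b))\<^sup>2)"
  have x0: "0 \<le> x a b" for a b by (simp add: x_def)
  have pt: "(B (F a) (F b) - B (F' a) (F' b))\<^sup>2 \<le> of_bool (F a \<noteq> F' a) * x a b + of_bool (F b \<noteq> F' b) * x a b" for a b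
  proof -
    have "(u - v)\<^sup>2 \<le> 2 * u\<^sup>2 + 2 * v\<^sup>2" for u v :: real
      using zero_le_power2[of "u + v"] by (simp add: power2_sum power2_diff)
    from this[of "B (F a) (F b)" "B (F' a) (F' b)"] have "(B (F a) (F b) - B (F' a) (F' b))\<^sup>2 \<le> x a b" by (simp add: x_def)
    then show ?thesis using x0[of a b] by (cases "F a = F' a"; cases "F b = F' b") auto
  qed
  have c1: "{a\<in>?D. F a = i} = {a\<in>{..<N}. F a = i \<and> F' a \<noteq> i}"
       "{a\<in>?D. F' a = i} = {a\<in>{..<N}. F' a = i \<and> F a \<noteq> i}" for i by auto
  have FD: "F ` ?D \<subseteq> {..<k}" "F' ` ?D \<subseteq> {..<k}" using F F' by auto
  have sx: "(\<Sum>a\<in>A. \<Sum>b\<in>A'. x a b) = 2 * (\<Sum>a\<in>A. \<Sum>b\<in>A'. (B (F a) (F b))\<^sup>2) + 2 * (\<Sum>a\<in>A. \<Sum>b\<in>A'. (B (F' a) (F' b))\<^sup>2)" for A A'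
    by (simp add: x_def sum.distrib sum_distrib_left)
  have "(\<Sum>a<N. \<Sum>b<N. (B (F a) (F b) - B (F' a) (F' b))\<^sup>2)
     \<le> (\<Sum>a<N. \<Sum>b<N. of_bool (F a \<noteq> F' a) * x a b + of_bool (F b \<noteq> F' b) * x a b)"
    by (intro sum_mono pt)
  also have "\<dots> = (\<Sum>a\<in>?D. \<Sum>b<N. x a b) + (\<Sum>a<N. \<Sum>b\<in>?D. x a b)"
  proof -
    have filter: "(\<Sum>b<N. of_bool (F b \<noteq> F' b) * y b) = (\<Sum>b\<in>?D. y b)" for y :: "nat \<Rightarrow> real"
    proof -
      have "(\<Sum>b\<in>?D. y b) = (\<Sum>b<N. if F b \<noteq> F' b then y b else 0)"
        by (rule sum.inter_filter) simp
      also have "\<dots> = (\<Sum>b<N. of_bool (F b \<noteq> F' b) * y b)"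
        by (rule sum.cong) auto
      finally show ?thesis ..
    qed
    have "(\<Sum>a<N. \<Sum>b<N. of_bool (F a \<noteq> F' a) * x a b) = (\<Sum>a\<in>?D. \<Sum>b<N. x a b)"
      by (simp only: sum_distrib_left[symmetric] filter)
    moreover have "(\<Sum>a<N. \<Sum>b<N. of_bool (F b \<noteq> F' b) * x a b) = (\<Sum>a<N. \<Sum>b\<in>?D. x a b)"
      by (simp only: filter)
    ultimately show ?thesis by (simp add: sum.distrib)
  qed
  also have "\<dots> \<le> 8 * c * d * ?S"
  proof -
    have "(\<Sum>a\<in>?D. \<Sum>b<N. (B (F a) (F b))\<^sup>2) \<le> d * c * ?S"
      by (rule sum_sum_comp_le) (use FD F c1 d c in auto)
    moreover have "(\<Sum>a\<in>?D. \<Sum>b<N. (B (F' a) (F' b))\<^sup>2) \<le> d * c * ?S"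
      by (rule sum_sum_comp_le) (use FD F' c1 d c in auto)
    moreover have "(\<Sum>a<N. \<Sum>b\<in>?D. (B (F a) (F b))\<^sup>2) \<le> c * d * ?S"
      by (rule sum_sum_comp_le) (use FD F c1 d c in auto)
    moreover have "(\<Sum>a<N. \<Sum>b\<in>?D. (B (F' a) (F' b))\<^sup>2) \<le> c * d * ?S"
      by (rule sum_sum_comp_le) (use FD F' c1 d c in auto)
    ultimately show ?thesis unfolding sx by (simp add: mult.assoc mult.left_commute[of d c])
  qed
  finally show ?thesis .
qed

lemma kernel_norm2_cong:
  assumes "\<And>x y. x \<in> {0..1} \<Longrightarrow> y \<in> {0..1} \<Longrightarrow> f x y = g x y"
  shows "kernel_norm2 f = kernel_norm2 g"
  unfolding kernel_norm2_alt
  by (intro arg_cong[of _ _ sqrt] Bochner_Integration.integral_cong refl)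
     (use assms in \<open>auto simp: space_pair_measure\<close>)

text \<open>On the common refinement into n*k intervals, interval \<open>a\<close> lies in interval
  \<open>a div k\<close> of the n-partition and in interval \<open>a div n\<close> of the
  k-partition.\<close>

lemma kernel_norm2_step_diff:
  assumes "0 < n" "0 < k"
  shows "(kernel_dist (step_kernel n A) (step_kernel k B))\<^sup>2
    = (\<Sum>a<n * k. \<Sum>b<n * k. (A (a div k) (b div k) - B (a div n) (b div n))\<^sup>2) / (real (n * k))\<^sup>2"
proof -
  have "kernel_dist (step_kernel n A) (step_kernel k B)
    = kernel_norm2 (step_kernel (n * k) (\<lambda>a b. A (a div k) (b div k) - B (a div n) (b div n)))"
    by (rule kernel_norm2_cong)
      (use cell_mult[OF assms] cell_mult[OF assms(2,1)] in \<open>simp add: step_kernel_def mult.commute[of k n]\<close>)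
  also have "\<dots> = matrix_norm2 (n * k) (\<lambda>a b. A (a div k) (b div k) - B (a div n) (b div n))"
    by (rule kernel_norm2_step) (use assms in simp)
  finally show ?thesis by (simp add: matrix_norm2_def sum_nonneg)
qed

lemma card_div_eq:
  assumes "0 < k"
  shows "card {a\<in>{..<n * k}. P (a div k)} = k * card {v\<in>{..<n}. P v}"
proof -
  have "{a\<in>{..<n * k}. P (a div k)} = (\<lambda>(v, r). v * k + r) ` ({v\<in>{..<n}. P v} \<times> {..<k})"
  proof (intro equalityI subsetI)
    fix a assume a: "a \<in> {a\<in>{..<n * k}. P (a div k)}"
    then have "a div k < n" by (simp add: less_mult_imp_div_less)
    then show "a \<in> (\<lambda>(v, r). v * k + r) ` ({v\<in>{..<n}. P v} \<times> {..<k})"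
      using a assms by (intro image_eqI[of _ _ "(a div k, a mod k)"]) auto
  next
    fix a assume "a \<in> (\<lambda>(v, r). v * k + r) ` ({v\<in>{..<n}. P v} \<times> {..<k})"
    then obtain v r where "a = v * k + r" "v < n" "P v" "r < k" by auto
    moreover have "v * k + r < n * k"
    proof -
      have "v * k + r < Suc v * k" using \<open>r < k\<close> by simp
      also have "\<dots> \<le> n * k" using \<open>v < n\<close> by (intro mult_le_mono1) simp
      finally show ?thesis .
    qed
    ultimately show "a \<in> {a\<in>{..<n * k}. P (a div k)}" by simp
  qed
  moreover have "inj_on (\<lambda>(v, r). v * k + r) ({v\<in>{..<n}. P v} \<times> {..<k})"
  proof (rule inj_onI, clarify)
    fix v r v' r' assume "r < k" "r' < k" and e: "v * k + r = v' * k + r'"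
    from this(1,2) have "(v * k + r) div k = v" "(v' * k + r') div k = v'" by simp_all
    then have "v = v'" using e by metis
    with e show "v = v' \<and> r = r'" by simp
  qed
  ultimately show ?thesis by (simp add: card_image card_cartesian_product)
qed

text \<open>The floor partition puts \<open>a\<close> into the class of
  \<open>(a div k) * k\<close>, the left end of its block of length k. This differs from
  \<open>a div n\<close> only if a multiple of n lies after that left end and not after
  \<open>a\<close>, so \<open>a\<close> is among the first k indices following a class
  boundary.\<close>

lemma card_floor_cell_mismatch:
  assumes "0 < n" "0 < k"
  shows "card {a\<in>{..<n * k}. (a div k) * k div n = i \<and> a div n \<noteq> i} \<le> k"
    "card {a\<in>{..<n * k}. a div n = i \<and> (a div k) * k div n \<noteq> i} \<le> k"
proof -
  have b: "(a div k) * k \<le> a" "a < (a div k) * k + k" for a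
    using assms by (auto simp: div_mult_mod_eq intro: div_times_less_eq_dividend)
      (metis assms(2) div_mult_mod_eq mod_less_divisor nat_add_left_cancel_less)
  have mono: "(a div k) * k div n \<le> a div n" for a using b by (intro div_le_mono)
  have "{a\<in>{..<n * k}. (a div k) * k div n = i \<and> a div n \<noteq> i} \<subseteq> {Suc i * n ..< Suc i * n + k}"
  proof
    fix a assume a: "a \<in> {a\<in>{..<n * k}. (a div k) * k div n = i \<and> a div n \<noteq> i}"
    then have "Suc i \<le> a div n" using mono[of a] by auto
    then have "Suc i * n \<le> a" using assms by (simp add: less_eq_div_iff_mult_less_eq)
    moreover have "(a div k) * k div n < Suc i" using a by auto
    then have "(a div k) * k < Suc i * n" using assms by (simp add: div_less_iff_less_mult)
    ultimately show "a \<in> {Suc i * n ..< Suc i * n + k}" using b(2)[of a] by auto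
  qed
  from card_mono[OF _ this] show "card {a\<in>{..<n * k}. (a div k) * k div n = i \<and> a div n \<noteq> i} \<le> k" by simp
  have "{a\<in>{..<n * k}. a div n = i \<and> (a div k) * k div n \<noteq> i} \<subseteq> {i * n ..< i * n + k}"
  proof
    fix a assume a: "a \<in> {a\<in>{..<n * k}. a div n = i \<and> (a div k) * k div n \<noteq> i}"
    then have "i * n \<le> a" by auto
    moreover have "(a div k) * k div n < i" using a mono[of a] by auto
    then have "(a div k) * k < i * n" using assms by (simp add: div_less_iff_less_mult)
    ultimately show "a \<in> {i * n ..< i * n + k}" using b(2)[of a] by auto
  qed
  from card_mono[OF _ this] show "card {a\<in>{..<n * k}. a div n = i \<and> (a div k) * k div n \<noteq> i} \<le> k" by simp
qed

text \<open>Class i is the integer interval from the ceiling of i n/k up to, but excluding, the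
  ceiling of (i+1) n/k. Two ceilings differ by less than 1 from the difference n/k of their
  arguments.\<close>

lemma card_floor_partition:
  assumes "i < k" "0 < n"
  shows "\<bar>real (card {v\<in>{..<n}. v * k div n = i}) - real n / real k\<bar> < 1"
proof -
  have k: "0 < k" using assms by simp
  define c where "c = (\<lambda>i. nat \<lceil>real (i * n) / real k\<rceil>)"
  have c: "c i \<le> v \<longleftrightarrow> i * n \<le> v * k" for i v
  proof -
    have "c i \<le> v \<longleftrightarrow> real (i * n) / real k \<le> real v" by (simp add: c_def nat_le_iff ceiling_le_iff)
    also have "\<dots> \<longleftrightarrow> real (i * n) \<le> real (v * k)" using k by (simp add: field_simps)
    finally show ?thesis by linarith
  qed
  have "{v\<in>{..<n}. v * k div n = i} = {c i ..< c (Suc i)}"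
  proof (intro set_eqI)
    fix v
    have "v * k div n = i \<longleftrightarrow> i * n \<le> v * k \<and> v * k < Suc i * n"
    proof -
      have "v * k div n = i \<longleftrightarrow> i \<le> v * k div n \<and> v * k div n < Suc i" by auto
      then show ?thesis using assms by (simp only: less_eq_div_iff_mult_less_eq div_less_iff_less_mult)
    qed
    moreover have "v < n" if "v * k < Suc i * n"
    proof -
      have "Suc i * n \<le> k * n" using assms by (intro mult_le_mono1) simp
      then have "v * k < n * k" using that by (simp only: mult.commute[of k n])
      then show ?thesis by (rule mult_less_cancel2[THEN iffD1, THEN conjunct2])
    qed
    ultimately show "v \<in> {v\<in>{..<n}. v * k div n = i} \<longleftrightarrow> v \<in> {c i ..< c (Suc i)}"
      unfolding mem_Collect_eq atLeastLessThan_iff lessThan_iff c using c[of "Suc i" v] by linarith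
  qed
  moreover have "c i \<le> c (Suc i)" using c[of i "c (Suc i)"] c[of "Suc i" "c (Suc i)"] by simp
  ultimately have "real (card {v\<in>{..<n}. v * k div n = i}) = real (c (Suc i)) - real (c i)" by simp
  moreover have r: "real (c i) = of_int \<lceil>real (i * n) / real k\<rceil>" for i by (simp add: c_def)
  moreover have "real (Suc i * n) / real k = real (i * n) / real k + real n / real k"
    by (simp add: add_divide_distrib distrib_right)
  ultimately show ?thesis
    using r[of i] r[of "Suc i"] ceiling_correct[of "real (i * n) / real k"] ceiling_correct[of "real (Suc i * n) / real k"] by linarith
qed

text \<open>The floor partition mediates between \<open>p\<close> and the k intervals. Every vertex
  misplaced by \<open>p\<close> accounts for k refined indices, and the boundary effect of the floor
  partition adds k more: hence \<open>D + 1\<close>.\<close>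

lemma cell_mismatch_count:
  assumes "0 < n" "0 < k"
    and p: "card {v\<in>{..<n}. p v = i \<and> v * k div n \<noteq> i} \<le> D"
    and q: "card {v\<in>{..<n}. v * k div n = i \<and> p v \<noteq> i} \<le> D"
  shows "card {a\<in>{..<n * k}. p (a div k) = i \<and> a div n \<noteq> i} \<le> k * (D + 1)"
    "card {a\<in>{..<n * k}. a div n = i \<and> p (a div k) \<noteq> i} \<le> k * (D + 1)"
proof -
  let ?A = "{a\<in>{..<n * k}. p (a div k) = i \<and> (a div k) * k div n \<noteq> i}"
    and ?B = "{a\<in>{..<n * k}. (a div k) * k div n = i \<and> a div n \<noteq> i}"
    and ?A' = "{a\<in>{..<n * k}. (a div k) * k div n = i \<and> p (a div k) \<noteq> i}"
    and ?B' = "{a\<in>{..<n * k}. a div n = i \<and> (a div k) * k div n \<noteq> i}"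
  have A: "card ?A \<le> k * D" "card ?A' \<le> k * D"
    using p q card_div_eq[OF assms(2), of n "\<lambda>v. p v = i \<and> v * k div n \<noteq> i"]
      card_div_eq[OF assms(2), of n "\<lambda>v. v * k div n = i \<and> p v \<noteq> i"] by simp_all
  have "card {a\<in>{..<n * k}. p (a div k) = i \<and> a div n \<noteq> i} \<le> card (?A \<union> ?B)"
    by (rule card_mono) auto
  also have "\<dots> \<le> card ?A + card ?B" by (rule card_Un_le)
  also have "\<dots> \<le> k * D + k" by (rule add_mono[OF A(1) card_floor_cell_mismatch(1)[OF assms(1,2)]])
  finally show "card {a\<in>{..<n * k}. p (a div k) = i \<and> a div n \<noteq> i} \<le> k * (D + 1)" by simp
  have "card {a\<in>{..<n * k}. a div n = i \<and> p (a div k) \<noteq> i} \<le> card (?A' \<union> ?B')"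
    by (rule card_mono) auto
  also have "\<dots> \<le> card ?A' + card ?B'" by (rule card_Un_le)
  also have "\<dots> \<le> k * D + k" by (rule add_mono[OF A(2) card_floor_cell_mismatch(2)[OF assms(1,2)]])
  finally show "card {a\<in>{..<n * k}. a div n = i \<and> p (a div k) \<noteq> i} \<le> k * (D + 1)" by simp
qed

lemma card_div_cell:
  assumes "0 < n" "i < k"
  shows "card {a\<in>{..<n * k}. a div n = i} = n"
proof -
  have "{v\<in>{..<k}. v = i} = {i}" using assms by auto
  then show ?thesis using card_div_eq[OF assms(1), of k "\<lambda>v. v = i"] by (simp add: mult.commute)
qed

text \<open>The bound involves the \<open>L\<^sub>2\<close> norm of \<open>B\<close>: for the entries only \<open>lam\<close> is available, and
  \<open>lam\<^sup>2 * k / n\<close> would exceed the rate.\<close>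

lemma kernel_norm2_equipartition_step_diff:
  assumes kn: "k \<le> n" "0 < k"
    and p: "p ` {..<n} \<subseteq> {..<k}"
    and eq: "\<And>i. i < k \<Longrightarrow> \<bar>real (card {v\<in>{..<n}. p v = i}) - real n / real k\<bar> < 1"
    and mis: "\<And>i. i < k \<Longrightarrow> card {v\<in>{..<n}. p v = i \<and> v * k div n \<noteq> i} \<le> 1"
       "\<And>i. i < k \<Longrightarrow> card {v\<in>{..<n}. v * k div n = i \<and> p v \<noteq> i} \<le> 1"
  shows "(kernel_dist (step_kernel n (\<lambda>u v. B (p u) (p v))) (step_kernel k B))\<^sup>2
    \<le> 32 * (real k / real n) * (matrix_norm2 k B)\<^sup>2"
proof -
  have n: "0 < n" using kn by simp
  \<comment> \<open>In refined indices a class has at most n + k \<le> 2n elements, and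
    \<open>D = 1\<close> gives at most 2k mismatches. After division by (n k)^2 the constant is 8 *
    2 * 2 = 32.\<close>
  have "(\<Sum>a<n * k. \<Sum>b<n * k. (B (p (a div k)) (p (b div k)) - B (a div n) (b div n))\<^sup>2)
     \<le> 8 * (2 * real n) * (2 * real k) * (\<Sum>i<k. \<Sum>j<k. (B i j)\<^sup>2)"
  proof (rule sum_square_block_diff_le)
    show "(\<lambda>a. p (a div k)) ` {..<n * k} \<subseteq> {..<k}"
      using p less_mult_imp_div_less by blast
    show "(\<lambda>a. a div n) ` {..<n * k} \<subseteq> {..<k}"
      by (auto simp: less_mult_imp_div_less mult.commute)
    fix i assume i: "i < k"
    have "real (card {v\<in>{..<n}. p v = i}) \<le> real n / real k + 1" using eq[OF i] by linarith
    then have "real k * real (card {v\<in>{..<n}. p v = i}) \<le> real k * (real n / real k + 1)" by (intro mult_left_mono) auto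
    also have "\<dots> = real n + real k" using kn by (simp add: distrib_left)
    also have "\<dots> \<le> 2 * real n" using kn by simp
    finally show "real (card {a\<in>{..<n * k}. p (a div k) = i}) \<le> 2 * real n"
      by (subst card_div_eq[OF kn(2), of n "\<lambda>v. p v = i"]) simp
    show "real (card {a\<in>{..<n * k}. a div n = i}) \<le> 2 * real n"
      using card_div_cell[OF n i] by simp
    have two: "k * (1 + 1) = 2 * k" by simp
    show "real (card {a\<in>{..<n * k}. p (a div k) = i \<and> a div n \<noteq> i}) \<le> 2 * real k"
      "real (card {a\<in>{..<n * k}. a div n = i \<and> p (a div k) \<noteq> i}) \<le> 2 * real k"
      using cell_mismatch_count[OF n kn(2) mis(1)[OF i] mis(2)[OF i]] unfolding two by linarith+
  qed
  then have "(\<Sum>a<n * k. \<Sum>b<n * k. (B (p (a div k)) (p (b div k)) - B (a div n) (b div n))\<^sup>2) / (real (n * k))\<^sup>2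
     \<le> 8 * (2 * real n) * (2 * real k) * (\<Sum>i<k. \<Sum>j<k. (B i j)\<^sup>2) / (real (n * k))\<^sup>2"
    by (rule divide_right_mono) simp
  also have "\<dots> = 32 * (real k / real n) * (matrix_norm2 k B)\<^sup>2"
    using n kn by (simp add: matrix_norm2_def sum_nonneg power2_eq_square field_simps)
  finally show ?thesis by (subst kernel_norm2_step_diff[OF n kn(2)])
qed

section \<open>The sampling model\<close>

abbreviation sample_space :: "nat \<Rightarrow> (nat \<Rightarrow> real) measure" where
  "sample_space n \<equiv> PiM {..<n} (\<lambda>_. unit_interval)"

lemma prob_space_sample: "prob_space (sample_space n)"
  by (rule prob_space_PiM) (rule prob_space_unit_interval)

lemma sample_in_unit: "x \<in> space (sample_space n) \<Longrightarrow> i < n \<Longrightarrow> x i \<in> {0..1}"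
  by (auto simp: space_PiM PiE_def Pi_def)

lemma measurable_kernel_sample:
  assumes f: "bounded_kernel f" and "i \<in> A" "j \<in> A"
  shows "(\<lambda>x. f (x i) (x j)) \<in> borel_measurable (PiM A (\<lambda>_. unit_interval))"
proof -
  have "(\<lambda>x. (x i, x j)) \<in> PiM A (\<lambda>_. unit_interval) \<rightarrow>\<^sub>M unit_square"
    by (intro measurable_Pair measurable_component_singleton assms)
  from measurable_compose[OF this bounded_kernel_measurable[OF f]] show ?thesis by simp
qed

lemma integrable_kernel_sample:
  assumes f: "bounded_kernel f" and "i < n" "j < n"
  shows "integrable (sample_space n) (\<lambda>x. f (x i) (x j))"
proof -
  interpret P: prob_space "sample_space n" by (rule prob_space_sample)
  obtain C where C: "0 \<le> C" "\<And>x y. x \<in> {0..1} \<Longrightarrow> y \<in> {0..1} \<Longrightarrow> \<bar>f x y\<bar> \<le> C"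
    by (rule bounded_kernelE[OF f]) (rule that)
  show ?thesis
  proof (rule P.integrable_const_bound[of _ C])
    show "AE x in sample_space n. norm (f (x i) (x j)) \<le> C"
      using C(2) sample_in_unit assms(2,3) by (intro AE_I2) (simp only: real_norm_def)
  qed (rule measurable_kernel_sample, use assms in auto)
qed

section \<open>Independence of the sample points\<close>

lemma indep_coordinates:
  assumes "0 < n"
  shows "prob_space.indep_vars (sample_space n) (\<lambda>_. unit_interval) (\<lambda>i x. x i) {..<n}"
proof -
  interpret P: prob_space "sample_space n" by (rule prob_space_sample)
  have "distr (sample_space n) (sample_space n) (\<lambda>x. \<lambda>i\<in>{..<n}. x i) = distr (sample_space n) (sample_space n) (\<lambda>x. x)"
    by (rule distr_cong) (auto simp: space_PiM PiE_def extensional_restrict)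
  also have "\<dots> = sample_space n" by (rule distr_id)
  also have "\<dots> = (\<Pi>\<^sub>M i\<in>{..<n}. distr (sample_space n) unit_interval (\<lambda>x. x i))"
    by (rule PiM_cong[OF refl]) (simp add: distr_PiM_component[OF prob_space_unit_interval, of _ "{..<n}"])
  finally show ?thesis
    using assms by (subst P.indep_vars_iff_distr_eq_PiM') auto
qed

lemma integral_sample_pair:
  assumes f: "bounded_kernel f" and ij: "i < n" "j < n" "i \<noteq> j"
  shows "(\<integral>x. f (x i) (x j) \<partial>sample_space n) = (\<integral>p. f (fst p) (snd p) \<partial>unit_square)"
proof -
  interpret P: prob_space "sample_space n" by (rule prob_space_sample)
  have n: "0 < n" using ij by simp
  have "P.indep_var unit_interval ((\<lambda>x. x i) \<circ> (\<lambda>\<omega>. restrict (\<lambda>i. \<omega> i) {i})) unit_interval ((\<lambda>x. x j) \<circ> (\<lambda>\<omega>. restrict (\<lambda>i. \<omega> i) {j}))"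
    by (rule P.indep_var_compose[OF P.indep_var_restrict[OF indep_coordinates[OF n]]]) (use ij in auto)
  then have ind: "P.indep_var unit_interval (\<lambda>x. x i) unit_interval (\<lambda>x. x j)" by (simp add: comp_def)
  have d: "distr (sample_space n) unit_interval (\<lambda>x. x l) = unit_interval" if "l < n" for l
    by (rule distr_PiM_component[OF prob_space_unit_interval, of _ "{..<n}"]) (use that in simp)
  have m: "(\<lambda>x. (x i, x j)) \<in> sample_space n \<rightarrow>\<^sub>M unit_square"
    by (intro measurable_Pair measurable_component_singleton) (use ij in auto)
  have "unit_square = distr (sample_space n) unit_square (\<lambda>x. (x i, x j))"
    using ind[unfolded P.indep_var_distribution_eq] ij by (simp add: d)
  then have "(\<integral>p. f (fst p) (snd p) \<partial>unit_square)
     = (\<integral>p. f (fst p) (snd p) \<partial>distr (sample_space n) unit_square (\<lambda>x. (x i, x j)))" by simp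
  also have "\<dots> = (\<integral>x. f (x i) (x j) \<partial>sample_space n)"
    by (subst integral_distr[OF m bounded_kernel_measurable[OF f]]) simp
  finally show ?thesis ..
qed

lemma integral_sample_disjoint_pairs:
  assumes f: "bounded_kernel f" and ij: "i < n" "j < n" "a < n" "b < n" "{i, j} \<inter> {a, b} = {}"
  shows "(\<integral>x. f (x i) (x j) * f (x a) (x b) \<partial>sample_space n)
    = (\<integral>x. f (x i) (x j) \<partial>sample_space n) * (\<integral>x. f (x a) (x b) \<partial>sample_space n)"
proof -
  interpret P: prob_space "sample_space n" by (rule prob_space_sample)
  have n: "0 < n" using ij by simp
  have "P.indep_var borel ((\<lambda>x. f (x i) (x j)) \<circ> (\<lambda>\<omega>. restrict (\<lambda>i. \<omega> i) {i, j}))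
      borel ((\<lambda>x. f (x a) (x b)) \<circ> (\<lambda>\<omega>. restrict (\<lambda>i. \<omega> i) {a, b}))"
    by (rule P.indep_var_compose[OF P.indep_var_restrict[OF indep_coordinates[OF n]]
          measurable_kernel_sample[OF f] measurable_kernel_sample[OF f]]) (use ij in auto)
  then have "P.indep_var borel (\<lambda>x. f (x i) (x j)) borel (\<lambda>x. f (x a) (x b))" by (simp add: comp_def)
  then show ?thesis
    by (rule P.indep_var_lebesgue_integral) (intro integrable_kernel_sample f ij)+
qed

section \<open>Sums over unordered pairs of vertices\<close>

lemma finite_vertex_pairs [simp]: "finite (vertex_pairs n)"
  by (rule finite_subset[of _ "{..<n} \<times> {..<n}"]) (auto simp: vertex_pairs_def)

lemma card_vertex_pairs_le: "card (vertex_pairs n) \<le> n * n"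
proof -
  have "card (vertex_pairs n) \<le> card ({..<n} \<times> {..<n})"
    by (rule card_mono) (auto simp: vertex_pairs_def)
  then show ?thesis by simp
qed

lemma sum_vertex_pairs: "(\<Sum>e\<in>vertex_pairs n. f e) = (\<Sum>j<n. \<Sum>i<j. f (i, j))"
proof -
  have "vertex_pairs n = (\<lambda>(j, i). (i, j)) ` (SIGMA j:{..<n}. {..<j})"
    by (auto simp: vertex_pairs_def image_def)
  moreover have "inj_on (\<lambda>(j, i). (i, j)) (SIGMA j:{..<n}. {..<j})" by (auto simp: inj_on_def)
  ultimately have "(\<Sum>e\<in>vertex_pairs n. f e) = (\<Sum>p\<in>(SIGMA j:{..<n}. {..<j}). f (snd p, fst p))"
    by (simp add: sum.reindex case_prod_beta')
  then show ?thesis by (simp add: sum.Sigma case_prod_beta')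
qed

lemma card_vertex_pairs: "card (vertex_pairs n) = n choose 2"
proof -
  have "card (vertex_pairs n) = (\<Sum>j<n. j)"
    using sum_vertex_pairs[of "\<lambda>_. 1::nat" n] by simp
  also have "\<dots> = n choose 2" by (simp add: choose_two lessThan_atLeast0 Sum_Ico_nat)
  finally show ?thesis .
qed

lemma sum_sum_vertex_pairs:
  fixes f :: "nat \<Rightarrow> nat \<Rightarrow> real"
  shows "(\<Sum>u<n. \<Sum>v<n. f u v) = (\<Sum>e\<in>vertex_pairs n. case e of (i, j) \<Rightarrow> f i j + f j i) + (\<Sum>u<n. f u u)"
proof -
  have "(\<Sum>u<n. \<Sum>v<n. f u v) = (\<Sum>j<n. \<Sum>i<j. f i j + f j i) + (\<Sum>u<n. f u u)"
    by (induction n) (simp_all add: sum.distrib)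
  then show ?thesis by (simp add: sum_vertex_pairs)
qed

lemma card_intersecting_pairs:
  "card {e'\<in>vertex_pairs n. {fst e', snd e'} \<inter> {i, j} \<noteq> {}} \<le> 4 * n"
proof -
  have "{e'\<in>vertex_pairs n. {fst e', snd e'} \<inter> {i, j} \<noteq> {}}
     \<subseteq> ({i} \<times> {..<n} \<union> {..<n} \<times> {i}) \<union> ({j} \<times> {..<n} \<union> {..<n} \<times> {j})" (is "_ \<subseteq> (?A \<union> ?B) \<union> (?C \<union> ?D)")
    by (auto simp: vertex_pairs_def)
  from card_mono[OF _ this] have "card {e'\<in>vertex_pairs n. {fst e', snd e'} \<inter> {i, j} \<noteq> {}} \<le> card ((?A \<union> ?B) \<union> (?C \<union> ?D))"
    by simp
  also have "\<dots> \<le> (card ?A + card ?B) + (card ?C + card ?D)"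
    by (rule order_trans[OF card_Un_le add_mono[OF card_Un_le card_Un_le]])
  finally show ?thesis by (simp add: card_cartesian_product)
qed

section \<open>Concentration of the sum of W over vertex pairs\<close>

abbreviation edge_sum :: "nat \<Rightarrow> (real \<Rightarrow> real \<Rightarrow> real) \<Rightarrow> (nat \<Rightarrow> real) \<Rightarrow> real" where
  "edge_sum n W x \<equiv> \<Sum>(i, j)\<in>vertex_pairs n. W (x i) (x j)"

text \<open>Centred terms over disjoint pairs are uncorrelated, and each of at most n^2 pairs meets
  at most 4n others, itself included. For meeting pairs only one factor of the product is replaced
  by \<Lambda>, the other keeps its mean 1. The bound is therefore linear in \<Lambda>; a factor
  \<Lambda>^2 would cost sqrt \<Lambda> more in the relative error of the density than the rate
  allows.\<close>

lemma second_moment_edge_sum: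
  assumes W: "graphon W" "normalized W" and L: "\<forall>x\<in>{0..1}. \<forall>y\<in>{0..1}. W x y \<le> \<Lambda>"
  shows "(\<integral>x. (edge_sum n W x - real (n choose 2))\<^sup>2 \<partial>sample_space n) \<le> 4 * real n ^ 3 * \<Lambda>"
proof -
  interpret P: prob_space "sample_space n" by (rule prob_space_sample)
  note bW = graphon_bounded_kernel[OF W(1)]
  have W0: "0 \<le> W x y" if "x \<in> {0..1}" "y \<in> {0..1}" for x y using W(1) that by (auto simp: graphon_def)
  have \<Lambda>0: "0 \<le> \<Lambda>" using L[rule_format, of 0 0] W0[of 0 0] by simp
  define Z where "Z = (\<lambda>x y. W x y - 1)"
  have b1: "bounded_kernel (\<lambda>x y. 1)" by (rule bounded_kernelI[of _ 1]) auto
  have bZ: "bounded_kernel Z" unfolding Z_def by (rule bounded_kernel_diff[OF bW b1])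
  have EW: "(\<integral>p. W (fst p) (snd p) \<partial>unit_square) = 1"
    using W(2) by (simp add: normalized_def case_prod_beta')
  have EWs: "(\<integral>x. W (x i) (x j) \<partial>sample_space n) = 1" if "i < n" "j < n" "i \<noteq> j" for i j
    using integral_sample_pair[OF bW that] EW by simp
  have EZ: "(\<integral>x. Z (x i) (x j) \<partial>sample_space n) = 0" if "i < n" "j < n" "i \<noteq> j" for i j
    using EWs[OF that] integrable_kernel_sample[OF bW that(1,2)] by (simp add: Z_def P.prob_space)
  have bounded_prod: "integrable (sample_space n) (\<lambda>x. f (x i) (x j) * g (x a) (x b))"
    if fg: "bounded_kernel f" "bounded_kernel g" and ij: "i < n" "j < n" "a < n" "b < n" for f g i j a b
  proof -
    obtain C where C: "0 \<le> C" "\<And>x y. x \<in> {0..1} \<Longrightarrow> y \<in> {0..1} \<Longrightarrow> \<bar>f x y\<bar> \<le> C"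
      by (rule bounded_kernelE[OF fg(1)]) (rule that)
    obtain D where D: "0 \<le> D" "\<And>x y. x \<in> {0..1} \<Longrightarrow> y \<in> {0..1} \<Longrightarrow> \<bar>g x y\<bar> \<le> D"
      by (rule bounded_kernelE[OF fg(2)]) (rule that)
    show ?thesis
    proof (rule P.integrable_const_bound[of _ "C * D"])
      show "AE x in sample_space n. norm (f (x i) (x j) * g (x a) (x b)) \<le> C * D"
      proof (rule AE_I2)
        fix x assume x: "x \<in> space (sample_space n)"
        show "norm (f (x i) (x j) * g (x a) (x b)) \<le> C * D"
          unfolding real_norm_def abs_mult using x ij C D
          by (intro mult_mono C(2) D(2) sample_in_unit) auto
      qed
      show "(\<lambda>x. f (x i) (x j) * g (x a) (x b)) \<in> borel_measurable (sample_space n)"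
        by (intro borel_measurable_times measurable_kernel_sample fg) (use ij in auto)
    qed
  qed
  have cov: "(\<integral>x. Z (x i) (x j) * Z (x a) (x b) \<partial>sample_space n) \<le> of_bool ({a, b} \<inter> {i, j} \<noteq> {}) * \<Lambda>"
    if ij: "i < n" "j < n" "i \<noteq> j" "a < n" "b < n" "a \<noteq> b" for i j a b
  proof (cases "{a, b} \<inter> {i, j} = {}")
    case True
    then have "{i, j} \<inter> {a, b} = {}" by blast
    from integral_sample_disjoint_pairs[OF bZ ij(1,2,4,5) this] True show ?thesis
      using EZ[OF ij(1,2,3)] by simp
  next
    case False
    have i1: "integrable (sample_space n) (\<lambda>x. W (x i) (x j) * W (x a) (x b))" by (rule bounded_prod[OF bW bW ij(1,2,4,5)])
    note i2 = integrable_kernel_sample[OF bW ij(1,2)] and i3 = integrable_kernel_sample[OF bW ij(4,5)]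
    have "(\<integral>x. Z (x i) (x j) * Z (x a) (x b) \<partial>sample_space n)
       = (\<integral>x. W (x i) (x j) * W (x a) (x b) - W (x i) (x j) - W (x a) (x b) + 1 \<partial>sample_space n)"
      by (simp add: Z_def algebra_simps)
    also have "\<dots> = (\<integral>x. W (x i) (x j) * W (x a) (x b) \<partial>sample_space n) - 1"
      using i1 i2 i3 by (simp add: EWs ij P.prob_space)
    also have "(\<integral>x. W (x i) (x j) * W (x a) (x b) \<partial>sample_space n) \<le> (\<integral>x. \<Lambda> * W (x a) (x b) \<partial>sample_space n)"
    proof (rule integral_mono[OF i1 integrable_mult_right[OF i3]])
      fix x assume x: "x \<in> space (sample_space n)"
      show "W (x i) (x j) * W (x a) (x b) \<le> \<Lambda> * W (x a) (x b)"
        using x ij L W0 by (intro mult_right_mono) (blast intro: sample_in_unit)+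
    qed
    also have "\<dots> = \<Lambda>" using i3 EWs[OF ij(4,5,6)] by simp
    finally show ?thesis using False by simp
  qed
  have eq: "edge_sum n W x - real (n choose 2) = (\<Sum>e\<in>vertex_pairs n. Z (x (fst e)) (x (snd e)))" for x
    by (simp add: Z_def sum_subtractf card_vertex_pairs case_prod_beta')
  have e: "fst e < n" "snd e < n" "fst e \<noteq> snd e" if "e \<in> vertex_pairs n" for e
    using that by (auto simp: vertex_pairs_def)
  have "(\<integral>x. (edge_sum n W x - real (n choose 2))\<^sup>2 \<partial>sample_space n)
    = (\<integral>x. (\<Sum>e\<in>vertex_pairs n. \<Sum>e'\<in>vertex_pairs n. Z (x (fst e)) (x (snd e)) * Z (x (fst e')) (x (snd e'))) \<partial>sample_space n)"
    unfolding eq power2_eq_square sum_product ..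
  also have "\<dots> = (\<Sum>e\<in>vertex_pairs n. \<Sum>e'\<in>vertex_pairs n. (\<integral>x. Z (x (fst e)) (x (snd e)) * Z (x (fst e')) (x (snd e')) \<partial>sample_space n))"
    by (subst Bochner_Integration.integral_sum,
        (intro Bochner_Integration.integrable_sum bounded_prod bZ; (simp add: e)),
        (intro sum.cong refl Bochner_Integration.integral_sum bounded_prod bZ; (simp add: e)))
  also have "\<dots> \<le> (\<Sum>e\<in>vertex_pairs n. \<Sum>e'\<in>vertex_pairs n. of_bool ({fst e', snd e'} \<inter> {fst e, snd e} \<noteq> {}) * \<Lambda>)"
    by (intro sum_mono cov e)
  also have "\<dots> = (\<Sum>e\<in>vertex_pairs n. real (card {e'\<in>vertex_pairs n. {fst e', snd e'} \<inter> {fst e, snd e} \<noteq> {}}) * \<Lambda>)"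
    by (intro sum.cong refl) (simp add: sum_distrib_right[symmetric] Int_def)
  also have "\<dots> \<le> (\<Sum>e\<in>vertex_pairs n. real (4 * n) * \<Lambda>)"
    by (intro sum_mono mult_right_mono of_nat_mono card_intersecting_pairs \<Lambda>0)
  also have "\<dots> = real (card (vertex_pairs n)) * (real (4 * n) * \<Lambda>)" by simp
  also have "\<dots> \<le> real (n * n) * (real (4 * n) * \<Lambda>)"
    by (intro mult_right_mono of_nat_mono card_vertex_pairs_le mult_nonneg_nonneg \<Lambda>0) simp
  finally show ?thesis by (simp add: power3_eq_cube algebra_simps)
qed

lemma edge_sum_concentration:
  assumes W: "graphon W" "normalized W" and L: "\<forall>x\<in>{0..1}. \<forall>y\<in>{0..1}. W x y \<le> \<Lambda>" and t: "0 < t"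
  shows "{x \<in> space (sample_space n). \<bar>edge_sum n W x - real (n choose 2)\<bar> < t} \<in> sets (sample_space n)"
    "measure (sample_space n) {x \<in> space (sample_space n). \<bar>edge_sum n W x - real (n choose 2)\<bar> < t}
      \<ge> 1 - 4 * real n ^ 3 * \<Lambda> / t\<^sup>2"
proof -
  interpret P: prob_space "sample_space n" by (rule prob_space_sample)
  let ?S = "\<lambda>x. edge_sum n W x - real (n choose 2)"
  have m: "?S \<in> borel_measurable (sample_space n)"
    unfolding case_prod_beta'
    by (intro borel_measurable_diff borel_measurable_sum borel_measurable_const
        measurable_kernel_sample[OF graphon_bounded_kernel[OF W(1)]])
      (auto simp: vertex_pairs_def)
  then show s: "{x \<in> space (sample_space n). \<bar>?S x\<bar> < t} \<in> sets (sample_space n)" by measurable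
  have \<Lambda>: "0 \<le> \<Lambda>" using L W(1) unfolding graphon_def by (meson atLeastAtMost_iff order_refl order_trans zero_le_one)
  let ?C = "\<Sum>e\<in>vertex_pairs n. \<Lambda>"
  have int: "integrable (sample_space n) (\<lambda>x. (?S x)\<^sup>2)"
  proof (rule P.integrable_const_bound[of _ "(?C + real (n choose 2))\<^sup>2"])
    show "AE x in sample_space n. norm ((?S x)\<^sup>2) \<le> (?C + real (n choose 2))\<^sup>2"
    proof (rule AE_I2)
      fix x assume x: "x \<in> space (sample_space n)"
      have b: "0 \<le> W (x (fst e)) (x (snd e))" "W (x (fst e)) (x (snd e)) \<le> \<Lambda>" if "e \<in> vertex_pairs n" for e
        using that L W(1) sample_in_unit[OF x] by (auto simp: vertex_pairs_def graphon_def)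
      have "0 \<le> edge_sum n W x" "edge_sum n W x \<le> ?C"
        unfolding case_prod_beta' by (intro sum_nonneg sum_mono b; assumption)+
      then have "\<bar>?S x\<bar> \<le> \<bar>?C + real (n choose 2)\<bar>" by linarith
      then show "norm ((?S x)\<^sup>2) \<le> (?C + real (n choose 2))\<^sup>2"
        by (simp only: real_norm_def abs_power2 abs_le_square_iff)
    qed
  qed (use m in measurable)
  have "measure (sample_space n) {x \<in> space (sample_space n). t\<^sup>2 \<le> (?S x)\<^sup>2} \<le> (\<integral>x. (?S x)\<^sup>2 \<partial>sample_space n) / t\<^sup>2"
    by (rule integral_Markov_inequality_measure[OF int sets.top]) (use t in auto)
  also have "\<dots> \<le> 4 * real n ^ 3 * \<Lambda> / t\<^sup>2"
    by (rule divide_right_mono[OF second_moment_edge_sum[OF W L]]) simp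
  also have "{x \<in> space (sample_space n). t\<^sup>2 \<le> (?S x)\<^sup>2} = space (sample_space n) - {x \<in> space (sample_space n). \<bar>?S x\<bar> < t}"
  proof -
    have "t\<^sup>2 \<le> (?S x)\<^sup>2 \<longleftrightarrow> \<not> \<bar>?S x\<bar> < t" for x
      using abs_le_square_iff[of t "?S x"] t by (simp only: abs_of_pos not_less)
    then show ?thesis by (simp only:) blast
  qed
  finally show "measure (sample_space n) {x \<in> space (sample_space n). \<bar>?S x\<bar> < t} \<ge> 1 - 4 * real n ^ 3 * \<Lambda> / t\<^sup>2"
    using P.prob_compl[OF s] by linarith
qed

section \<open>Chernoff bounds for the random graph\<close>

lemma exp_le_quadratic:
  fixes t :: real
  assumes "\<bar>t\<bar> \<le> 1"
  shows "exp t \<le> 1 + t + t\<^sup>2"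
proof (cases "0 \<le> t")
  case True
  then show ?thesis using exp_bound[of t] assms by simp
next
  case False
  define u where "u = - t"
  have u: "0 \<le> u" using False by (simp add: u_def)
  \<comment> \<open>For t = -u the claim reads 1 \<le> (1 - u + u^2) exp u, which already holds for
    the quadratic Taylor polynomial in place of the exponential.\<close>
  have "1 \<le> 1 + u\<^sup>2 / 2 + u ^ 3 / 2 + u ^ 4 / 2" using u by simp
  also have "\<dots> = (1 - u + u\<^sup>2) * (1 + u + u\<^sup>2 / 2)"
    by (simp add: field_simps power2_eq_square power3_eq_cube power4_eq_xxxx)
  also have "\<dots> \<le> (1 - u + u\<^sup>2) * exp u"
  proof (rule mult_left_mono[OF exp_lower_Taylor_quadratic[OF u]])
    show "0 \<le> 1 - u + u\<^sup>2" using zero_le_power2[of "u - 1 / 2"] by (simp add: power2_eq_square algebra_simps)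
  qed
  finally have "1 * exp (- u) \<le> ((1 - u + u\<^sup>2) * exp u) * exp (- u)" by (rule mult_right_mono) simp
  also have "\<dots> = 1 - u + u\<^sup>2" by (simp add: mult.assoc exp_add[symmetric])
  finally show ?thesis by (simp add: u_def)
qed

text \<open>Bounding 1 + q (exp t - 1) by an exponential keeps the factor \<open>q\<close> in the
  exponent. A bound for general bounded variables, without \<open>q\<close>, would lose the factor
  \<rho> and be too weak for sparse graphs.\<close>

lemma bernoulli_mgf_le:
  fixes q t :: real
  assumes "0 \<le> q" "q \<le> 1" "\<bar>t\<bar> \<le> 1"
  shows "(\<integral>v. exp (t * (of_bool v - q)) \<partial>bernoulli_pmf q) \<le> exp (t\<^sup>2 * q)"
proof -
  have "(\<integral>v. exp (t * (of_bool v - q)) \<partial>bernoulli_pmf q) = exp (t * (1 - q)) * q + exp (t * (0 - q)) * (1 - q)"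
    using assms by simp
  also have "\<dots> = exp (- (t * q)) * (1 + q * (exp t - 1))"
    by (simp add: algebra_simps exp_diff exp_minus field_simps)
  also have "\<dots> \<le> exp (- (t * q)) * exp (q * (exp t - 1))"
    by (intro mult_left_mono exp_ge_add_one_self) simp
  also have "\<dots> = exp (q * (exp t - 1 - t))" by (simp add: exp_add[symmetric] algebra_simps)
  also have "\<dots> \<le> exp (q * t\<^sup>2)"
    using mult_left_mono[OF exp_le_quadratic[OF assms(3)] assms(1)] by (simp add: algebra_simps)
  finally show ?thesis by (simp add: mult.commute)
qed

text \<open>Two kinds of weights \<open>b\<close> occur: the constant 1, which compares the number
  of edges with its conditional mean, and \<open>block_indicator\<close>.\<close>

definition edge_deviation :: "nat \<Rightarrow> (nat \<times> nat \<Rightarrow> real) \<Rightarrow> (nat \<times> nat \<Rightarrow> real) \<Rightarrow> (nat \<times> nat) set \<Rightarrow> real" where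
  "edge_deviation n q b G = (\<Sum>e\<in>vertex_pairs n. (of_bool (e \<in> G) - q e) * b e)"

lemma edge_deviation_mgf:
  assumes q: "\<And>i j. (i, j) \<in> vertex_pairs n \<Longrightarrow> 0 \<le> p i j \<and> p i j \<le> 1"
    and b: "\<And>e. e \<in> vertex_pairs n \<Longrightarrow> \<bar>b e\<bar> \<le> 1" and s: "\<bar>s\<bar> \<le> 1"
  shows "(\<integral>G. exp (s * edge_deviation n (case_prod p) b G) \<partial>random_graph_pmf n p)
     \<le> exp (s\<^sup>2 * (\<Sum>(i, j)\<in>vertex_pairs n. p i j))"
proof -
  let ?V = "vertex_pairs n" and ?q = "case_prod p"
  have q': "0 \<le> ?q e" "?q e \<le> 1" if "e \<in> ?V" for e using q that by (cases e; auto)+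
  have "(\<integral>G. exp (s * edge_deviation n ?q b G) \<partial>random_graph_pmf n p)
     = measure_pmf.expectation (Pi_pmf ?V False (\<lambda>(i, j). bernoulli_pmf (p i j)))
        (\<lambda>f. \<Prod>e\<in>?V. exp ((s * b e) * (of_bool (f e) - ?q e)))"
    unfolding random_graph_pmf_def integral_map_pmf edge_deviation_def sum_distrib_left
    by (intro Bochner_Integration.integral_cong refl) (simp add: exp_sum mult_ac)
  also have "\<dots> = (\<Prod>e\<in>?V. measure_pmf.expectation (case e of (i, j) \<Rightarrow> bernoulli_pmf (p i j))
        (\<lambda>v. exp ((s * b e) * (of_bool v - ?q e))))"
    by (rule expectation_prod_Pi_pmf) (auto intro!: integrable_measure_pmf_finite)
  also have "\<dots> \<le> (\<Prod>e\<in>?V. exp (s\<^sup>2 * ?q e))"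
  proof (intro prod_mono conjI)
    fix e assume e: "e \<in> ?V"
    show "0 \<le> measure_pmf.expectation (case e of (i, j) \<Rightarrow> bernoulli_pmf (p i j)) (\<lambda>v. exp ((s * b e) * (of_bool v - ?q e)))"
      by (rule Bochner_Integration.integral_nonneg) simp
    have sb: "\<bar>s * b e\<bar> \<le> 1" using mult_mono[OF s b[OF e]] by (simp add: abs_mult)
    have "measure_pmf.expectation (bernoulli_pmf (?q e)) (\<lambda>v. exp ((s * b e) * (of_bool v - ?q e))) \<le> exp ((s * b e)\<^sup>2 * ?q e)"
      by (rule bernoulli_mgf_le[OF q'[OF e] sb])
    also have "\<dots> \<le> exp (s\<^sup>2 * ?q e)"
    proof -
      have "(b e)\<^sup>2 \<le> 1" using b[OF e] by (simp add: abs_square_le_1)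
      then have "s\<^sup>2 * (b e)\<^sup>2 \<le> s\<^sup>2 * 1" by (intro mult_left_mono) auto
      then show ?thesis using q'(1)[OF e] by (simp add: power_mult_distrib mult_right_mono)
    qed
    finally show "measure_pmf.expectation (case e of (i, j) \<Rightarrow> bernoulli_pmf (p i j)) (\<lambda>v. exp ((s * b e) * (of_bool v - ?q e))) \<le> exp (s\<^sup>2 * ?q e)"
      by (simp add: case_prod_beta')
  qed
  also have "\<dots> = exp (s\<^sup>2 * (\<Sum>(i, j)\<in>?V. p i j))" by (simp add: exp_sum[symmetric] sum_distrib_left)
  finally show ?thesis .
qed

lemma set_random_graph_pmf: "set_pmf (random_graph_pmf n p) \<subseteq> Pow (vertex_pairs n)"
  by (auto simp: random_graph_pmf_def)

lemma finite_set_random_graph_pmf: "finite (set_pmf (random_graph_pmf n p))"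
  by (rule finite_subset[OF set_random_graph_pmf]) simp

text \<open>The lower tail is the upper tail for -b. The parameter \<open>s\<close> stays free
  because the two applications choose it differently: 1 / (sqrt \<rho> n) for the number of edges,
  sqrt(noise) for the blocks.\<close>

lemma edge_deviation_tail:
  assumes q: "\<And>i j. (i, j) \<in> vertex_pairs n \<Longrightarrow> 0 \<le> p i j \<and> p i j \<le> 1"
    and b: "\<And>e. e \<in> vertex_pairs n \<Longrightarrow> \<bar>b e\<bar> \<le> 1" and s: "0 < s" "s \<le> 1"
    and V: "(\<Sum>(i, j)\<in>vertex_pairs n. p i j) \<le> V"
  shows "measure_pmf.prob (random_graph_pmf n p) {G. t \<le> \<bar>edge_deviation n (case_prod p) b G\<bar>} \<le> 2 * exp (s\<^sup>2 * V - s * t)"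
proof -
  let ?M = "measure_pmf (random_graph_pmf n p)" and ?D = "edge_deviation n (case_prod p)"
  have one: "measure_pmf.prob (random_graph_pmf n p) {G. t \<le> ?D b' G} \<le> exp (s\<^sup>2 * V - s * t)"
    if b': "\<And>e. e \<in> vertex_pairs n \<Longrightarrow> \<bar>b' e\<bar> \<le> 1" for b'
  proof -
    have "measure_pmf.prob (random_graph_pmf n p) {G\<in>UNIV. t \<le> ?D b' G} \<le> exp (- s * t) * (\<integral>G\<in>UNIV. exp (s * ?D b' G) \<partial>?M)"
      by (rule measure_pmf.Chernoff_ineq_ge[OF s(1)])
        (auto simp: set_integrable_def intro!: integrable_measure_pmf_finite finite_set_random_graph_pmf)
    also have "\<dots> \<le> exp (- s * t) * exp (s\<^sup>2 * (\<Sum>(i, j)\<in>vertex_pairs n. p i j))"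
      using edge_deviation_mgf[of n p b' s] q b' s by (simp add: set_lebesgue_integral_def)
    also have "\<dots> \<le> exp (- s * t) * exp (s\<^sup>2 * V)"
      using V by (simp add: mult_left_mono)
    also have "\<dots> = exp (s\<^sup>2 * V - s * t)" by (simp add: exp_add[symmetric])
    finally show ?thesis by simp
  qed
  have neg: "?D (\<lambda>e. - b e) G = - ?D b G" for G by (simp add: edge_deviation_def sum_negf)
  have "{G. t \<le> \<bar>?D b G\<bar>} = {G. t \<le> ?D b G} \<union> {G. t \<le> ?D (\<lambda>e. - b e) G}"
    unfolding neg by (auto simp: abs_real_def)
  then have "measure_pmf.prob (random_graph_pmf n p) {G. t \<le> \<bar>?D b G\<bar>}
     \<le> measure_pmf.prob (random_graph_pmf n p) {G. t \<le> ?D b G} + measure_pmf.prob (random_graph_pmf n p) {G. t \<le> ?D (\<lambda>e. - b e) G}"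
    by (simp add: measure_Un_le)
  also have "\<dots> \<le> exp (s\<^sup>2 * V - s * t) + exp (s\<^sup>2 * V - s * t)"
    by (intro add_mono one) (use b in auto)
  finally show ?thesis by simp
qed

lemma edge_deviation_uniform_tail:
  assumes q: "\<And>i j. (i, j) \<in> vertex_pairs n \<Longrightarrow> 0 \<le> p i j \<and> p i j \<le> 1"
    and I: "finite I" and b: "\<And>e a. a \<in> I \<Longrightarrow> e \<in> vertex_pairs n \<Longrightarrow> \<bar>b a e\<bar> \<le> 1" and s: "0 < s" "s \<le> 1"
    and V: "(\<Sum>(i, j)\<in>vertex_pairs n. p i j) \<le> V"
  shows "measure_pmf.prob (random_graph_pmf n p) {G. \<forall>a\<in>I. \<bar>edge_deviation n (case_prod p) (b a) G\<bar> < t}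
    \<ge> 1 - real (card I) * (2 * exp (s\<^sup>2 * V - s * t))"
proof -
  let ?M = "measure_pmf.prob (random_graph_pmf n p)" and ?D = "edge_deviation n (case_prod p)"
  have "?M (\<Union>a\<in>I. {G. t \<le> \<bar>?D (b a) G\<bar>}) \<le> (\<Sum>a\<in>I. ?M {G. t \<le> \<bar>?D (b a) G\<bar>})"
    by (rule measure_UNION_le[OF I]) simp
  also have "\<dots> \<le> (\<Sum>a\<in>I. 2 * exp (s\<^sup>2 * V - s * t))"
    by (intro sum_mono edge_deviation_tail q b s V)
  finally have "?M (\<Union>a\<in>I. {G. t \<le> \<bar>?D (b a) G\<bar>}) \<le> real (card I) * (2 * exp (s\<^sup>2 * V - s * t))" by simp
  moreover have "{G. \<forall>a\<in>I. \<bar>?D (b a) G\<bar> < t} = UNIV - (\<Union>a\<in>I. {G. t \<le> \<bar>?D (b a) G\<bar>})"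
    by (auto simp: not_le)
  ultimately show ?thesis
    using measure_pmf.prob_compl[of "\<Union>a\<in>I. {G. t \<le> \<bar>?D (b a) G\<bar>}" "random_graph_pmf n p"] by simp
qed

section \<open>The joint law of sample points and graph\<close>

lemma pmf_random_graph:
  assumes "G \<subseteq> vertex_pairs n"
  shows "pmf (random_graph_pmf n p) G = (\<Prod>e\<in>vertex_pairs n. pmf (bernoulli_pmf (case_prod p e)) (e \<in> G))"
proof -
  let ?P = "Pi_pmf (vertex_pairs n) False (\<lambda>(i, j). bernoulli_pmf (p i j))"
  have "pmf (random_graph_pmf n p) G = measure_pmf.prob ?P ((\<lambda>f. {e \<in> vertex_pairs n. f e}) -` {G})"
    unfolding random_graph_pmf_def by (rule pmf_map)
  also have "\<dots> = measure_pmf.prob ?P {\<lambda>e. e \<in> G}"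
  \<comment> \<open>Functions that are true somewhere outside \<open>vertex_pairs n\<close> also map
    to \<open>G\<close>, but \<open>Pi_pmf\<close> almost surely takes the default value
    \<open>False\<close> there.\<close>
  proof (rule measure_pmf.finite_measure_eq_AE)
    show "AE f in ?P. (f \<in> (\<lambda>f. {e \<in> vertex_pairs n. f e}) -` {G}) = (f \<in> {\<lambda>e. e \<in> G})"
    proof (rule AE_pmfI)
      fix f assume "f \<in> set_pmf ?P"
      then have "\<forall>e. e \<notin> vertex_pairs n \<longrightarrow> \<not> f e"
        using set_Pi_pmf_subset[of "vertex_pairs n" False] by auto
      then show "(f \<in> (\<lambda>f. {e \<in> vertex_pairs n. f e}) -` {G}) = (f \<in> {\<lambda>e. e \<in> G})"
        using assms by (auto simp: fun_eq_iff)
    qed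
  qed auto
  also have "\<dots> = pmf ?P (\<lambda>e. e \<in> G)" by (simp add: measure_pmf_single)
  also have "\<dots> = (\<Prod>e\<in>vertex_pairs n. pmf (bernoulli_pmf (case_prod p e)) (e \<in> G))"
    using assms by (subst pmf_Pi') (auto simp: case_prod_beta')
  finally show ?thesis .
qed

abbreviation graph_law :: "nat \<Rightarrow> real \<Rightarrow> (real \<Rightarrow> real \<Rightarrow> real) \<Rightarrow> (nat \<Rightarrow> real) \<Rightarrow> (nat \<times> nat) set pmf" where
  "graph_law n \<rho> W x \<equiv> random_graph_pmf n (\<lambda>i j. \<rho> * sampled_matrix W x i j)"

context
  fixes n :: nat and \<rho> :: real and W :: "real \<Rightarrow> real \<Rightarrow> real" and \<Lambda> :: real
  assumes W: "graphon W" and L: "\<forall>x\<in>{0..1}. \<forall>y\<in>{0..1}. W x y \<le> \<Lambda>" and \<rho>: "0 \<le> \<rho>" "\<rho> * \<Lambda> \<le> 1"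
begin

lemma edge_probability_bounds:
  assumes "x \<in> space (sample_space n)" "i < n" "j < n"
  shows "0 \<le> \<rho> * sampled_matrix W x i j" "\<rho> * sampled_matrix W x i j \<le> 1"
proof -
  have x: "x i \<in> {0..1}" "x j \<in> {0..1}" using sample_in_unit assms by auto
  then have "0 \<le> W (x i) (x j)" "W (x i) (x j) \<le> \<Lambda>" using W L by (auto simp: graphon_def)
  then show "0 \<le> \<rho> * sampled_matrix W x i j" "\<rho> * sampled_matrix W x i j \<le> 1"
    using \<rho> mult_left_mono[of "W (x i) (x j)" \<Lambda> \<rho>] by (auto simp: sampled_matrix_def)
qed

text \<open>On the sample space all edge probabilities lie in [0,1], so the Bernoulli masses are the
  affine expressions p and 1 - p, and the mass of \<open>G\<close> is a finite product of measurable
  functions.\<close>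

lemma measurable_pmf_random_graph:
  assumes "G \<subseteq> vertex_pairs n"
  shows "(\<lambda>x. pmf (graph_law n \<rho> W x) G) \<in> borel_measurable (sample_space n)"
proof -
  have "(\<lambda>x. \<Prod>e\<in>vertex_pairs n. if e \<in> G then \<rho> * W (x (fst e)) (x (snd e)) else 1 - \<rho> * W (x (fst e)) (x (snd e)))
     \<in> borel_measurable (sample_space n)"
  proof (rule borel_measurable_prod)
    fix e assume "e \<in> vertex_pairs n"
    then have "(\<lambda>x. W (x (fst e)) (x (snd e))) \<in> borel_measurable (sample_space n)"
      by (intro measurable_kernel_sample graphon_bounded_kernel W) (auto simp: vertex_pairs_def)
    then show "(\<lambda>x. if e \<in> G then \<rho> * W (x (fst e)) (x (snd e)) else 1 - \<rho> * W (x (fst e)) (x (snd e)))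
     \<in> borel_measurable (sample_space n)" by (cases "e \<in> G") simp_all
  qed
  moreover have "pmf (graph_law n \<rho> W x) G
    = (\<Prod>e\<in>vertex_pairs n. if e \<in> G then \<rho> * W (x (fst e)) (x (snd e)) else 1 - \<rho> * W (x (fst e)) (x (snd e)))"
    if "x \<in> space (sample_space n)" for x
    unfolding pmf_random_graph[OF assms]
  proof (rule prod.cong[OF refl])
    fix e assume "e \<in> vertex_pairs n"
    then have "fst e < n" "snd e < n" by (auto simp: vertex_pairs_def)
    from edge_probability_bounds[OF that this]
    show "pmf (bernoulli_pmf (case_prod (\<lambda>i j. \<rho> * sampled_matrix W x i j) e)) (e \<in> G)
      = (if e \<in> G then \<rho> * W (x (fst e)) (x (snd e)) else 1 - \<rho> * W (x (fst e)) (x (snd e)))"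
      by (simp add: case_prod_beta' sampled_matrix_def)
  qed
  ultimately show ?thesis by (simp cong: measurable_cong)
qed

lemma space_graph_model: "space (graph_model n \<rho> W) = space (sample_space n) \<times> Pow (vertex_pairs n)"
  by (simp add: graph_model_def space_pair_measure)

text \<open>There are finitely many graphs, so an event is a finite union of rectangles over single
  graphs.\<close>

lemma sets_graph_modelI:
  assumes "\<And>G. G \<subseteq> vertex_pairs n \<Longrightarrow> {x \<in> space (sample_space n). Q x G} \<in> sets (sample_space n)"
  shows "{(x, G) \<in> space (graph_model n \<rho> W). Q x G} \<in> sets (graph_model n \<rho> W)"
proof -
  have "{(x, G) \<in> space (graph_model n \<rho> W). Q x G}
    = (\<Union>G\<in>Pow (vertex_pairs n). {x \<in> space (sample_space n). Q x G} \<times> {G})"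
    unfolding space_graph_model by auto
  also have "\<dots> \<in> sets (sample_space n \<Otimes>\<^sub>M count_space (Pow (vertex_pairs n)))"
    by (intro sets.finite_UN pair_measureI assms) auto
  finally show ?thesis by (simp add: graph_model_def)
qed

text \<open>This recovers the two-stage experiment from the density: for fixed x, the mass that the
  density puts on a set of graphs is its probability under \<open>graph_law\<close>. Everything
  conditional on the sample passes through this identity.\<close>

lemma emeasure_graph_model:
  assumes S: "S \<in> sets (graph_model n \<rho> W)"
  shows "emeasure (graph_model n \<rho> W) S
    = (\<integral>\<^sup>+x. emeasure (measure_pmf (graph_law n \<rho> W x)) {G. (x, G) \<in> S} \<partial>sample_space n)"
proof -
  let ?C = "count_space (Pow (vertex_pairs n))"
  let ?f = "\<lambda>p. ennreal (pmf (random_graph_pmf n (\<lambda>i j. \<rho> * sampled_matrix W (fst p) i j)) (snd p))"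
  interpret C: sigma_finite_measure ?C by (rule sigma_finite_measure_count_space_finite) simp
  have f: "?f \<in> borel_measurable (sample_space n \<Otimes>\<^sub>M ?C)"
  proof (rule measurable_compose_countable'[where g = snd and I = "Pow (vertex_pairs n)"
        and f = "\<lambda>G p. ennreal (pmf (random_graph_pmf n (\<lambda>i j. \<rho> * sampled_matrix W (fst p) i j)) G)"])
    fix G assume "G \<in> Pow (vertex_pairs n)"
    then have "(\<lambda>x. pmf (graph_law n \<rho> W x) G) \<in> borel_measurable (sample_space n)"
      by (intro measurable_pmf_random_graph) auto
    from measurable_compose[OF measurable_fst this]
    show "(\<lambda>p. ennreal (pmf (random_graph_pmf n (\<lambda>i j. \<rho> * sampled_matrix W (fst p) i j)) G)) \<in> borel_measurable (sample_space n \<Otimes>\<^sub>M ?C)"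
      by measurable
  qed (auto intro: countable_finite)
  have S': "S \<in> sets (sample_space n \<Otimes>\<^sub>M ?C)" using S by (simp add: graph_model_def)
  have "emeasure (graph_model n \<rho> W) S = (\<integral>\<^sup>+p. ?f p * indicator S p \<partial>(sample_space n \<Otimes>\<^sub>M ?C))"
    unfolding graph_model_def case_prod_beta' by (rule emeasure_density[OF f S'])
  also have "\<dots> = (\<integral>\<^sup>+x. (\<integral>\<^sup>+G. ?f (x, G) * indicator S (x, G) \<partial>?C) \<partial>sample_space n)"
    by (rule C.nn_integral_fst[symmetric]) (use f S' in measurable)
  also have "\<dots> = (\<integral>\<^sup>+x. emeasure (measure_pmf (graph_law n \<rho> W x)) {G. (x, G) \<in> S} \<partial>sample_space n)"
  proof (rule nn_integral_cong)
    fix x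
    have sub: "{G. (x, G) \<in> S} \<subseteq> Pow (vertex_pairs n)" using sets.sets_into_space[OF S] by (auto simp: space_graph_model)
    then have fin: "finite {G. (x, G) \<in> S}" by (rule finite_subset) simp
    have "(\<integral>\<^sup>+G. ?f (x, G) * indicator S (x, G) \<partial>?C) = (\<Sum>G\<in>Pow (vertex_pairs n). ?f (x, G) * indicator S (x, G))"
      by (rule nn_integral_count_space_finite) simp
    also have "\<dots> = (\<Sum>G\<in>{G. (x, G) \<in> S}. ?f (x, G))"
      by (rule sum.mono_neutral_cong_right) (use sub in \<open>auto simp: indicator_def\<close>)
    also have "\<dots> = emeasure (measure_pmf (graph_law n \<rho> W x)) {G. (x, G) \<in> S}"
      by (simp add: emeasure_measure_pmf_finite[OF fin])
    finally show "(\<integral>\<^sup>+G. ?f (x, G) * indicator S (x, G) \<partial>?C)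
      = emeasure (measure_pmf (graph_law n \<rho> W x)) {G. (x, G) \<in> S}" .
  qed
  finally show ?thesis .
qed

lemma prob_space_graph_model: "prob_space (graph_model n \<rho> W)"
proof (rule prob_spaceI)
  interpret P: prob_space "sample_space n" by (rule prob_space_sample)
  have "emeasure (graph_model n \<rho> W) (space (graph_model n \<rho> W))
     = (\<integral>\<^sup>+x. 1 \<partial>sample_space n)"
    unfolding emeasure_graph_model[OF sets.top]
  proof (rule nn_integral_cong)
    fix x assume x: "x \<in> space (sample_space n)"
    show "emeasure (measure_pmf (graph_law n \<rho> W x)) {G. (x, G) \<in> space (graph_model n \<rho> W)} = 1"
      by (rule measure_pmf.emeasure_eq_1_AE) (use x set_random_graph_pmf in \<open>auto simp: space_graph_model intro!: AE_pmfI\<close>)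
  qed
  also have "\<dots> = 1" using P.emeasure_space_1 by simp
  finally show "emeasure (graph_model n \<rho> W) (space (graph_model n \<rho> W)) = 1" .
qed

lemma graph_model_prob_ge:
  assumes S: "S \<in> sets (graph_model n \<rho> W)" and X: "X \<in> sets (sample_space n)"
    and a: "measure (sample_space n) X \<ge> 1 - a" and b: "0 \<le> b" "b \<le> 1" and a0: "0 \<le> a"
    and c: "\<And>x. x \<in> X \<Longrightarrow> measure_pmf.prob (graph_law n \<rho> W x) {G. (x, G) \<in> S} \<ge> 1 - b"
  shows "measure (graph_model n \<rho> W) S \<ge> 1 - a - b"
proof -
  interpret P: prob_space "sample_space n" by (rule prob_space_sample)
  interpret gm: prob_space "graph_model n \<rho> W" by (rule prob_space_graph_model)
  have "ennreal ((1 - b) * measure (sample_space n) X) = (\<integral>\<^sup>+x. ennreal (1 - b) * indicator X x \<partial>sample_space n)"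
    using X b by (simp add: nn_integral_cmult_indicator P.emeasure_eq_measure ennreal_mult)
  also have "\<dots> \<le> emeasure (graph_model n \<rho> W) S"
    unfolding emeasure_graph_model[OF S]
    using c by (intro nn_integral_mono) (auto simp: indicator_def measure_pmf.emeasure_eq_measure intro!: ennreal_leI)
  finally have "(1 - b) * measure (sample_space n) X \<le> measure (graph_model n \<rho> W) S"
    by (simp add: gm.emeasure_eq_measure)
  moreover have "(1 - b) * (1 - a) \<le> (1 - b) * measure (sample_space n) X" using a b by (intro mult_left_mono) auto
  moreover have "1 - a - b \<le> (1 - b) * (1 - a)" using mult_nonneg_nonneg[OF a0 b(1)] by (simp add: algebra_simps)
  ultimately show ?thesis by linarith
qed

end

section \<open>Measurability of the sampling error\<close>

lemma measurable_cell_bounded: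
  assumes "0 < n"
  shows "cell n \<in> unit_interval \<rightarrow>\<^sub>M count_space {..<n}"
proof (subst measurable_count_space_eq2_countable)
  show "cell n \<in> space unit_interval \<rightarrow> {..<n} \<and> (\<forall>a\<in>{..<n}. cell n -` {a} \<inter> space unit_interval \<in> sets unit_interval)"
    using assms measurable_sets[OF measurable_cell, of _ n] by (auto simp: cell_less)
qed

text \<open>For each of the finitely many permutations the integrand is measurable jointly in the
  sample and both coordinates, because it selects among finitely many measurable functions by the
  cell indices. Integrating out the coordinates and taking a finite minimum preserves measurability
  in x.\<close>

lemma measurable_eps_sample:
  assumes W: "graphon W" and n: "0 < n"
  shows "eps_sample n W \<in> borel_measurable (sample_space n)"
proof -
  have "(\<lambda>x. kernel_dist (step_kernel n (\<lambda>i j. sampled_matrix W x (\<sigma> i) (\<sigma> j))) W) \<in> borel_measurable (sample_space n)"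
    if \<sigma>: "\<sigma> permutes {..<n}" for \<sigma>
  proof -
    let ?N = "sample_space n \<Otimes>\<^sub>M unit_square"
    have c1: "(\<lambda>z. cell n (fst (snd z))) \<in> ?N \<rightarrow>\<^sub>M count_space {..<n}"
      and c2: "(\<lambda>z. cell n (snd (snd z))) \<in> ?N \<rightarrow>\<^sub>M count_space {..<n}"
      by (rule measurable_compose[OF _ measurable_cell_bounded[OF n]], measurable)+
    have "(\<lambda>z. (\<lambda>i z. W (fst z (\<sigma> i)) (fst z (\<sigma> (cell n (snd (snd z)))))) (cell n (fst (snd z))) z) \<in> borel_measurable ?N"
    proof (rule measurable_compose_countable'[OF _ c1])
      fix i assume i: "i \<in> {..<n}"
      have "(\<lambda>z. (\<lambda>j z. W (fst z (\<sigma> i)) (fst z (\<sigma> j))) (cell n (snd (snd z))) z) \<in> borel_measurable ?N"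
      proof (rule measurable_compose_countable'[OF _ c2])
        fix j assume "j \<in> {..<n}"
        then have "(\<lambda>x. W (x (\<sigma> i)) (x (\<sigma> j))) \<in> borel_measurable (sample_space n)"
          using permutes_in_image[OF \<sigma>] i by (intro measurable_kernel_sample graphon_bounded_kernel W) auto
        from measurable_compose[OF measurable_fst this]
        show "(\<lambda>z. W (fst z (\<sigma> i)) (fst z (\<sigma> j))) \<in> borel_measurable ?N" .
      qed simp
      then show "(\<lambda>z. W (fst z (\<sigma> i)) (fst z (\<sigma> (cell n (snd (snd z)))))) \<in> borel_measurable ?N" .
    qed simp
    then have "(\<lambda>z. (step_kernel n (\<lambda>i j. sampled_matrix W (fst z) (\<sigma> i) (\<sigma> j)) (fst (snd z)) (snd (snd z)) - W (fst (snd z)) (snd (snd z)))\<^sup>2) \<in> borel_measurable ?N"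
      using measurable_compose[OF measurable_snd bounded_kernel_measurable[OF graphon_bounded_kernel[OF W]]]
      unfolding step_kernel_def sampled_matrix_def by measurable
    then have "(\<lambda>x. \<integral>p. (step_kernel n (\<lambda>i j. sampled_matrix W x (\<sigma> i) (\<sigma> j)) (fst p) (snd p) - W (fst p) (snd p))\<^sup>2
        \<partial>unit_square) \<in> borel_measurable (sample_space n)"
      by (intro UI2.P.borel_measurable_lebesgue_integral) (simp add: case_prod_beta')
    then show ?thesis unfolding kernel_norm2_alt by measurable
  qed
  then show ?thesis
    unfolding eps_sample_def[abs_def] by (intro borel_measurable_Min) (auto simp: finite_permutations)
qed

text \<open>The set \<open>L\<close> may be uncountable: entries of a least-squares matrix outside
  the k by k block are arbitrary. All conditions are lower bounds on the single variable
  \<open>eps_sample\<close>, and any intersection of closed half-lines is closed.\<close>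

lemma sets_eps_sample_ge:
  assumes W: "graphon W" and n: "0 < n" and a: "0 < (a::real)"
  shows "{x \<in> space (sample_space n). \<forall>B\<in>L. c B \<le> d + a * eps_sample n W x + r} \<in> sets (sample_space n)"
proof -
  have "{x \<in> space (sample_space n). \<forall>B\<in>L. c B \<le> d + a * eps_sample n W x + r}
    = eps_sample n W -` (\<Inter>B\<in>L. {(c B - d - r) / a..}) \<inter> space (sample_space n)"
    using a by (auto simp: field_simps)
  moreover have "(\<Inter>B\<in>L. {(c B - d - r) / a..}) \<in> sets borel"
    by (intro borel_closed closed_INT) auto
  ultimately show ?thesis using measurable_sets[OF measurable_eps_sample[OF W n]] by simp
qed

section \<open>Matrix norms and block sums\<close>

lemma matrix_norm2_nonneg [simp]: "0 \<le> matrix_norm2 m A"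
  by (simp add: matrix_norm2_def sum_nonneg)

lemma matrix_norm2_square: "(matrix_norm2 m A)\<^sup>2 = (\<Sum>i<m. \<Sum>j<m. (A i j)\<^sup>2) / (real m)\<^sup>2"
  by (simp add: matrix_norm2_def sum_nonneg)

lemma matrix_norm2_cong:
  "(\<And>i j. i < m \<Longrightarrow> j < m \<Longrightarrow> A i j = B i j) \<Longrightarrow> matrix_norm2 m A = matrix_norm2 m B"
  by (simp add: matrix_norm2_def)

lemma matrix_norm2_scale: "matrix_norm2 m (\<lambda>i j. c * A i j) = \<bar>c\<bar> * matrix_norm2 m A"
  by (simp add: matrix_norm2_def power_mult_distrib sum_distrib_left[symmetric] real_sqrt_mult real_sqrt_divide)

lemma matrix_norm2_permute:
  assumes "\<sigma> permutes {..<m}"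
  shows "matrix_norm2 m (\<lambda>i j. A (\<sigma> i) (\<sigma> j)) = matrix_norm2 m A"
proof -
  have "(\<Sum>i<m. \<Sum>j<m. (A (\<sigma> i) (\<sigma> j))\<^sup>2) = (\<Sum>i<m. \<Sum>j<m. (A (\<sigma> i) j)\<^sup>2)"
  proof (rule sum.cong[OF refl])
    fix i
    show "(\<Sum>j<m. (A (\<sigma> i) (\<sigma> j))\<^sup>2) = (\<Sum>j<m. (A (\<sigma> i) j)\<^sup>2)"
      using sum.permute[OF assms, of "\<lambda>j. (A (\<sigma> i) j)\<^sup>2"] by (simp add: o_def)
  qed
  also have "\<dots> = (\<Sum>i<m. \<Sum>j<m. (A i j)\<^sup>2)"
    using sum.permute[OF assms, of "\<lambda>i. \<Sum>j<m. (A i j)\<^sup>2"] by (simp add: o_def)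
  finally show ?thesis by (simp add: matrix_norm2_def)
qed

lemma matrix_norm2_le_const:
  assumes "0 < m" "\<And>i j. i < m \<Longrightarrow> j < m \<Longrightarrow> \<bar>A i j\<bar> \<le> c"
  shows "matrix_norm2 m A \<le> c"
proof -
  have c: "0 \<le> c" using assms(2)[of 0 0] assms(1) by simp
  have "(\<Sum>i<m. \<Sum>j<m. (A i j)\<^sup>2) \<le> (\<Sum>i<m. \<Sum>j<m. c\<^sup>2)"
    using assms c by (intro sum_mono) (auto simp: abs_le_square_iff[symmetric])
  also have "\<dots> = (c * real m)\<^sup>2" by (simp add: power2_eq_square)
  finally have "(matrix_norm2 m A)\<^sup>2 \<le> (c * real m)\<^sup>2 / (real m)\<^sup>2"
    unfolding matrix_norm2_square by (rule divide_right_mono) simp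
  also have "\<dots> = c\<^sup>2" using assms(1) by (simp add: power_divide[symmetric])
  finally show ?thesis by (rule power2_le_imp_le[OF _ c])
qed

lemma matrix_norm2_closer:
  fixes A Q X Y :: "nat \<Rightarrow> nat \<Rightarrow> real"
  assumes "matrix_norm2 n (\<lambda>u v. Y u v - A u v) \<le> matrix_norm2 n (\<lambda>u v. X u v - A u v)"
  shows "(matrix_norm2 n (\<lambda>u v. Y u v - Q u v))\<^sup>2 \<le> (matrix_norm2 n (\<lambda>u v. X u v - Q u v))\<^sup>2
    + 2 * ((\<Sum>u<n. \<Sum>v<n. (A u v - Q u v) * Y u v) - (\<Sum>u<n. \<Sum>v<n. (A u v - Q u v) * X u v)) / (real n)\<^sup>2"
proof -
  \<comment> \<open>The last sum does not depend on \<open>Z\<close> and cancels between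
    \<open>Y\<close> and \<open>X\<close>.\<close>
  have expand: "(\<Sum>u<n. \<Sum>v<n. (Z u v - Q u v)\<^sup>2) = (\<Sum>u<n. \<Sum>v<n. (Z u v - A u v)\<^sup>2)
      + 2 * (\<Sum>u<n. \<Sum>v<n. (A u v - Q u v) * Z u v) + (\<Sum>u<n. \<Sum>v<n. (Q u v)\<^sup>2 - (A u v)\<^sup>2)" for Z
    by (simp add: sum_distrib_left sum.distrib[symmetric] power2_eq_square algebra_simps)
  have "(matrix_norm2 n (\<lambda>u v. Y u v - A u v))\<^sup>2 \<le> (matrix_norm2 n (\<lambda>u v. X u v - A u v))\<^sup>2"
    by (rule power_mono[OF assms]) simp
  then show ?thesis
    unfolding matrix_norm2_square expand by (simp add: add_divide_distrib diff_divide_distrib right_diff_distrib)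
qed

text \<open>The matrices need not be symmetric, so an unordered pair meets the set \<open>S\<close>
  in both orders. The average of the two indicators stays in [0,1], as the Chernoff bound requires;
  the 2 divided out here returns as the factor in \<open>2 * \<mu> * T\<close>.\<close>

definition block_indicator :: "(nat \<Rightarrow> nat) \<Rightarrow> (nat \<times> nat) set \<Rightarrow> nat \<times> nat \<Rightarrow> real" where
  "block_indicator \<pi> S e = (of_bool ((\<pi> (fst e), \<pi> (snd e)) \<in> S) + of_bool ((\<pi> (snd e), \<pi> (fst e)) \<in> S)) / 2"

text \<open>The left-hand side is linear in \<open>B\<close>, hence at most its value at one of the extreme points of the
  cube of matrices with entries in \<open>[0,\<mu>]\<close>.  This keeps the union bound down to the sets \<open>S\<close>.\<close>

lemma block_sum_le:
  assumes B: "\<And>i j. i < k \<Longrightarrow> j < k \<Longrightarrow> 0 \<le> B i j \<and> B i j \<le> \<mu>" and \<pi>: "\<pi> ` {..<n} \<subseteq> {..<k}" and \<mu>: "0 \<le> \<mu>"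
    and T: "\<And>S. S \<subseteq> {..<k} \<times> {..<k} \<Longrightarrow> \<bar>\<Sum>e\<in>vertex_pairs n. d e * block_indicator \<pi> S e\<bar> \<le> T"
  shows "\<bar>\<Sum>(u, v)\<in>vertex_pairs n. d (u, v) * (B (\<pi> u) (\<pi> v) + B (\<pi> v) (\<pi> u))\<bar> \<le> 2 * \<mu> * T"
proof -
  let ?K = "{..<k} \<times> {..<k}"
  \<comment> \<open>\<open>t p\<close> is the coefficient of the entry \<open>B p\<close> in the
    linear form.\<close>
  define t where "t = (\<lambda>p. \<Sum>e\<in>vertex_pairs n. d e * (of_bool ((\<pi> (fst e), \<pi> (snd e)) = p) + of_bool ((\<pi> (snd e), \<pi> (fst e)) = p)))"
  have pt: "(\<Sum>p\<in>?K. f p * of_bool (q = p)) = (f q :: real)" if "q \<in> ?K" for f q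
    using that by (subst sum.remove[of _ q]) auto
  have e: "\<pi> (fst e) < k" "\<pi> (snd e) < k" if "e \<in> vertex_pairs n" for e
    using that image_subset_iff[THEN iffD1, OF \<pi>] by (auto simp: vertex_pairs_def)
  have "(\<Sum>(u, v)\<in>vertex_pairs n. d (u, v) * (B (\<pi> u) (\<pi> v) + B (\<pi> v) (\<pi> u)))
    = (\<Sum>e\<in>vertex_pairs n. \<Sum>p\<in>?K. case_prod B p * (d e * (of_bool ((\<pi> (fst e), \<pi> (snd e)) = p) + of_bool ((\<pi> (snd e), \<pi> (fst e)) = p))))"
  proof (rule sum.cong[OF refl])
    fix f assume f: "f \<in> vertex_pairs n"
    have "(\<Sum>p\<in>?K. case_prod B p * (d f * (of_bool ((\<pi> (fst f), \<pi> (snd f)) = p) + of_bool ((\<pi> (snd f), \<pi> (fst f)) = p))))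
      = d f * ((\<Sum>p\<in>?K. case_prod B p * of_bool ((\<pi> (fst f), \<pi> (snd f)) = p)) + (\<Sum>p\<in>?K. case_prod B p * of_bool ((\<pi> (snd f), \<pi> (fst f)) = p)))"
      unfolding sum.distrib[symmetric] sum_distrib_left
      by (rule sum.cong[OF refl]) (simp only: distrib_left mult.left_commute)
    also have "\<dots> = d f * (B (\<pi> (fst f)) (\<pi> (snd f)) + B (\<pi> (snd f)) (\<pi> (fst f)))"
      using e[OF f] by (simp add: pt del: of_bool_eq_iff)
    finally show "(case f of (u, v) \<Rightarrow> d (u, v) * (B (\<pi> u) (\<pi> v) + B (\<pi> v) (\<pi> u)))
      = (\<Sum>p\<in>?K. case_prod B p * (d f * (of_bool ((\<pi> (fst f), \<pi> (snd f)) = p) + of_bool ((\<pi> (snd f), \<pi> (fst f)) = p))))"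
      by (simp add: case_prod_beta')
  qed
  also have "\<dots> = (\<Sum>p\<in>?K. case_prod B p * t p)"
    by (subst sum.swap) (simp add: t_def sum_distrib_left)
  finally have eq: "(\<Sum>(u, v)\<in>vertex_pairs n. d (u, v) * (B (\<pi> u) (\<pi> v) + B (\<pi> v) (\<pi> u))) = (\<Sum>p\<in>?K. case_prod B p * t p)" .
  have tS: "\<bar>\<Sum>p\<in>S. t p\<bar> \<le> 2 * T" if S: "S \<subseteq> ?K" for S
  proof -
    have fin: "finite S" by (rule finite_subset[OF S]) simp
    have "(\<Sum>p\<in>S. t p) = (\<Sum>e\<in>vertex_pairs n. \<Sum>p\<in>S. d e * (of_bool ((\<pi> (fst e), \<pi> (snd e)) = p) + of_bool ((\<pi> (snd e), \<pi> (fst e)) = p)))"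
      unfolding t_def by (rule sum.swap)
    also have "\<dots> = (\<Sum>e\<in>vertex_pairs n. 2 * (d e * block_indicator \<pi> S e))"
    proof (rule sum.cong[OF refl])
      fix e
      have 1: "(\<Sum>p\<in>S. of_bool (q = p)) = (of_bool (q \<in> S) :: real)" for q
        using fin by (cases "q \<in> S") (auto simp: of_bool_def)
      show "(\<Sum>p\<in>S. d e * (of_bool ((\<pi> (fst e), \<pi> (snd e)) = p) + of_bool ((\<pi> (snd e), \<pi> (fst e)) = p))) = 2 * (d e * block_indicator \<pi> S e)"
        unfolding sum_distrib_left[symmetric] sum.distrib 1 block_indicator_def by simp
    qed
    also have "\<dots> = 2 * (\<Sum>e\<in>vertex_pairs n. d e * block_indicator \<pi> S e)" by (simp add: sum_distrib_left)
    finally show ?thesis using T[OF S] by (simp add: abs_mult)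
  qed
  \<comment> \<open>The form is largest when \<open>B\<close> is \<mu> on the nonnegative
    coefficients and 0 elsewhere, smallest in the opposite case; \<open>tS\<close> bounds both
    extremes.\<close>
  define P where "P = {p\<in>?K. 0 \<le> t p}"
  define N where "N = {p\<in>?K. t p < 0}"
  have PN: "P \<subseteq> ?K" "N \<subseteq> ?K" "P \<inter> N = {}" "?K = P \<union> N" by (auto simp: P_def N_def)
  have finPN: "finite P" "finite N" using PN by (meson finite_SigmaI finite_lessThan finite_subset)+
  have split: "(\<Sum>p\<in>?K. case_prod B p * t p) = (\<Sum>p\<in>P. case_prod B p * t p) + (\<Sum>p\<in>N. case_prod B p * t p)"
    unfolding PN(4) by (rule sum.union_disjoint[OF finPN PN(3)])
  have Bp: "0 \<le> case_prod B p" "case_prod B p \<le> \<mu>" if "p \<in> ?K" for p using that B by auto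
  have "0 \<le> (\<Sum>p\<in>P. case_prod B p * t p)"
    by (intro sum_nonneg mult_nonneg_nonneg Bp) (auto simp: P_def)
  moreover have "(\<Sum>p\<in>P. case_prod B p * t p) \<le> (\<Sum>p\<in>P. \<mu> * t p)"
    by (intro sum_mono mult_right_mono Bp) (auto simp: P_def)
  moreover have "(\<Sum>p\<in>P. \<mu> * t p) \<le> \<mu> * (2 * T)"
    unfolding sum_distrib_left[symmetric] using tS[OF PN(1)] \<mu> by (intro mult_left_mono) auto
  moreover have "(\<Sum>p\<in>N. case_prod B p * t p) \<le> 0"
    by (intro sum_nonpos mult_nonneg_nonpos Bp) (auto simp: N_def)
  moreover have "(\<Sum>p\<in>N. \<mu> * t p) \<le> (\<Sum>p\<in>N. case_prod B p * t p)"
    by (intro sum_mono mult_right_mono_neg Bp) (auto simp: N_def)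
  moreover have "\<mu> * (- (2 * T)) \<le> (\<Sum>p\<in>N. \<mu> * t p)"
    unfolding sum_distrib_left[symmetric] using tS[OF PN(2)] \<mu> by (intro mult_left_mono) auto
  ultimately show ?thesis unfolding eq split by (simp add: abs_le_iff algebra_simps)
qed

text \<open>The adjacency matrix vanishes on the diagonal whereas \<open>Q\<close> has the entries
  \<rho> W(x_u,x_u) there. This part is not random noise and is paid for by the term
  \<open>n * (D * \<mu>)\<close>.\<close>

lemma adjacency_sum:
  assumes G: "G \<subseteq> vertex_pairs n" and Qs: "\<And>u v. u < n \<Longrightarrow> v < n \<Longrightarrow> Q u v = Q v u"
    and Q: "\<And>u. u < n \<Longrightarrow> 0 \<le> Q u u \<and> Q u u \<le> D" and Y: "\<And>u. u < n \<Longrightarrow> 0 \<le> Y u u \<and> Y u u \<le> \<mu>"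
  shows "\<bar>\<Sum>u<n. \<Sum>v<n. (adjacency G u v - Q u v) * Y u v\<bar>
    \<le> \<bar>\<Sum>(u, v)\<in>vertex_pairs n. (of_bool ((u, v) \<in> G) - Q u v) * (Y u v + Y v u)\<bar> + real n * (D * \<mu>)"
proof -
  have diag: "adjacency G u u = 0" for u using G by (auto simp: adjacency_def vertex_pairs_def)
  have a: "adjacency G u v = of_bool ((u, v) \<in> G)" "adjacency G v u = of_bool ((u, v) \<in> G)" if "(u, v) \<in> vertex_pairs n" for u v
    using G that by (auto simp: adjacency_def vertex_pairs_def)
  have 1: "(\<Sum>(i, j)\<in>vertex_pairs n. (adjacency G i j - Q i j) * Y i j + (adjacency G j i - Q j i) * Y j i)
     = (\<Sum>(u, v)\<in>vertex_pairs n. (of_bool ((u, v) \<in> G) - Q u v) * (Y u v + Y v u))"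
  proof (rule sum.cong[OF refl], clarify)
    fix i j assume ij: "(i, j) \<in> vertex_pairs n"
    then have "Q j i = Q i j" using Qs by (auto simp: vertex_pairs_def)
    then show "(adjacency G i j - Q i j) * Y i j + (adjacency G j i - Q j i) * Y j i = (of_bool ((i, j) \<in> G) - Q i j) * (Y i j + Y j i)"
      unfolding a[OF ij] by (simp add: distrib_left)
  qed
  have 2: "\<bar>\<Sum>u<n. (adjacency G u u - Q u u) * Y u u\<bar> \<le> (\<Sum>u<n. D * \<mu>)"
  proof (rule order_trans[OF sum_abs sum_mono])
    fix u assume "u \<in> {..<n}"
    then have u: "u < n" by simp
    show "\<bar>(adjacency G u u - Q u u) * Y u u\<bar> \<le> D * \<mu>"
      unfolding diag abs_mult using Q[OF u] Y[OF u] by (intro mult_mono) auto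
  qed
  show ?thesis unfolding sum_sum_vertex_pairs 1 using 2 by simp
qed

section \<open>Equipartitions and the least-squares objective\<close>

lemma finite_equipartitions: "finite (equipartitions n k)"
  by (rule finite_subset[of _ "{..<n} \<rightarrow>\<^sub>E {..<k}"]) (auto simp: equipartitions_def intro!: finite_PiE)

lemma delta2_hat_le:
  assumes "\<pi> \<in> equipartitions n k"
  shows "delta2_hat n k B G \<le> matrix_norm2 n (\<lambda>u v. B (\<pi> u) (\<pi> v) - adjacency G u v)"
  unfolding delta2_hat_def by (rule Min_le) (use assms finite_equipartitions in auto)

lemma delta2_hat_attained:
  assumes "equipartitions n k \<noteq> {}"
  obtains \<pi> where "\<pi> \<in> equipartitions n k" "delta2_hat n k B G = matrix_norm2 n (\<lambda>u v. B (\<pi> u) (\<pi> v) - adjacency G u v)"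
proof -
  have "delta2_hat n k B G \<in> (\<lambda>\<pi>. matrix_norm2 n (\<lambda>u v. B (\<pi> u) (\<pi> v) - adjacency G u v)) ` equipartitions n k"
    unfolding delta2_hat_def by (rule Min_in) (use assms finite_equipartitions in auto)
  then show thesis using that by blast
qed

lemma floor_equipartition:
  assumes "k \<le> n" "0 < k" and \<sigma>: "\<sigma> permutes {..<n}"
  shows "(\<lambda>v\<in>{..<n}. \<sigma> v * k div n) \<in> equipartitions n k"
proof -
  have n: "0 < n" using assms by simp
  have lt: "v * k div n < k" if "v < n" for v
  proof -
    have "v * k < n * k" using that assms by simp
    then show ?thesis using n by (simp add: div_less_iff_less_mult mult.commute)
  qed
  have "{v \<in> {..<n}. (\<lambda>v\<in>{..<n}. \<sigma> v * k div n) v = i} = {v \<in> {..<n}. \<sigma> v * k div n = i}" for i by auto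
  then show ?thesis
    unfolding equipartitions_def
    using card_permuted[OF \<sigma>, of "\<lambda>v. v * k div n = _"] card_floor_partition[OF _ n] lt permutes_in_image[OF \<sigma>]
    by (auto simp del: restrict_apply)
qed

text \<open>Every class has at least n/(2k) elements: it is nonempty because n/k \<ge> 1, and a size
  that is at least 1 and above n/k - 1 exceeds half of n/k. Thus each entry of \<open>B\<close> has
  at least a quarter of its weight in the blown-up square sum.\<close>

lemma matrix_norm2_equipartition_ge:
  assumes \<pi>: "\<pi> \<in> equipartitions n k" and kn: "k \<le> n" "0 < k"
  shows "matrix_norm2 k B \<le> 2 * matrix_norm2 n (\<lambda>u v. B (\<pi> u) (\<pi> v))"
proof -
  define c where "c = (\<lambda>i. real (card {v\<in>{..<n}. \<pi> v = i}))"
  have img: "\<pi> ` {..<n} \<subseteq> {..<k}" using \<pi> by (auto simp: equipartitions_def)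
  have n: "0 < n" using kn by simp
  have c: "real n / (2 * real k) \<le> c i" if i: "i < k" for i
  proof -
    have b: "\<bar>c i - real n / real k\<bar> < 1" using \<pi> i by (simp add: equipartitions_def c_def)
    have nk: "1 \<le> real n / real k" using kn by simp
    have "0 < c i" using b nk by linarith
    then have "1 \<le> c i" by (simp add: c_def)
    moreover have "real n / (2 * real k) = (real n / real k) / 2" by simp
    ultimately show ?thesis using b by linarith
  qed
  have "(real n / (2 * real k))\<^sup>2 * (\<Sum>i<k. \<Sum>j<k. (B i j)\<^sup>2) = (\<Sum>i<k. \<Sum>j<k. (real n / (2 * real k)) * (real n / (2 * real k)) * (B i j)\<^sup>2)"
    by (simp add: sum_distrib_left power2_eq_square)
  also have "\<dots> \<le> (\<Sum>i<k. \<Sum>j<k. c i * c j * (B i j)\<^sup>2)"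
    by (intro sum_mono mult_right_mono mult_mono c) (auto simp: c_def)
  also have "\<dots> = (\<Sum>i<k. c i * (\<Sum>j<k. c j * (B i j)\<^sup>2))" by (simp add: sum_distrib_left mult.assoc)
  also have "\<dots> = (\<Sum>u<n. \<Sum>j<k. c j * (B (\<pi> u) j)\<^sup>2)"
    unfolding c_def by (rule sum_fun_comp[symmetric]) (use img in auto)
  also have "\<dots> = (\<Sum>u<n. \<Sum>v<n. (B (\<pi> u) (\<pi> v))\<^sup>2)"
    unfolding c_def by (intro sum.cong refl sum_fun_comp[symmetric]) (use img in auto)
  finally have "(real n / (2 * real k))\<^sup>2 * (\<Sum>i<k. \<Sum>j<k. (B i j)\<^sup>2) \<le> (\<Sum>u<n. \<Sum>v<n. (B (\<pi> u) (\<pi> v))\<^sup>2)" .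
  then have "(matrix_norm2 k B)\<^sup>2 \<le> (2 * matrix_norm2 n (\<lambda>u v. B (\<pi> u) (\<pi> v)))\<^sup>2"
    unfolding power_mult_distrib matrix_norm2_square using n kn by (simp add: field_simps power2_eq_square)
  then show ?thesis by (rule power2_le_imp_le) simp
qed

section \<open>The least-squares estimate\<close>

lemma power4_eq_square_square: "x ^ 4 = ((x::real)\<^sup>2)\<^sup>2"
  by (simp add: power4_eq_xxxx power2_eq_square)

lemma graphon_pointwise:
  assumes "graphon W" "x \<in> {0..1}" "y \<in> {0..1}"
  shows "0 \<le> W x y" "W x y = W y x"
  using assms by (auto simp: graphon_def)

lemma normalized_integral:
  "normalized W \<Longrightarrow> (\<integral>p. W (fst p) (snd p) \<partial>unit_square) = 1"
  by (simp add: normalized_def case_prod_beta')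

lemma normalized_bound_ge_1:
  assumes "graphon W" "normalized W" "\<forall>x\<in>{0..1}. \<forall>y\<in>{0..1}. W x y \<le> \<Lambda>"
  shows "1 \<le> \<Lambda>"
proof -
  have "(\<integral>p. W (fst p) (snd p) \<partial>unit_square) \<le> (\<integral>p. \<Lambda> \<partial>unit_square)"
    by (rule integral_mono[OF integrable_bounded_kernel[OF graphon_bounded_kernel[OF assms(1)]]])
      (use assms(3) in \<open>auto simp: space_pair_measure\<close>)
  then show ?thesis using normalized_integral[OF assms(2)] by (simp add: UI2.P.prob_space)
qed

text \<open>W^2 \<le> \<Lambda> W together with mean 1 improves the pointwise bound \<Lambda> to its
  square root, which all later norm estimates rely on.\<close>

lemma kernel_norm2_graphon_le:
  assumes "graphon W" "normalized W" "\<forall>x\<in>{0..1}. \<forall>y\<in>{0..1}. W x y \<le> \<Lambda>"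
  shows "kernel_norm2 W \<le> sqrt \<Lambda>"
proof -
  note bW = graphon_bounded_kernel[OF assms(1)]
  have "(\<integral>p. (W (fst p) (snd p))\<^sup>2 \<partial>unit_square)
    \<le> (\<integral>p. \<Lambda> * W (fst p) (snd p) \<partial>unit_square)"
  proof (rule integral_mono[OF integrable_bounded_kernel[OF bounded_kernel_square[OF bW]] integrable_mult_right[OF integrable_bounded_kernel[OF bW]]])
    fix p assume "p \<in> space unit_square"
    then have "fst p \<in> {0..1}" "snd p \<in> {0..1}" by (auto simp: space_pair_measure)
    then show "(W (fst p) (snd p))\<^sup>2 \<le> \<Lambda> * W (fst p) (snd p)"
      using assms(3) graphon_pointwise[OF assms(1)] by (simp add: power2_eq_square mult_right_mono)
  qed
  also have "\<dots> = \<Lambda>" using normalized_integral[OF assms(2)] by simp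
  finally show ?thesis by (simp add: kernel_norm2_alt)
qed

lemma eps_oracle_bounded_below: "bdd_below (range (\<lambda>B. kernel_dist W (step_kernel k B)))"
  by (rule bdd_belowI2[of _ 0]) simp

lemma eps_oracle_nonneg: "0 \<le> eps_oracle k W"
  unfolding eps_oracle_def by (rule cINF_greatest) auto

lemma eps_oracle_le: "eps_oracle k W \<le> kernel_dist W (step_kernel k B)"
  unfolding eps_oracle_def by (rule cINF_lower[OF eps_oracle_bounded_below]) simp

text \<open>\<open>W\<close> takes values in [0,\<Lambda>], so clipping the entries of a near
  minimiser to this range brings the step kernel pointwise closer. The range is what lets the scaled
  matrix enter the search grid.\<close>

lemma eps_oracle_near_minimizer:
  assumes W: "graphon W" and L: "\<forall>x\<in>{0..1}. \<forall>y\<in>{0..1}. W x y \<le> \<Lambda>" and k: "0 < k" and e: "0 < e"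
  obtains B where "\<And>i j. 0 \<le> B i j \<and> B i j \<le> \<Lambda>"
    "kernel_dist W (step_kernel k B) \<le> eps_oracle k W + e"
proof -
  note bW = graphon_bounded_kernel[OF W]
  have \<Lambda>: "0 \<le> \<Lambda>" using L[rule_format, of 0 0] graphon_pointwise(1)[OF W, of 0 0] by simp
  have "\<exists>B. kernel_dist W (step_kernel k B) < eps_oracle k W + e"
  proof (rule ccontr)
    assume "\<not> ?thesis"
    then have "eps_oracle k W + e \<le> kernel_dist W (step_kernel k B)" for B by (simp add: not_less)
    then have "eps_oracle k W + e \<le> eps_oracle k W"
      by (subst (2) eps_oracle_def) (rule cINF_greatest, auto)
    with e show False by simp
  qed
  then obtain B where B: "kernel_dist W (step_kernel k B) < eps_oracle k W + e" by blast
  define B' where "B' = (\<lambda>i j. max 0 (min \<Lambda> (B i j)))"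
  have "kernel_dist W (step_kernel k B') \<le> kernel_dist W (step_kernel k B)"
  proof (rule kernel_norm2_mono[OF bounded_kernel_diff[OF bW bounded_kernel_step[OF k]] bounded_kernel_diff[OF bW bounded_kernel_step[OF k]]])
    fix x y :: real assume xy: "x \<in> {0..1}" "y \<in> {0..1}"
    have "0 \<le> W x y" "W x y \<le> \<Lambda>" using graphon_pointwise(1)[OF W xy] L xy by auto
    then show "\<bar>W x y - step_kernel k B' x y\<bar> \<le> \<bar>W x y - step_kernel k B x y\<bar>"
      unfolding step_kernel_def B'_def by linarith
  qed
  then show thesis using B \<Lambda> by (intro that[of B']) (auto simp: B'_def)
qed

lemma eps_sample_attained:
  obtains \<sigma> where "\<sigma> permutes {..<n}"
    "eps_sample n W x = kernel_dist (step_kernel n (\<lambda>i j. sampled_matrix W x (\<sigma> i) (\<sigma> j))) W"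
proof -
  let ?f = "\<lambda>\<sigma>. kernel_dist (step_kernel n (\<lambda>i j. sampled_matrix W x (\<sigma> i) (\<sigma> j))) W"
  have "?f ` {\<sigma>. \<sigma> permutes {..<n}} \<noteq> {}" using permutes_id by blast
  then have "eps_sample n W x \<in> ?f ` {\<sigma>. \<sigma> permutes {..<n}}"
    unfolding eps_sample_def by (intro Min_in finite_imageI finite_permutations) auto
  then show thesis using that by blast
qed

lemma eps_sample_nonneg: "0 \<le> eps_sample n W x"
  by (rule eps_sample_attained[of n W x]) simp

lemma eps_sample_le:
  assumes "\<sigma> permutes {..<n}"
  shows "eps_sample n W x \<le> kernel_dist (step_kernel n (\<lambda>i j. sampled_matrix W x (\<sigma> i) (\<sigma> j))) W"
  unfolding eps_sample_def by (rule Min_le) (use assms in \<open>auto simp: finite_permutations\<close>)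

abbreviation good_event ::
    "nat \<Rightarrow> nat \<Rightarrow> (real \<Rightarrow> real \<Rightarrow> real) \<Rightarrow> real \<Rightarrow> real \<Rightarrow> real \<Rightarrow> ((nat \<Rightarrow> real) \<times> (nat \<times> nat) set) set" where
  "good_event n k W \<rho> lam M \<equiv> {(x, G) \<in> space (graph_model n \<rho> W).
     \<forall>B \<in> least_squares n k (lam * edge_density n G) G.
       delta2 W (estimated_kernel n k G B) \<le> eps_oracle k W + 2 * eps_sample n W x + M * root 4 (rate n k \<rho> lam)}"

lemma prob_Int_ge:
  "measure_pmf.prob p (A \<inter> B) \<ge> 1 - a - b" if "measure_pmf.prob p A \<ge> 1 - a" "measure_pmf.prob p B \<ge> 1 - b"
proof -
  have "measure_pmf.prob p A \<le> measure_pmf.prob p ((A \<inter> B) \<union> (UNIV - B))"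
    by (rule measure_pmf.finite_measure_mono) auto
  also have "\<dots> \<le> measure_pmf.prob p (A \<inter> B) + measure_pmf.prob p (UNIV - B)" by (rule measure_Un_le) auto
  also have "measure_pmf.prob p (UNIV - B) = 1 - measure_pmf.prob p B" using measure_pmf.prob_compl[of B p] by simp
  finally show ?thesis using that by linarith
qed

section \<open>Consequences of admissibility\<close>

locale least_squares_model =
  fixes n k :: nat and W :: "real \<Rightarrow> real \<Rightarrow> real" and \<Lambda> \<rho> lam :: real
  assumes adm: "admissible n k W \<Lambda> \<rho> lam"
begin

lemma adm_graphon: "graphon W" "normalized W" "\<forall>x\<in>{0..1}. \<forall>y\<in>{0..1}. W x y \<le> \<Lambda>"
  using adm by (auto simp: admissible_def)

lemma adm_\<Lambda>: "1 \<le> \<Lambda>" by (rule normalized_bound_ge_1[OF adm_graphon])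

lemma adm_\<rho>: "0 < \<rho>" "\<rho> * \<Lambda> \<le> 1" "\<rho> \<le> 1"
proof -
  have "0 < \<rho> * \<Lambda>" using adm by (simp add: admissible_def)
  then show \<rho>: "0 < \<rho>" using adm_\<Lambda> by (simp add: zero_less_mult_iff)
  show \<rho>\<Lambda>: "\<rho> * \<Lambda> \<le> 1" using adm by (simp add: admissible_def)
  have "\<rho> * 1 \<le> \<rho> * \<Lambda>" using \<rho> adm_\<Lambda> by (intro mult_left_mono) auto
  with \<rho>\<Lambda> show "\<rho> \<le> 1" by simp
qed

lemma adm_lam: "1 \<le> lam" "2 * \<Lambda> \<le> lam" "lam\<^sup>2 \<le> real n"
proof -
  show 1: "1 \<le> lam" "2 * \<Lambda> \<le> lam" using adm by (auto simp: admissible_def)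
  have "lam \<le> sqrt (real n)" using adm by (simp add: admissible_def)
  then have "lam\<^sup>2 \<le> (sqrt (real n))\<^sup>2" using 1 by (intro power_mono) auto
  then show "lam\<^sup>2 \<le> real n" by simp
qed

lemma adm_k: "2 \<le> k" "(real k)\<^sup>2 \<le> \<rho> * (real n)\<^sup>2 / 2" "ln (real k) \<le> \<rho> * real n / 2"
proof -
  show k: "2 \<le> k" using adm by (simp add: admissible_def)
  have a: "real k \<le> real n * sqrt (\<rho> / 2)" "real k \<le> exp (\<rho> * real n / 2)" using adm by (auto simp: admissible_def)
  have "(real k)\<^sup>2 \<le> (real n * sqrt (\<rho> / 2))\<^sup>2" by (rule power_mono[OF a(1)]) simp
  then show "(real k)\<^sup>2 \<le> \<rho> * (real n)\<^sup>2 / 2" using adm_\<rho>(1) by (simp add: power_mult_distrib mult.commute)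
  have "ln (real k) \<le> ln (exp (\<rho> * real n / 2))" using a(2) k by (subst ln_le_cancel_iff) auto
  then show "ln (real k) \<le> \<rho> * real n / 2" by simp
qed

text \<open>All four facts come from k \<ge> 2: the first bound on k gives \<rho> n^2 \<ge> 2 k^2
  \<ge> 8, and the second gives \<rho> n \<ge> 2 ln 2.\<close>

lemma adm_n: "k \<le> n" "3 \<le> n" "1 \<le> \<rho> * real n" "8 \<le> \<rho> * (real n)\<^sup>2"
proof -
  have k4: "4 \<le> (real k)\<^sup>2" using adm_k(1) power_mono[of 2 "real k" 2] by simp
  then show r8: "8 \<le> \<rho> * (real n)\<^sup>2" using adm_k(2) by linarith
  have "\<rho> * (real n)\<^sup>2 \<le> 1 * (real n)\<^sup>2" using adm_\<rho> by (intro mult_right_mono) auto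
  then have n2: "\<rho> * (real n)\<^sup>2 \<le> (real n)\<^sup>2" by simp
  then have "(real k)\<^sup>2 \<le> (real n)\<^sup>2" using adm_k(2) zero_le_power2[of "real n"] by linarith
  then have "real k \<le> real n" by (rule power2_le_imp_le) simp
  then show "k \<le> n" by simp
  show "3 \<le> n"
  proof (rule ccontr)
    assume "\<not> 3 \<le> n"
    then have "(real n)\<^sup>2 \<le> 2\<^sup>2" by (intro power_mono) auto
    with r8 n2 show False by simp
  qed
  have "ln 2 \<le> ln (real k)" using adm_k(1) by (subst ln_le_cancel_iff) auto
  then show "1 \<le> \<rho> * real n" using ln2_ge_two_thirds adm_k(3) by linarith
qed

text \<open>Multiplied by \<rho> n^2 this is n ln k + k^2, which bounds the logarithm of the number
  of pairs of a map to [k] and a 0/1 block matrix.\<close>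

definition noise :: real where
  "noise = ln (real k) / (\<rho> * real n) + (real k)\<^sup>2 / (\<rho> * (real n)\<^sup>2)"

lemma rate_eq: "rate n k \<rho> lam = lam\<^sup>2 * noise" by (simp add: rate_def noise_def)

text \<open>The upper bounds on k in \<open>admissible\<close> make each of the two summands at most
  1/2. Hence noise \<le> 1, and sqrt(noise) can serve as Chernoff parameter.\<close>

lemma noise_bounds:
  "1 / (2 * \<rho> * real n) \<le> noise" "1 / (2 * real n) \<le> noise"
  "(real k)\<^sup>2 / (\<rho> * (real n)\<^sup>2) \<le> noise" "noise \<le> 1" "0 < noise"
proof -
  have n: "0 < real n" using adm_n by simp
  have lnk: "2 / 3 \<le> ln (real k)"
    using ln2_ge_two_thirds adm_k(1) by (intro order_trans[OF ln2_ge_two_thirds]) simp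
  have "(1 / 2) / (\<rho> * real n) \<le> ln (real k) / (\<rho> * real n)"
    using lnk n adm_\<rho> by (intro divide_right_mono) auto
  moreover have kn: "0 \<le> (real k)\<^sup>2 / (\<rho> * (real n)\<^sup>2)" using adm_\<rho> by simp
  ultimately show 1: "1 / (2 * \<rho> * real n) \<le> noise" by (simp add: noise_def)
  have "\<rho> * (2 * real n) \<le> 1 * (2 * real n)" using adm_\<rho> by (intro mult_right_mono) auto
  then have "1 / (2 * real n) \<le> 1 / (2 * \<rho> * real n)" using n adm_\<rho> by (intro divide_left_mono) (auto simp: mult_ac)
  with 1 show "1 / (2 * real n) \<le> noise" by linarith
  show "(real k)\<^sup>2 / (\<rho> * (real n)\<^sup>2) \<le> noise"
    using lnk n adm_\<rho> by (simp add: noise_def)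
  have "0 < 1 / (2 * \<rho> * real n)" using n adm_\<rho> by simp
  with 1 show "0 < noise" by linarith
  have "ln (real k) / (\<rho> * real n) \<le> 1 / 2" using adm_k(3) n adm_\<rho> by (simp add: field_simps)
  moreover have "(real k)\<^sup>2 / (\<rho> * (real n)\<^sup>2) \<le> 1 / 2" using adm_k(2) n adm_\<rho> by (simp add: field_simps)
  ultimately show "noise \<le> 1" unfolding noise_def by linarith
qed

definition R :: real where "R = root 4 (rate n k \<rho> lam)"

lemma R_power4: "R ^ 4 = lam\<^sup>2 * noise" and R_pos: "0 < R"
proof -
  have "0 < lam\<^sup>2 * noise" using noise_bounds(5) adm_lam(1) by simp
  then show "R ^ 4 = lam\<^sup>2 * noise" "0 < R" unfolding R_def rate_eq by simp_all
qed

lemma le_R: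
  assumes "a ^ 4 \<le> lam\<^sup>2 * noise"
  shows "a \<le> R"
  using assms R_pos unfolding R_power4[symmetric] by (simp add: power_le_imp_le_base[of a 3 R] eval_nat_numeral)

lemma R_square: "R\<^sup>2 = lam * sqrt noise"
proof -
  have "(R\<^sup>2)\<^sup>2 = (lam * sqrt noise)\<^sup>2"
    using R_power4 noise_bounds(5) by (simp add: power_mult_distrib)
  then show ?thesis using adm_lam(1) noise_bounds(5) by (subst (asm) power2_eq_iff_nonneg) auto
qed

text \<open>One factor lam^2 of the fourth power is part of the rate; the other is at most n, which
  leaves a multiple of 1/n, and that is below the noise. This pays for the diagonal, for the
  fluctuation of the edge sum and for small n.\<close>

lemma lam_over_sqrt_n: "lam / sqrt (real n) \<le> 2 * R"
proof -
  have n: "0 < real n" using adm_n by simp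
  have "(lam / (2 * sqrt (real n))) ^ 4 = lam\<^sup>2 * (lam\<^sup>2 / (16 * (real n)\<^sup>2))"
  proof -
    have "(sqrt (real n)) ^ 4 = ((sqrt (real n))\<^sup>2)\<^sup>2" by (rule power4_eq_square_square)
    then show ?thesis by (simp add: power_divide power_mult_distrib)
  qed
  also have "\<dots> \<le> lam\<^sup>2 * noise"
  proof (rule mult_left_mono)
    have "lam\<^sup>2 / (16 * (real n)\<^sup>2) \<le> real n / (16 * (real n)\<^sup>2)" using adm_lam(3) by (intro divide_right_mono) auto
    also have "\<dots> = 1 / (16 * real n)" using n by (simp add: power2_eq_square)
    also have "\<dots> \<le> 1 / (2 * real n)" using n by (simp add: field_simps)
    also have "\<dots> \<le> noise" by (rule noise_bounds(2))
    finally show "lam\<^sup>2 / (16 * (real n)\<^sup>2) \<le> noise" .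
  qed simp
  finally have "lam / (2 * sqrt (real n)) \<le> R" by (rule le_R)
  then show ?thesis using n by (simp add: field_simps)
qed

text \<open>The second factor is the relative fluctuation of the number of edges given the sample;
  the first is the order of the norm it multiplies. Its square is at most noise \<le> 1, hence so is
  its fourth power.\<close>

lemma sqrt_lam_over_sqrt_\<rho>_n: "sqrt lam * (1 / (sqrt \<rho> * real n)) \<le> R"
proof (rule le_R)
  let ?a = "1 / (sqrt \<rho> * real n)"
  have a2: "?a\<^sup>2 = 1 / (\<rho> * (real n)\<^sup>2)" using adm_\<rho> by (simp add: power_divide power_mult_distrib)
  have "1 / (\<rho> * (real n)\<^sup>2) \<le> (real k)\<^sup>2 / (\<rho> * (real n)\<^sup>2)"
    using adm_k(1) adm_\<rho> by (intro divide_right_mono) auto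
  then have le: "?a\<^sup>2 \<le> noise" unfolding a2 using noise_bounds(3) by linarith
  have "?a\<^sup>2 \<le> 1" using le noise_bounds(4) by linarith
  then have "?a\<^sup>2 * ?a\<^sup>2 \<le> 1 * ?a\<^sup>2" by (intro mult_right_mono) auto
  then have "?a\<^sup>2 * ?a\<^sup>2 \<le> noise" using le by linarith
  moreover have "(sqrt lam * ?a) ^ 4 = lam\<^sup>2 * (?a\<^sup>2 * ?a\<^sup>2)"
  proof -
    have "(sqrt lam * ?a) ^ 4 = ((sqrt lam)\<^sup>2 * ?a\<^sup>2)\<^sup>2" by (simp only: power4_eq_square_square power_mult_distrib)
    also have "\<dots> = (lam * ?a\<^sup>2)\<^sup>2" using adm_lam(1) by simp
    finally show ?thesis by (simp add: power2_eq_square)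
  qed
  ultimately show "(sqrt lam * ?a) ^ 4 \<le> lam\<^sup>2 * noise" by (simp add: mult_left_mono)
qed

text \<open>This is the squared cost of aligning n-step and k-step kernels for a matrix of norm of
  order sqrt lam. With norm lam it would not fit under R^2.\<close>

lemma k_lam_over_n: "real k * lam / real n \<le> R\<^sup>2"
proof (rule power2_le_imp_le)
  have n: "0 < real n" using adm_n by simp
  have "(real k * lam / real n)\<^sup>2 = lam\<^sup>2 * ((real k)\<^sup>2 / (real n)\<^sup>2)" by (simp add: power_divide power_mult_distrib)
  also have "\<dots> \<le> lam\<^sup>2 * noise"
  proof (rule mult_left_mono)
    have "\<rho> * (real n)\<^sup>2 \<le> 1 * (real n)\<^sup>2" using adm_\<rho> by (intro mult_right_mono) auto
    then have "(real k)\<^sup>2 / (real n)\<^sup>2 \<le> (real k)\<^sup>2 / (\<rho> * (real n)\<^sup>2)" using n adm_\<rho> by (intro divide_left_mono) auto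
    then show "(real k)\<^sup>2 / (real n)\<^sup>2 \<le> noise" using noise_bounds(3) by linarith
  qed simp
  also have "\<dots> = (R\<^sup>2)\<^sup>2" using R_power4 by (simp add: power_mult[symmetric])
  finally show "(real k * lam / real n)\<^sup>2 \<le> (R\<^sup>2)\<^sup>2" .
qed simp

text \<open>Rounding entries to multiples of 1/n costs 1/n before and 1/(\<rho> n) after dividing by
  \<rho>.\<close>

lemma inverse_\<rho>_n: "1 / (\<rho> * real n) \<le> 2 * R"
proof -
  have \<rho>n: "0 < \<rho> * real n" using adm_n(3) by linarith
  let ?a = "1 / (2 * \<rho> * real n)"
  have a: "0 \<le> ?a" "?a \<le> 1" using adm_n(3) \<rho>n by (auto simp: mult.assoc)
  have "?a ^ 4 \<le> ?a ^ 1" by (rule power_decreasing) (use a in auto)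
  also have "?a ^ 1 \<le> noise" using noise_bounds(1) by simp
  also have "1 * noise \<le> lam\<^sup>2 * noise" using adm_lam(1) noise_bounds(5) by (intro mult_right_mono) auto
  finally have "?a \<le> R" by (intro le_R) simp
  then show ?thesis using \<rho>n by (simp add: field_simps)
qed

lemma R_le: "R \<le> sqrt lam"
proof -
  have "R ^ 4 \<le> lam\<^sup>2 * 1" unfolding R_power4 using noise_bounds(4) by (intro mult_left_mono) auto
  also have "\<dots> = (sqrt lam) ^ 4"
  proof -
    have "(sqrt lam) ^ 4 = ((sqrt lam)\<^sup>2)\<^sup>2" by (rule power4_eq_square_square)
    then show ?thesis using adm_lam(1) by simp
  qed
  finally show ?thesis
    using adm_lam(1) by (simp add: power_le_imp_le_base[of R 3 "sqrt lam"] eval_nat_numeral)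
qed

lemma sqrt_\<Lambda>_le: "sqrt \<Lambda> \<le> sqrt lam" using adm_\<Lambda> adm_lam by simp

lemma estimated_kernel_bounds:
  assumes B: "B \<in> least_squares n k (lam * edge_density n G) G"
  shows "0 \<le> estimated_kernel n k G B u v" "estimated_kernel n k G B u v \<le> lam"
    "bounded_kernel (estimated_kernel n k G B)"
proof -
  have k: "0 < k" using adm_k(1) by simp
  have "B \<in> grid_matrices n k (lam * edge_density n G)" using B by (simp add: least_squares_def is_arg_min_def)
  then have b: "0 \<le> step_kernel k B u v" "step_kernel k B u v \<le> lam * edge_density n G"
    using cell_less[OF k] by (auto simp: grid_matrices_def step_kernel_def)
  have d: "0 \<le> edge_density n G" by (simp add: edge_density_def)
  show "0 \<le> estimated_kernel n k G B u v" using b d by (simp add: estimated_kernel_def)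
  show "estimated_kernel n k G B u v \<le> lam"
    using b d adm_lam(1) by (cases "edge_density n G = 0") (auto simp: estimated_kernel_def field_simps)
  show "bounded_kernel (estimated_kernel n k G B)"
    unfolding estimated_kernel_def[abs_def] by (rule bounded_kernel_scale[OF bounded_kernel_step[OF k]])
qed

lemma delta2_le_lam:
  assumes B: "B \<in> least_squares n k (lam * edge_density n G) G"
  shows "delta2 W (estimated_kernel n k G B) \<le> lam"
proof -
  have "delta2 W (estimated_kernel n k G B) \<le> kernel_dist W (estimated_kernel n k G B)"
    by (rule delta2_le[OF id_measure_preserving])
  also have "\<dots> \<le> lam"
  proof (rule kernel_norm2_le_const[OF bounded_kernel_diff[OF graphon_bounded_kernel[OF adm_graphon(1)] estimated_kernel_bounds(3)[OF B]]])
    fix x y :: real assume xy: "x \<in> {0..1}" "y \<in> {0..1}"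
    have "0 \<le> W x y" "W x y \<le> \<Lambda>" using graphon_pointwise(1)[OF adm_graphon(1) xy] adm_graphon(3) xy by auto
    then show "\<bar>W x y - estimated_kernel n k G B x y\<bar> \<le> lam"
      using estimated_kernel_bounds(1,2)[OF B, of x y] adm_lam(2) adm_\<Lambda> by linarith
  qed
  finally show ?thesis .
qed

lemma least_squares_bound_small_n:
  assumes B: "B \<in> least_squares n k (lam * edge_density n G) G" and n: "real n \<le> c\<^sup>2" "0 \<le> c"
  shows "delta2 W (estimated_kernel n k G B) \<le> 2 * c * R"
proof -
  have "sqrt (real n) \<le> c" using n by (simp add: real_le_lsqrt)
  moreover have "lam \<le> sqrt (real n) * (2 * R)" using lam_over_sqrt_n adm_n(2) by (simp add: field_simps)
  ultimately have "lam \<le> c * (2 * R)" using R_pos by (smt (verit) mult_right_mono)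
  then show ?thesis using delta2_le_lam[OF B] by simp
qed

end

section \<open>The deterministic bound on the good event\<close>

context least_squares_model
begin

lemma n_choose_2_bounds: "(real n)\<^sup>2 / 3 \<le> real (n choose 2)" "real (n choose 2) \<le> (real n)\<^sup>2 / 2"
proof -
  have "even (n * (n - 1))" by (cases "even n") auto
  then have "real (n choose 2) = real (n * (n - 1)) / 2" by (simp add: choose_two real_of_nat_div)
  also have "\<dots> = (real n)\<^sup>2 / 2 - real n / 2" using adm_n(2) by (simp add: of_nat_diff power2_eq_square algebra_simps diff_divide_distrib)
  finally have eq: "real (n choose 2) = (real n)\<^sup>2 / 2 - real n / 2" .
  have "3 * real n \<le> (real n)\<^sup>2" using adm_n(2) by (simp add: power2_eq_square)
  then show "(real n)\<^sup>2 / 3 \<le> real (n choose 2)" unfolding eq by linarith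
  show "real (n choose 2) \<le> (real n)\<^sup>2 / 2" unfolding eq by simp
qed

lemma \<Lambda>_le_n: "\<Lambda> \<le> real n" "\<Lambda> \<le> sqrt (real n)"
proof -
  have "lam \<le> sqrt (real n)" using adm_lam by (intro real_le_rsqrt) auto
  then show 1: "\<Lambda> \<le> sqrt (real n)" using adm_lam(2) adm_\<Lambda> by linarith
  have "real n \<le> (real n)\<^sup>2" using adm_n(2) by (simp add: power2_eq_square)
  then have "sqrt (real n) \<le> real n" by (intro real_le_lsqrt) auto
  with 1 show "\<Lambda> \<le> real n" by linarith
qed

lemma edge_sum_le:
  assumes "\<bar>S - real (n choose 2)\<bar> \<le> K * (real n * sqrt (real n * \<Lambda>))" "1 \<le> K"
  shows "S \<le> (1 / 2 + K) * (real n)\<^sup>2"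
proof -
  have "sqrt (real n * \<Lambda>) \<le> sqrt (real n * real n)"
    using \<Lambda>_le_n by (intro real_sqrt_le_mono mult_left_mono) auto
  then have "K * (real n * sqrt (real n * \<Lambda>)) \<le> K * (real n * real n)"
    using assms(2) by (intro mult_left_mono) auto
  then show ?thesis using assms(1) n_choose_2_bounds(2) by (simp add: power2_eq_square algebra_simps)
qed

context
  fixes x :: "nat \<Rightarrow> real" and G :: "(nat \<times> nat) set" and K :: real
  assumes x: "x \<in> space (sample_space n)" and G: "G \<subseteq> vertex_pairs n" and K: "1 \<le> K"
    and vertex_sum: "\<bar>edge_sum n W x - real (n choose 2)\<bar> \<le> K * (real n * sqrt (real n * \<Lambda>))"
    and edge_count: "\<bar>edge_deviation n (\<lambda>(i, j). \<rho> * sampled_matrix W x i j) (\<lambda>_. 1) G\<bar> \<le> K * (sqrt \<rho> * real n)"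
    and blocks: "\<And>\<pi> S. \<pi> \<in> {..<n} \<rightarrow>\<^sub>E {..<k} \<Longrightarrow> S \<subseteq> {..<k} \<times> {..<k} \<Longrightarrow>
      \<bar>edge_deviation n (\<lambda>(i, j). \<rho> * sampled_matrix W x i j) (block_indicator \<pi> S) G\<bar> \<le> K * (\<rho> * (real n)\<^sup>2 * sqrt noise)"
    and large: "12 * K \<le> sqrt (sqrt (real n))"
begin

abbreviation (input) H where "H \<equiv> sampled_matrix W x"
text \<open>The estimate is divided by the observed density but the target \<rho> H by \<rho>;
  \<open>r\<close> measures the discrepancy between the two normalisations.\<close>

abbreviation (input) r where "r \<equiv> edge_density n G / \<rho>"

lemma H_bounds:
  assumes "u < n" "v < n"
  shows "0 \<le> H u v" "H u v \<le> \<Lambda>" "H u v = H v u"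
  using graphon_pointwise[OF adm_graphon(1) sample_in_unit[OF x assms(1)] sample_in_unit[OF x assms(2)]] adm_graphon(3)
    sample_in_unit[OF x assms(1)] sample_in_unit[OF x assms(2)] by (auto simp: sampled_matrix_def)

text \<open>The error splits into the fluctuation of the edges given the sample and that of the
  conditional mean. The factor 3 comes from n choose 2 \<ge> n^2/3.\<close>

lemma r_close: "\<bar>r - 1\<bar> \<le> 3 * K * (1 / (sqrt \<rho> * real n) + sqrt \<Lambda> / sqrt (real n))"
proof -
  let ?N = "real (n choose 2)" and ?S = "edge_sum n W x"
    and ?D = "edge_deviation n (\<lambda>(i, j). \<rho> * H i j) (\<lambda>_. 1) G"
  have n: "0 < real n" using adm_n(2) by simp
  then have N: "0 < ?N" "(real n)\<^sup>2 / 3 \<le> ?N" using adm_n(2) n_choose_2_bounds(1) by auto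
  have "(\<Sum>e\<in>vertex_pairs n. of_bool (e \<in> G)) = (\<Sum>e\<in>G. (1::real))"
    by (rule sum.mono_neutral_cong_right) (use G in auto)
  then have D: "?D = real (card G) - \<rho> * ?S"
    by (simp add: edge_deviation_def sum_subtractf sum_distrib_left sampled_matrix_def case_prod_beta')
  have "r - 1 = ?D / (\<rho> * ?N) + (?S - ?N) / ?N"
    unfolding D edge_density_def using N adm_\<rho> by (simp add: field_simps)
  then have "\<bar>r - 1\<bar> \<le> \<bar>?D\<bar> / (\<rho> * ?N) + \<bar>?S - ?N\<bar> / ?N"
    using N adm_\<rho> abs_triangle_ineq[of "?D / (\<rho> * ?N)" "(?S - ?N) / ?N"] by (simp add: abs_mult)
  also have "\<bar>?D\<bar> / (\<rho> * ?N) \<le> (K * (sqrt \<rho> * real n)) / (\<rho> * ((real n)\<^sup>2 / 3))"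
    using edge_count N n adm_\<rho> K by (intro frac_le mult_nonneg_nonneg mult_left_mono) auto
  also have "\<dots> = 3 * K * (1 / (sqrt \<rho> * real n))"
  proof -
    have "K * (s * m) / ((s * s) * (m\<^sup>2 / 3)) = 3 * K * (1 / (s * m))" if "0 < s" "0 < m" for s m :: real
      using that by (simp add: power2_eq_square field_simps)
    from this[of "sqrt \<rho>" "real n"] show ?thesis using adm_\<rho> n by simp
  qed
  also have "\<bar>?S - ?N\<bar> / ?N \<le> (K * (real n * sqrt (real n * \<Lambda>))) / ((real n)\<^sup>2 / 3)"
    using vertex_sum N n K adm_\<Lambda> by (intro frac_le mult_nonneg_nonneg) auto
  also have "\<dots> = 3 * K * (sqrt \<Lambda> / sqrt (real n))"
  proof -
    have "sqrt (real n) / real n = 1 / sqrt (real n)" using n by (simp add: field_simps)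
    then show ?thesis using n by (simp add: real_sqrt_mult power2_eq_square field_simps)
  qed
  finally show ?thesis by (simp add: distrib_left)
qed

text \<open>Both terms of \<open>r_close\<close> are at most n^(-1/4): the first by \<rho> n \<ge>
  1, the second by \<Lambda> \<le> sqrt n. So the error is at most 6 K n^(-1/4), and asking for 1/2
  gives the threshold 12 K in \<open>large\<close>.\<close>

lemma r_bounds: "1 / 2 \<le> r" "r \<le> 3 / 2"
proof -
  let ?w = "sqrt (sqrt (real n))"
  have n: "0 < real n" using adm_n(2) by simp
  have w: "1 \<le> ?w" "0 < ?w" using large K by linarith+
  have sw: "sqrt (real n) = ?w * ?w" by simp
  have "sqrt \<Lambda> \<le> ?w" using \<Lambda>_le_n(2) by simp
  then have "sqrt \<Lambda> / sqrt (real n) \<le> ?w / (?w * ?w)" unfolding sw[symmetric] by (intro divide_right_mono) auto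
  moreover have "w / (w * w) = 1 / w" if "0 < w" for w :: real using that by simp
  from this[OF w(2)] have "?w / (?w * ?w) = 1 / ?w" .
  ultimately have 1: "sqrt \<Lambda> / sqrt (real n) \<le> 1 / ?w" by linarith
  have "real n \<le> \<rho> * real n * real n" using adm_n(3) n by simp
  then have "sqrt (real n) \<le> sqrt (\<rho> * real n * real n)" by (rule real_sqrt_le_mono)
  also have "\<dots> = sqrt \<rho> * real n" by (simp add: real_sqrt_mult)
  finally have "?w * ?w \<le> sqrt \<rho> * real n" by simp
  then have "1 / (sqrt \<rho> * real n) \<le> 1 / (?w * ?w)" using w by (intro divide_left_mono) (auto simp: adm_\<rho>)
  also have "\<dots> \<le> 1 / (1 * ?w)" using w by (intro divide_left_mono mult_right_mono) auto
  finally have 2: "1 / (sqrt \<rho> * real n) \<le> 1 / ?w" by simp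
  have "\<bar>r - 1\<bar> \<le> 3 * K * (1 / ?w + 1 / ?w)"
    using r_close by (rule order_trans) (use 1 2 K in \<open>intro mult_left_mono add_mono; simp\<close>)
  also have "\<dots> = 6 * K / ?w" by simp
  also have "\<dots> \<le> 1 / 2" using large w by (simp add: field_simps)
  finally have "\<bar>r - 1\<bar> \<le> 1 / 2" .
  then show "1 / 2 \<le> r" "r \<le> 3 / 2" by linarith+
qed

lemma sqrt_lam_r: "sqrt lam * \<bar>r - 1\<bar> \<le> 9 * K * R"
proof -
  have "sqrt lam * \<bar>r - 1\<bar> \<le> sqrt lam * (3 * K * (1 / (sqrt \<rho> * real n) + sqrt \<Lambda> / sqrt (real n)))"
    using adm_lam(1) by (intro mult_left_mono r_close) auto
  also have "\<dots> = 3 * K * (sqrt lam * (1 / (sqrt \<rho> * real n)) + sqrt lam * sqrt \<Lambda> / sqrt (real n))"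
    by (simp add: algebra_simps)
  also have "\<dots> \<le> 3 * K * (R + 2 * R)"
  proof (intro mult_left_mono add_mono sqrt_lam_over_sqrt_\<rho>_n)
    have "sqrt lam * sqrt \<Lambda> \<le> sqrt lam * sqrt lam" using sqrt_\<Lambda>_le adm_lam(1) by (intro mult_left_mono) auto
    then have "sqrt lam * sqrt \<Lambda> \<le> lam" using adm_lam(1) by simp
    then have "sqrt lam * sqrt \<Lambda> / sqrt (real n) \<le> lam / sqrt (real n)" by (rule divide_right_mono) simp
    then show "sqrt lam * sqrt \<Lambda> / sqrt (real n) \<le> 2 * R" using lam_over_sqrt_n by linarith
  qed (use K in simp)
  finally show ?thesis by simp
qed

lemma density_bounds: "0 < edge_density n G" "\<rho> / 2 \<le> edge_density n G" "edge_density n G \<le> 2 * \<rho>"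
  using r_bounds adm_\<rho> by (auto simp: field_simps)

text \<open>\<open>block_sum_le\<close> with \<mu> \<le> 2 lam \<rho> gives 4 K (\<rho> n)^2 lam
  sqrt(noise), where lam sqrt(noise) is R^2. The diagonal adds \<rho>^2 n * 2 \<Lambda> lam, and 2
  \<Lambda> lam \<le> lam^2 \<le> 4 n R^2.\<close>

lemma inner_bound:
  assumes B: "\<And>i j. i < k \<Longrightarrow> j < k \<Longrightarrow> 0 \<le> B i j \<and> B i j \<le> lam * edge_density n G" and \<pi>: "\<pi> \<in> equipartitions n k"
  shows "\<bar>\<Sum>u<n. \<Sum>v<n. (adjacency G u v - \<rho> * H u v) * B (\<pi> u) (\<pi> v)\<bar> \<le> (4 * K + 4) * (\<rho> * real n)\<^sup>2 * R\<^sup>2"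
proof -
  let ?\<mu> = "lam * edge_density n G"
  let ?d = "\<lambda>e. of_bool (e \<in> G) - (case e of (i, j) \<Rightarrow> \<rho> * H i j)"
  have \<pi>': "\<pi> \<in> {..<n} \<rightarrow>\<^sub>E {..<k}" using \<pi> by (simp add: equipartitions_def)
  then have img: "\<pi> ` {..<n} \<subseteq> {..<k}" by auto
  have \<mu>: "0 \<le> ?\<mu>" "?\<mu> \<le> 2 * lam * \<rho>" using density_bounds adm_lam(1) by (auto simp: mult_left_mono)
  have n: "0 < real n" using adm_n(2) by simp
  have "\<bar>\<Sum>(u, v)\<in>vertex_pairs n. ?d (u, v) * (B (\<pi> u) (\<pi> v) + B (\<pi> v) (\<pi> u))\<bar> \<le> 2 * ?\<mu> * (K * (\<rho> * (real n)\<^sup>2 * sqrt noise))"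
    by (rule block_sum_le[OF B img \<mu>(1)]) (use blocks[OF \<pi>'] in \<open>simp_all add: edge_deviation_def\<close>)
  moreover have "\<bar>\<Sum>u<n. \<Sum>v<n. (adjacency G u v - \<rho> * H u v) * B (\<pi> u) (\<pi> v)\<bar>
    \<le> \<bar>\<Sum>(u, v)\<in>vertex_pairs n. (of_bool ((u, v) \<in> G) - \<rho> * H u v) * (B (\<pi> u) (\<pi> v) + B (\<pi> v) (\<pi> u))\<bar> + real n * (\<rho> * \<Lambda> * ?\<mu>)"
    by (rule adjacency_sum[OF G]) (use H_bounds adm_\<rho> B img in \<open>auto simp: mult_left_mono\<close>)
  ultimately have "\<bar>\<Sum>u<n. \<Sum>v<n. (adjacency G u v - \<rho> * H u v) * B (\<pi> u) (\<pi> v)\<bar>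
    \<le> 2 * ?\<mu> * (K * (\<rho> * (real n)\<^sup>2 * sqrt noise)) + real n * (\<rho> * \<Lambda> * ?\<mu>)" by simp
  also have "\<dots> \<le> 2 * (2 * lam * \<rho>) * (K * (\<rho> * (real n)\<^sup>2 * sqrt noise)) + real n * (\<rho> * \<Lambda> * (2 * lam * \<rho>))"
    using \<mu> K adm_\<rho> adm_\<Lambda> noise_bounds(5) by (intro add_mono mult_right_mono mult_left_mono mult_nonneg_nonneg) auto
  also have "\<dots> = 4 * K * (\<rho> * real n)\<^sup>2 * R\<^sup>2 + \<rho>\<^sup>2 * real n * (2 * \<Lambda> * lam)"
    unfolding R_square by (simp add: power2_eq_square algebra_simps)
  also have "\<rho>\<^sup>2 * real n * (2 * \<Lambda> * lam) \<le> \<rho>\<^sup>2 * real n * (4 * real n * R\<^sup>2)"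
  proof (rule mult_left_mono)
    have "2 * \<Lambda> * lam \<le> lam * lam" using adm_lam by (intro mult_right_mono) auto
    also have "lam * lam = real n * (lam / sqrt (real n))\<^sup>2" using n by (simp add: power_divide power2_eq_square)
    also have "\<dots> \<le> real n * (2 * R)\<^sup>2" using lam_over_sqrt_n adm_lam(1) by (intro mult_left_mono power_mono) auto
    finally show "2 * \<Lambda> * lam \<le> 4 * real n * R\<^sup>2" by (simp add: power_mult_distrib)
  qed simp
  finally show ?thesis by (simp add: power2_eq_square algebra_simps)
qed

text \<open>As for \<open>W\<close> itself, H^2 \<le> \<Lambda> H reduces the square sum to the sum
  of the entries, which concentration of the edge sum bounds by a multiple of n^2.\<close>

lemma norm_H: "matrix_norm2 n H \<le> (1 + K) * sqrt lam"
proof -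
  let ?S = "edge_sum n W x"
  have n: "0 < real n" using adm_n(2) by simp
  have "(\<Sum>u<n. \<Sum>v<n. (H u v)\<^sup>2) \<le> (\<Sum>u<n. \<Sum>v<n. \<Lambda> * H u v)"
    using H_bounds by (intro sum_mono) (auto simp: power2_eq_square mult_right_mono)
  also have "\<dots> = \<Lambda> * (\<Sum>u<n. \<Sum>v<n. H u v)" by (simp add: sum_distrib_left)
  also have "(\<Sum>u<n. \<Sum>v<n. H u v) = (\<Sum>(i, j)\<in>vertex_pairs n. H i j + H j i) + (\<Sum>u<n. H u u)" by (rule sum_sum_vertex_pairs)
  also have "(\<Sum>(i, j)\<in>vertex_pairs n. H i j + H j i) = (\<Sum>(i, j)\<in>vertex_pairs n. 2 * W (x i) (x j))"
  proof (rule sum.cong[OF refl], clarify)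
    fix i j assume "(i, j) \<in> vertex_pairs n"
    then have "H j i = H i j" by (intro H_bounds) (auto simp: vertex_pairs_def)
    then show "H i j + H j i = 2 * W (x i) (x j)" by (simp add: sampled_matrix_def)
  qed
  also have "\<dots> = 2 * ?S" by (simp add: sum_distrib_left case_prod_beta')
  also have "\<Lambda> * (2 * ?S + (\<Sum>u<n. H u u)) \<le> \<Lambda> * (2 * ((1 / 2 + K) * (real n)\<^sup>2) + (real n)\<^sup>2)"
  proof (intro mult_left_mono add_mono)
    show "?S \<le> (1 / 2 + K) * (real n)\<^sup>2" by (rule edge_sum_le[OF vertex_sum K])
    have "(\<Sum>u<n. H u u) \<le> (\<Sum>u<n. real n)" by (intro sum_mono order_trans[OF H_bounds(2) \<Lambda>_le_n(1)]) auto
    then show "(\<Sum>u<n. H u u) \<le> (real n)\<^sup>2" by (simp add: power2_eq_square)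
  qed (use adm_\<Lambda> in auto)
  also have "\<dots> = 2 * \<Lambda> * (1 + K) * (real n)\<^sup>2" by (simp add: algebra_simps)
  finally have "(matrix_norm2 n H)\<^sup>2 \<le> 2 * \<Lambda> * (1 + K)" unfolding matrix_norm2_square using n by (simp add: field_simps)
  also have "\<dots> \<le> lam * (1 + K)" using adm_lam K by (intro mult_right_mono) auto
  also have "\<dots> \<le> lam * ((1 + K) * (1 + K))" using adm_lam K by (intro mult_left_mono) (auto simp: algebra_simps)
  also have "\<dots> = ((1 + K) * sqrt lam)\<^sup>2" using adm_lam(1) by (simp add: power_mult_distrib power2_eq_square)
  finally show ?thesis by (rule power2_le_imp_le) (use K adm_lam in simp)
qed

lemma block_matrix_blowup:
  assumes p: "p ` {..<n} \<subseteq> {..<k}" "\<And>i. i < k \<Longrightarrow> \<bar>real (card {v\<in>{..<n}. p v = i}) - real n / real k\<bar> < 1"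
    "\<And>i. i < k \<Longrightarrow> card {v\<in>{..<n}. p v = i \<and> v * k div n \<noteq> i} \<le> 1"
    "\<And>i. i < k \<Longrightarrow> card {v\<in>{..<n}. v * k div n = i \<and> p v \<noteq> i} \<le> 1"
    and B: "matrix_norm2 k B \<le> c * sqrt lam"
  shows "kernel_norm2 (\<lambda>u v. step_kernel n (\<lambda>u v. B (p u) (p v)) u v - step_kernel k B u v) \<le> 6 * c * R"
proof (rule power2_le_imp_le)
  have k: "0 < k" using adm_k(1) by simp
  have n: "0 < real n" using adm_n(2) by simp
  have c: "0 \<le> c" using order_trans[OF matrix_norm2_nonneg B] adm_lam(1) by (simp add: zero_le_mult_iff)
  have "(kernel_norm2 (\<lambda>u v. step_kernel n (\<lambda>u v. B (p u) (p v)) u v - step_kernel k B u v))\<^sup>2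
    \<le> 32 * (real k / real n) * (matrix_norm2 k B)\<^sup>2"
    by (rule kernel_norm2_equipartition_step_diff[OF adm_n(1) k p])
  also have "\<dots> \<le> 32 * (real k / real n) * (c * sqrt lam)\<^sup>2"
    using B n by (intro mult_left_mono power_mono) auto
  also have "\<dots> = 32 * c\<^sup>2 * (real k * lam / real n)" using adm_lam(1) by (simp add: power_mult_distrib)
  also have "\<dots> \<le> 32 * c\<^sup>2 * R\<^sup>2" by (intro mult_left_mono k_lam_over_n) simp
  \<comment> \<open>The constant 32 is rounded up to a square.\<close>
  also have "\<dots> \<le> 36 * c\<^sup>2 * R\<^sup>2" by (intro mult_right_mono) auto
  also have "\<dots> = (6 * c * R)\<^sup>2" by (simp add: power_mult_distrib)
  finally show "(kernel_norm2 (\<lambda>u v. step_kernel n (\<lambda>u v. B (p u) (p v)) u v - step_kernel k B u v))\<^sup>2 \<le> (6 * c * R)\<^sup>2" .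
  show "0 \<le> 6 * c * R" using c R_pos by simp
qed

lemma floor_div_less: "v < n \<Longrightarrow> v * k div n < k"
proof -
  assume "v < n"
  then have "v * k < n * k" using adm_k(1) by simp
  then show "v * k div n < k" using adm_n(2) by (simp add: div_less_iff_less_mult mult.commute)
qed

text \<open>The partition assigns to a vertex the floor class of its position in the optimal
  ordering \<open>\<sigma>\<close>, so that after sorting it matches the k intervals. The 21 R
  consist of 2 R for rounding, R for the near minimiser and 6 * 3 R for passing from the n-step to
  the k-step kernel.\<close>

lemma competitor:
  obtains B \<pi> where "B \<in> grid_matrices n k (lam * edge_density n G)" "\<pi> \<in> equipartitions n k"
    "matrix_norm2 n (\<lambda>u v. B (\<pi> u) (\<pi> v) - \<rho> * H u v) \<le> \<rho> * (eps_oracle k W + eps_sample n W x + 21 * R)"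
proof -
  have k: "0 < k" using adm_k(1) by simp
  have n: "0 < n" using adm_n(2) by simp
  have rn: "0 < real n" using n by simp
  note bW = graphon_bounded_kernel[OF adm_graphon(1)]
  obtain B0 where B0: "\<And>i j. 0 \<le> B0 i j \<and> B0 i j \<le> \<Lambda>"
    and near: "kernel_dist W (step_kernel k B0) \<le> eps_oracle k W + R"
    by (rule eps_oracle_near_minimizer[OF adm_graphon(1,3) k R_pos]) (rule that)
  obtain \<sigma> where \<sigma>: "\<sigma> permutes {..<n}"
    and es: "eps_sample n W x = kernel_dist (step_kernel n (\<lambda>i j. H (\<sigma> i) (\<sigma> j))) W"
    by (rule eps_sample_attained)
  note \<sigma>' = permutes_inv[OF \<sigma>]
  define p where "p = (\<lambda>v. v * k div n)"
  define \<pi> where "\<pi> = (\<lambda>v\<in>{..<n}. inv \<sigma> v * k div n)"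
  \<comment> \<open>Rounding down keeps the entries at most \<rho> \<Lambda> \<le> lam \<rho>/2,
    hence at most lam times the edge density.\<close>
  define B where "B = (\<lambda>i j. of_int \<lfloor>real n * (\<rho> * B0 i j)\<rfloor> / real n)"
  have \<pi>: "\<pi> \<in> equipartitions n k" unfolding \<pi>_def by (rule floor_equipartition[OF adm_n(1) k \<sigma>'])
  have B_close: "\<bar>B i j - \<rho> * B0 i j\<bar> \<le> 1 / real n" for i j
  proof -
    have "B i j - \<rho> * B0 i j = (of_int \<lfloor>real n * (\<rho> * B0 i j)\<rfloor> - real n * (\<rho> * B0 i j)) / real n"
      using rn by (simp add: B_def diff_divide_distrib)
    also have "\<bar>\<dots>\<bar> = \<bar>of_int \<lfloor>real n * (\<rho> * B0 i j)\<rfloor> - real n * (\<rho> * B0 i j)\<bar> / real n" by simp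
    also have "\<dots> \<le> 1 / real n"
      by (rule divide_right_mono) (use floor_correct[of "real n * (\<rho> * B0 i j)"] in linarith, simp)
    finally show ?thesis .
  qed
  have "B \<in> grid_matrices n k (lam * edge_density n G)"
  proof -
    have "0 \<le> B i j" "B i j \<le> lam * edge_density n G" "\<exists>m::int. B i j = of_int m / real n" for i j
    proof -
      show "0 \<le> B i j" using B0 adm_\<rho> by (simp add: B_def)
      have "B i j \<le> (real n * (\<rho> * B0 i j)) / real n" unfolding B_def by (intro divide_right_mono) auto
      also have "\<dots> = \<rho> * B0 i j" using rn by simp
      also have "\<dots> \<le> \<rho> * \<Lambda>" using B0 adm_\<rho> by (intro mult_left_mono) auto
      also have "\<dots> \<le> \<rho> * (lam / 2)" using adm_lam adm_\<rho> by (intro mult_left_mono) auto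
      also have "\<dots> = lam * (\<rho> / 2)" by simp
      also have "\<dots> \<le> lam * edge_density n G" using density_bounds(2) adm_lam by (intro mult_left_mono) auto
      finally show "B i j \<le> lam * edge_density n G" .
      show "\<exists>m::int. B i j = of_int m / real n" unfolding B_def by blast
    qed
    then show ?thesis by (simp add: grid_matrices_def)
  qed
  moreover note \<pi>
  moreover have "matrix_norm2 n (\<lambda>u v. B (\<pi> u) (\<pi> v) - \<rho> * H u v) \<le> \<rho> * (eps_oracle k W + eps_sample n W x + 21 * R)"
  proof -
    have "matrix_norm2 n (\<lambda>u v. B (\<pi> u) (\<pi> v) - \<rho> * H u v) = matrix_norm2 n (\<lambda>u v. B (\<pi> (\<sigma> u)) (\<pi> (\<sigma> v)) - \<rho> * H (\<sigma> u) (\<sigma> v))"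
      using matrix_norm2_permute[OF \<sigma>, of "\<lambda>u v. B (\<pi> u) (\<pi> v) - \<rho> * H u v"] by simp
    also have "\<dots> = matrix_norm2 n (\<lambda>u v. B (p u) (p v) - \<rho> * H (\<sigma> u) (\<sigma> v))"
      by (rule matrix_norm2_cong)
        (use permutes_in_image[OF \<sigma>] in \<open>simp add: \<pi>_def p_def permutes_inverses[OF \<sigma>]\<close>)
    also have "\<dots> \<le> matrix_norm2 n (\<lambda>u v. B (p u) (p v) - \<rho> * B0 (p u) (p v))
       + matrix_norm2 n (\<lambda>u v. \<rho> * B0 (p u) (p v) - \<rho> * H (\<sigma> u) (\<sigma> v))"
      by (rule matrix_norm2_triangle[OF n])
    also have "matrix_norm2 n (\<lambda>u v. B (p u) (p v) - \<rho> * B0 (p u) (p v)) \<le> 1 / real n"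
      by (rule matrix_norm2_le_const[OF n B_close])
    also have "1 / real n \<le> \<rho> * (2 * R)"
      using inverse_\<rho>_n rn adm_\<rho> by (simp add: field_simps)
    also have "matrix_norm2 n (\<lambda>u v. \<rho> * B0 (p u) (p v) - \<rho> * H (\<sigma> u) (\<sigma> v)) = \<rho> * matrix_norm2 n (\<lambda>u v. B0 (p u) (p v) - H (\<sigma> u) (\<sigma> v))"
      using matrix_norm2_scale[of n \<rho> "\<lambda>u v. B0 (p u) (p v) - H (\<sigma> u) (\<sigma> v)"] adm_\<rho> by (simp add: right_diff_distrib)
    also have "matrix_norm2 n (\<lambda>u v. B0 (p u) (p v) - H (\<sigma> u) (\<sigma> v)) \<le> eps_oracle k W + eps_sample n W x + 19 * R"
    proof -
      let ?B0p = "\<lambda>u v. B0 (p u) (p v)" and ?H\<sigma> = "\<lambda>u v. H (\<sigma> u) (\<sigma> v)"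
      note bs = bounded_kernel_step[OF n] bounded_kernel_step[OF k]
      have "matrix_norm2 k B0 = kernel_norm2 (step_kernel k B0)" by (rule kernel_norm2_step[OF k, symmetric])
      \<comment> \<open>The norm of \<open>B0\<close> is estimated through its distance to
        \<open>W\<close>, which the zero matrix bounds by the norm of \<open>W\<close> plus R. This
        gives order sqrt lam, which the entrywise bound \<Lambda> would not.\<close>
      also have "step_kernel k B0 = (\<lambda>u v. W u v - (W u v - step_kernel k B0 u v))" by simp
      also have "kernel_norm2 \<dots> \<le> kernel_norm2 W + kernel_dist W (step_kernel k B0)"
        by (rule kernel_norm2_triangle[OF bW bounded_kernel_diff[OF bW bs(2)]])
      also have "kernel_dist W (step_kernel k B0) \<le> kernel_norm2 W + R"
        using near eps_oracle_le[of k W "\<lambda>_ _. 0"] by (simp add: step_kernel_def)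
      also have "kernel_norm2 W \<le> sqrt lam" using kernel_norm2_graphon_le[OF adm_graphon] sqrt_\<Lambda>_le by linarith
      also have "R \<le> sqrt lam" by (rule R_le)
      finally have B0n: "matrix_norm2 k B0 \<le> 3 * sqrt lam" by simp
      \<comment> \<open>After sorting, the partition is the floor partition itself, so nothing is
        misplaced.\<close>
      have z: "{v\<in>{..<n}. p v = i \<and> v * k div n \<noteq> i} = {}" "{v\<in>{..<n}. v * k div n = i \<and> p v \<noteq> i} = {}" for i
        by (auto simp: p_def)
      have "kernel_dist (step_kernel n ?B0p) (step_kernel k B0) \<le> 6 * 3 * R"
        by (rule block_matrix_blowup[OF _ _ _ _ B0n])
           (use floor_div_less card_floor_partition[OF _ n] in \<open>auto simp: z simp flip: p_def\<close>, auto simp: p_def)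
      moreover have "matrix_norm2 n (\<lambda>u v. ?B0p u v - ?H\<sigma> u v) = kernel_dist (step_kernel n ?B0p) (step_kernel n ?H\<sigma>)"
        unfolding kernel_norm2_step[OF n, symmetric] by (simp add: step_kernel_def[abs_def])
      moreover have "kernel_dist (step_kernel n ?B0p) (step_kernel n ?H\<sigma>)
          \<le> kernel_dist (step_kernel n ?B0p) (step_kernel k B0) + kernel_dist (step_kernel k B0) (step_kernel n ?H\<sigma>)"
        by (rule kernel_norm2_dist_triangle[OF bs(1) bs(2) bs(1)])
      moreover have "kernel_dist (step_kernel k B0) (step_kernel n ?H\<sigma>)
          \<le> kernel_dist (step_kernel k B0) W + kernel_dist W (step_kernel n ?H\<sigma>)"
        by (rule kernel_norm2_dist_triangle[OF bs(2) bW bs(1)])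
      moreover have "kernel_dist W (step_kernel n ?H\<sigma>) = eps_sample n W x"
        unfolding es by (rule kernel_norm2_minus_commute)
      moreover have "kernel_dist (step_kernel k B0) W \<le> eps_oracle k W + R"
        using near by (subst kernel_norm2_minus_commute)
      ultimately show ?thesis by linarith
    qed
    finally show ?thesis using adm_\<rho> by (simp add: algebra_simps)
  qed
  ultimately show thesis by (rule that)
qed

text \<open>The constant adds up as follows: 21 from the competitor and 4 + 4 K from the noise;
  then, with c = 29 + 6 K bounding the norm of the fitted matrix, 2 c * 9 K for replacing \<rho> by
  the edge density and 6 * 4 c for aligning the fitted partition with the intervals.\<close>

lemma least_squares_bound:
  assumes Bh: "Bh \<in> least_squares n k (lam * edge_density n G) G"
  shows "delta2 W (estimated_kernel n k G Bh)
    \<le> eps_oracle k W + 2 * eps_sample n W x + (25 + 4 * K + (18 * K + 24) * (29 + 6 * K)) * R"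
proof -
  have k: "0 < k" using adm_k(1) by simp
  have n: "0 < n" using adm_n(2) by simp
  have rn: "0 < real n" using n by simp
  note bW = graphon_bounded_kernel[OF adm_graphon(1)] and bs = bounded_kernel_step[OF n] bounded_kernel_step[OF k]
  let ?g = "edge_density n G"
  let ?eO = "eps_oracle k W" and ?es = "eps_sample n W x"
  let ?A = "adjacency G"
  define Q where "Q = (\<lambda>u v. \<rho> * H u v)"
  define c where "c = 29 + 6 * K"
  have c0: "0 \<le> c" using K by (simp add: c_def)
  have eO0: "0 \<le> ?eO" and es0: "0 \<le> ?es" by (rule eps_oracle_nonneg eps_sample_nonneg)+
  have grid: "Bh \<in> grid_matrices n k (lam * ?g)"
    and min: "\<And>B. B \<in> grid_matrices n k (lam * ?g) \<Longrightarrow> delta2_hat n k Bh G \<le> delta2_hat n k B G"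
    using Bh by (auto simp: least_squares_def is_arg_min_linorder)
  obtain B \<pi> where B: "B \<in> grid_matrices n k (lam * ?g)" and \<pi>: "\<pi> \<in> equipartitions n k"
    and close: "matrix_norm2 n (\<lambda>u v. B (\<pi> u) (\<pi> v) - \<rho> * H u v) \<le> \<rho> * (?eO + ?es + 21 * R)"
    by (rule competitor)
  obtain \<pi>h where \<pi>h: "\<pi>h \<in> equipartitions n k"
    and hat: "delta2_hat n k Bh G = matrix_norm2 n (\<lambda>u v. Bh (\<pi>h u) (\<pi>h v) - ?A u v)"
    by (rule delta2_hat_attained[of n k Bh G]) (use \<pi> in auto)
  have \<pi>h_img: "\<pi>h ` {..<n} \<subseteq> {..<k}"
    and \<pi>h_card: "\<And>i. i < k \<Longrightarrow> \<bar>real (card {v \<in> {..<n}. \<pi>h v = i}) - real n / real k\<bar> < 1"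
    using \<pi>h by (auto simp: equipartitions_def)
  define Y where "Y = (\<lambda>u v. Bh (\<pi>h u) (\<pi>h v))"
  define X where "X = (\<lambda>u v. B (\<pi> u) (\<pi> v))"
  define E where "E = ?eO + ?es + (25 + 4 * K) * R"
  have YX: "matrix_norm2 n (\<lambda>u v. Y u v - ?A u v) \<le> matrix_norm2 n (\<lambda>u v. X u v - ?A u v)"
    using min[OF B] delta2_hat_le[OF \<pi>, of B G] unfolding hat X_def Y_def by linarith
  have YQ: "matrix_norm2 n (\<lambda>u v. Y u v - Q u v) \<le> \<rho> * E"
  proof (rule power2_le_imp_le)
    let ?I = "\<lambda>Z. \<Sum>u<n. \<Sum>v<n. (?A u v - Q u v) * Z u v"
    let ?C = "(4 * K + 4) * (\<rho> * real n)\<^sup>2 * R\<^sup>2" and ?\<Delta> = "?eO + ?es + 21 * R"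
    have IY: "\<bar>?I Y\<bar> \<le> ?C" unfolding Y_def Q_def
      by (rule inner_bound[OF _ \<pi>h]) (use grid in \<open>auto simp: grid_matrices_def\<close>)
    have IX: "\<bar>?I X\<bar> \<le> ?C" unfolding X_def Q_def
      by (rule inner_bound[OF _ \<pi>]) (use B in \<open>auto simp: grid_matrices_def\<close>)
    have "(matrix_norm2 n (\<lambda>u v. Y u v - Q u v))\<^sup>2 \<le> (matrix_norm2 n (\<lambda>u v. X u v - Q u v))\<^sup>2 + 2 * (?I Y - ?I X) / (real n)\<^sup>2"
      by (rule matrix_norm2_closer[OF YX])
    also have "2 * (?I Y - ?I X) / (real n)\<^sup>2 \<le> 2 * (2 * ?C) / (real n)\<^sup>2"
      using IX IY by (intro divide_right_mono) auto
    also have "\<dots> = \<rho>\<^sup>2 * (16 * (1 + K) * R\<^sup>2)" using rn by (simp add: power_mult_distrib field_simps)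
    \<comment> \<open>The noise term is enlarged to a square so that a^2 + b^2 \<le> (a + b)^2
      yields a bound on the norm whose oracle and sampling terms keep coefficient 1.\<close>
    also have "\<dots> \<le> \<rho>\<^sup>2 * ((4 * (1 + K) * R)\<^sup>2)"
    proof (rule mult_left_mono)
      have "16 * (1 + K) * 1 \<le> 16 * (1 + K) * (1 + K)" using K by (intro mult_left_mono) auto
      then have "16 * (1 + K) * 1 * R\<^sup>2 \<le> 16 * (1 + K) * (1 + K) * R\<^sup>2" by (rule mult_right_mono) simp
      moreover have "(4 * (1 + K) * R)\<^sup>2 = 16 * (1 + K) * (1 + K) * R\<^sup>2" by (simp only: power_mult_distrib) (simp add: power2_eq_square)
      ultimately show "16 * (1 + K) * R\<^sup>2 \<le> (4 * (1 + K) * R)\<^sup>2" by simp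
    qed simp
    also have "(matrix_norm2 n (\<lambda>u v. X u v - Q u v))\<^sup>2 \<le> (\<rho> * ?\<Delta>)\<^sup>2"
      using close unfolding X_def Q_def by (intro power_mono) auto
    also have "(\<rho> * ?\<Delta>)\<^sup>2 + \<rho>\<^sup>2 * ((4 * (1 + K) * R)\<^sup>2) \<le> (\<rho> * (?\<Delta> + 4 * (1 + K) * R))\<^sup>2"
    proof -
      have "(\<rho> * a)\<^sup>2 + \<rho>\<^sup>2 * b\<^sup>2 \<le> (\<rho> * (a + b))\<^sup>2" if "0 \<le> a" "0 \<le> b" for a b :: real
      proof -
        have "\<rho>\<^sup>2 * (a\<^sup>2 + b\<^sup>2) \<le> \<rho>\<^sup>2 * (a + b)\<^sup>2"
          using that by (intro mult_left_mono) (auto simp: power2_sum)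
        then show ?thesis by (simp only: power_mult_distrib distrib_left[of "\<rho>\<^sup>2"])
      qed
      then show ?thesis using eO0 es0 R_pos K by simp
    qed
    also have "?\<Delta> + 4 * (1 + K) * R = E" by (simp add: E_def algebra_simps)
    finally show "(matrix_norm2 n (\<lambda>u v. Y u v - Q u v))\<^sup>2 \<le> (\<rho> * E)\<^sup>2" by simp
    show "0 \<le> \<rho> * E" using eO0 es0 R_pos K adm_\<rho> by (simp add: E_def)
  qed
  obtain \<sigma> where \<sigma>: "\<sigma> permutes {..<n}"
    and es: "?es = kernel_dist (step_kernel n (\<lambda>i j. H (\<sigma> i) (\<sigma> j))) W"
    by (rule eps_sample_attained)
  have Wn: "kernel_norm2 W \<le> sqrt lam" using kernel_norm2_graphon_le[OF adm_graphon] sqrt_\<Lambda>_le by linarith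
  \<comment> \<open>The error terms in \<open>E\<close> have an a priori bound of order sqrt lam,
    which is needed to bound the norm of the fitted matrix: 25 + 4 K from the rate, 2 + K from
    sampling and 1 from the oracle make 28 + 5 K.\<close>
  have "?es \<le> kernel_norm2 (step_kernel n (\<lambda>i j. H (\<sigma> i) (\<sigma> j))) + kernel_norm2 W"
    unfolding es by (rule kernel_norm2_triangle[OF bs(1) bW])
  also have "kernel_norm2 (step_kernel n (\<lambda>i j. H (\<sigma> i) (\<sigma> j))) = matrix_norm2 n H"
    using kernel_norm2_step[OF n] matrix_norm2_permute[OF \<sigma>, of H] by simp
  finally have es_le: "?es \<le> (2 + K) * sqrt lam" using norm_H Wn by (simp add: algebra_simps)
  have eO_le: "?eO \<le> sqrt lam" using eps_oracle_le[of k W "\<lambda>_ _. 0"] Wn by (simp add: step_kernel_def)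
  have "(25 + 4 * K) * R \<le> (25 + 4 * K) * sqrt lam" using R_le K by (intro mult_left_mono) auto
  with es_le eO_le have E_le: "E \<le> (28 + 5 * K) * sqrt lam" unfolding E_def by (simp add: algebra_simps)
  have Yn: "matrix_norm2 n Y \<le> \<rho> * (c * sqrt lam)"
  proof -
    have "matrix_norm2 n (\<lambda>u v. Y u v - 0) \<le> matrix_norm2 n (\<lambda>u v. Y u v - Q u v) + matrix_norm2 n (\<lambda>u v. Q u v - 0)"
      by (rule matrix_norm2_triangle[OF n])
    also have "matrix_norm2 n (\<lambda>u v. Q u v - 0) = \<rho> * matrix_norm2 n H"
      using matrix_norm2_scale[of n \<rho> H] adm_\<rho> by (simp add: Q_def)
    also have "\<dots> \<le> \<rho> * ((1 + K) * sqrt lam)" using norm_H adm_\<rho> by (intro mult_left_mono) auto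
    also have "matrix_norm2 n (\<lambda>u v. Y u v - Q u v) \<le> \<rho> * ((28 + 5 * K) * sqrt lam)"
      using YQ E_le adm_\<rho> by (meson mult_left_mono less_imp_le order_trans)
    finally show ?thesis by (simp add: c_def algebra_simps)
  qed
  define B' where "B' = (\<lambda>i j. 1 / ?g * Bh i j)"
  have g: "0 < ?g" "\<rho> / 2 \<le> ?g" by (rule density_bounds)+
  have est: "estimated_kernel n k G Bh = step_kernel k B'"
    by (intro ext) (simp add: estimated_kernel_def step_kernel_def B'_def)
  have HY: "matrix_norm2 n (\<lambda>u v. H u v - 1 / ?g * Y u v) \<le> E + 18 * K * c * R"
  proof -
    have "matrix_norm2 n (\<lambda>u v. H u v - 1 / ?g * Y u v) \<le> matrix_norm2 n (\<lambda>u v. H u v - 1 / \<rho> * Y u v)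
       + matrix_norm2 n (\<lambda>u v. 1 / \<rho> * Y u v - 1 / ?g * Y u v)" by (rule matrix_norm2_triangle[OF n])
    also have "(\<lambda>u v. H u v - 1 / \<rho> * Y u v) = (\<lambda>u v. (- 1 / \<rho>) * (Y u v - Q u v))"
      using adm_\<rho> by (intro ext) (simp add: Q_def field_simps)
    also have "matrix_norm2 n \<dots> = 1 / \<rho> * matrix_norm2 n (\<lambda>u v. Y u v - Q u v)"
      using adm_\<rho> by (subst matrix_norm2_scale) simp
    also have "\<dots> \<le> 1 / \<rho> * (\<rho> * E)" using YQ adm_\<rho> by (intro mult_left_mono) auto
    also have "\<dots> = E" using adm_\<rho> by simp
    also have "(\<lambda>u v. 1 / \<rho> * Y u v - 1 / ?g * Y u v) = (\<lambda>u v. (1 / \<rho> - 1 / ?g) * Y u v)"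
      by (intro ext) (simp add: left_diff_distrib)
    also have "matrix_norm2 n \<dots> = \<bar>1 / \<rho> - 1 / ?g\<bar> * matrix_norm2 n Y" by (rule matrix_norm2_scale)
    also have "\<dots> \<le> \<bar>1 / \<rho> - 1 / ?g\<bar> * (\<rho> * (c * sqrt lam))" by (intro mult_left_mono Yn) simp
    \<comment> \<open>The change of normalisation is a relative error, and the norm of the fitted
      matrix is of order \<rho> sqrt lam. So \<open>sqrt_lam_r\<close> applies, with the factor 2
      coming from r \<ge> 1/2.\<close>
    also have "\<dots> = \<bar>(r - 1) / r\<bar> * (c * sqrt lam)"
    proof -
      have "(1 / \<rho> - 1 / ?g) * \<rho> = (r - 1) / r" using adm_\<rho> g by (simp add: field_simps)
      then have "\<bar>1 / \<rho> - 1 / ?g\<bar> * \<rho> = \<bar>(r - 1) / r\<bar>" using adm_\<rho> by (metis abs_mult abs_of_pos)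
      then show ?thesis by (simp only: mult.assoc[symmetric])
    qed
    also have "\<dots> \<le> (2 * \<bar>r - 1\<bar>) * (c * sqrt lam)"
    proof (intro mult_right_mono)
      have "\<bar>r\<bar> = r" using r_bounds(1) by linarith
      then have "\<bar>(r - 1) / r\<bar> = \<bar>r - 1\<bar> / r" by (metis abs_divide)
      also have "\<dots> \<le> \<bar>r - 1\<bar> / (1 / 2)"
      proof (rule divide_left_mono[OF r_bounds(1) abs_ge_zero])
        have "0 < r" using r_bounds(1) by linarith
        then show "0 < r * (1 / 2)" by simp
      qed
      finally show "\<bar>(r - 1) / r\<bar> \<le> 2 * \<bar>r - 1\<bar>" by simp
    qed (use c0 adm_lam in simp)
    also have "\<dots> = 2 * c * (sqrt lam * \<bar>r - 1\<bar>)" by simp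
    also have "\<dots> \<le> 2 * c * (9 * K * R)" using c0 by (intro mult_left_mono sqrt_lam_r) simp
    finally show ?thesis by (simp add: mult_ac)
  qed
  have B'n: "matrix_norm2 k B' \<le> (4 * c) * sqrt lam"
  proof -
    have "matrix_norm2 k B' = 1 / ?g * matrix_norm2 k Bh" unfolding B'_def using g by (subst matrix_norm2_scale) simp
    also have "\<dots> \<le> 1 / ?g * (2 * matrix_norm2 n Y)"
      unfolding Y_def using g matrix_norm2_equipartition_ge[OF \<pi>h adm_n(1) k, of Bh] by (intro mult_left_mono) auto
    also have "\<dots> \<le> 1 / (\<rho> / 2) * (2 * (\<rho> * (c * sqrt lam)))"
      using g Yn adm_\<rho> by (intro mult_mono divide_left_mono) auto
    also have "\<dots> = (4 * c) * sqrt lam" using adm_\<rho> by simp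
    finally show ?thesis .
  qed
  obtain \<nu> where \<nu>: "\<nu> permutes {..<n}"
    and m1: "\<And>i. card {v\<in>{..<n}. \<pi>h (\<nu> v) = i \<and> v * k div n \<noteq> i} \<le> card {v\<in>{..<n}. \<pi>h v = i} - card {v\<in>{..<n}. v * k div n = i}"
    and m2: "\<And>i. card {v\<in>{..<n}. v * k div n = i \<and> \<pi>h (\<nu> v) \<noteq> i} \<le> card {v\<in>{..<n}. v * k div n = i} - card {v\<in>{..<n}. \<pi>h v = i}"
    by (rule exists_matching_permutation[of n \<pi>h "\<lambda>v. v * k div n"]) (rule that)
  \<comment> \<open>Both class sizes differ from n/k by less than 1, so their integer difference is
    less than 2.\<close>
  have diff: "card {v\<in>{..<n}. \<pi>h v = i} - card {v\<in>{..<n}. v * k div n = i} \<le> 1"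
    "card {v\<in>{..<n}. v * k div n = i} - card {v\<in>{..<n}. \<pi>h v = i} \<le> 1" if i: "i < k" for i
    using \<pi>h_card[OF i] card_floor_partition[OF i n] by linarith+
  have blow: "kernel_norm2 (\<lambda>u v. step_kernel n (\<lambda>u v. B' (\<pi>h (\<nu> u)) (\<pi>h (\<nu> v))) u v - step_kernel k B' u v) \<le> 6 * (4 * c) * R"
  proof (rule block_matrix_blowup[OF _ _ _ _ B'n])
    show "(\<lambda>v. \<pi>h (\<nu> v)) ` {..<n} \<subseteq> {..<k}"
      using \<pi>h_img permutes_image[OF \<nu>] by (metis image_image)
    fix i assume i: "i < k"
    show "\<bar>real (card {v\<in>{..<n}. \<pi>h (\<nu> v) = i}) - real n / real k\<bar> < 1"
      using \<pi>h_card[OF i] unfolding card_permuted[OF \<nu>, of "\<lambda>v. \<pi>h v = i"] .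
    show "card {v\<in>{..<n}. \<pi>h (\<nu> v) = i \<and> v * k div n \<noteq> i} \<le> 1" using m1 diff(1)[OF i] by (rule order_trans)
    show "card {v\<in>{..<n}. v * k div n = i \<and> \<pi>h (\<nu> v) \<noteq> i} \<le> 1" using m2 diff(2)[OF i] by (rule order_trans)
  qed
  \<comment> \<open>\<open>\<sigma>\<close> sorts the sample to fit \<open>W\<close> and
    \<open>\<nu>\<close> sorts it to fit the estimate; \<open>?\<tau>\<close> passes from the first
    order to the second.\<close>
  let ?\<tau> = "inv \<sigma> \<circ> \<nu>" and ?H\<nu> = "\<lambda>i j. H (\<nu> i) (\<nu> j)" and ?B\<nu> = "\<lambda>u v. B' (\<pi>h (\<nu> u)) (\<pi>h (\<nu> v))"
  have \<tau>: "?\<tau> permutes {..<n}" by (rule permutes_compose[OF \<nu> permutes_inv[OF \<sigma>]])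
  have "delta2 W (estimated_kernel n k G Bh) \<le> ?es + kernel_dist (step_kernel n ?H\<nu>) (estimated_kernel n k G Bh)"
    using delta2_le_step_permuted[OF bW estimated_kernel_bounds(3)[OF Bh] \<tau> n, of "\<lambda>i j. H (\<sigma> i) (\<sigma> j)"]
    unfolding es by (simp add: permutes_inverses[OF \<sigma>])
  also have "kernel_dist (step_kernel n ?H\<nu>) (estimated_kernel n k G Bh)
    \<le> kernel_dist (step_kernel n ?H\<nu>) (step_kernel n ?B\<nu>) + kernel_dist (step_kernel n ?B\<nu>) (step_kernel k B')"
    unfolding est by (rule kernel_norm2_dist_triangle[OF bs(1) bs(1) bs(2)])
  also have "kernel_dist (step_kernel n ?H\<nu>) (step_kernel n ?B\<nu>) = matrix_norm2 n (\<lambda>u v. ?H\<nu> u v - ?B\<nu> u v)"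
    unfolding kernel_norm2_step[OF n, symmetric] by (simp add: step_kernel_def[abs_def])
  also have "\<dots> = matrix_norm2 n (\<lambda>u v. H u v - 1 / ?g * Y u v)"
    using matrix_norm2_permute[OF \<nu>, of "\<lambda>u v. H u v - 1 / ?g * Y u v"] by (simp add: B'_def Y_def)
  finally have "delta2 W (estimated_kernel n k G Bh) \<le> ?es + ((E + 18 * K * c * R) + 6 * (4 * c) * R)"
    using HY blow by linarith
  also have "\<dots> = ?eO + 2 * ?es + (25 + 4 * K + (18 * K + 24) * c) * R"
    by (simp add: E_def algebra_simps)
  finally show ?thesis by (simp add: c_def)
qed

end

section \<open>Probability of the good event\<close>

lemma least_squares_probability:
  assumes \<eta>: "0 < \<eta>" "\<eta> \<le> 1" and K: "1 \<le> K1" "8 / K1\<^sup>2 \<le> \<eta>" "K = 2 * K1 + 1 + ln (8 / \<eta>)"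
    and large: "12 * K \<le> sqrt (sqrt (real n))"
    and M: "25 + 4 * K + (18 * K + 24) * (29 + 6 * K) \<le> M"
  shows "measure (graph_model n \<rho> W)
        (good_event n k W \<rho> lam M)
        \<ge> 1 - \<eta>"
proof -
  let ?S = "good_event n k W \<rho> lam M"
  let ?t = "K1 * (real n * sqrt (real n * \<Lambda>))"
  let ?X = "{x \<in> space (sample_space n). \<bar>edge_sum n W x - real (n choose 2)\<bar> < ?t}"
  have n: "0 < real n" using adm_n(2) by simp
  have \<rho>0: "0 \<le> \<rho>" using adm_\<rho> by simp
  note model = adm_graphon(1,3) \<rho>0 adm_\<rho>(2)
  have ln8: "0 \<le> ln (8 / \<eta>)" using \<eta> by simp
  have KK1: "K1 \<le> K" "1 \<le> K" using K ln8 by auto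
  have t: "0 < ?t" using K(1) n adm_\<Lambda> by simp
  have S: "?S \<in> sets (graph_model n \<rho> W)"
    by (rule sets_graph_modelI[OF model]) (rule sets_eps_sample_ge[OF adm_graphon(1)], use n in auto)
  \<comment> \<open>Chebyshev contributes 4 / K1^2 \<le> \<eta>/2. The other half of \<eta> is
    shared by the two Chernoff bounds given the sample.\<close>
  have X: "measure (sample_space n) ?X \<ge> 1 - \<eta> / 2"
  proof -
    have "?t\<^sup>2 = K1\<^sup>2 * (real n ^ 3 * \<Lambda>)"
      using n adm_\<Lambda> by (simp add: power_mult_distrib power3_eq_cube power2_eq_square)
    then have "4 * real n ^ 3 * \<Lambda> / ?t\<^sup>2 = 4 / K1\<^sup>2" using n adm_\<Lambda> by simp
    then show ?thesis using edge_sum_concentration(2)[OF adm_graphon t, of n] K(2) by linarith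
  qed
  have exp_bound: "2 * exp (- ln (8 / \<eta>)) = \<eta> / 4" using \<eta> by (simp add: exp_minus)
  have "measure (graph_model n \<rho> W) ?S \<ge> 1 - \<eta> / 2 - \<eta> / 2"
  proof (rule graph_model_prob_ge[OF model S edge_sum_concentration(1)[OF adm_graphon t] X])
    fix x assume xX: "x \<in> ?X"
    then have x: "x \<in> space (sample_space n)" by simp
    let ?p = "\<lambda>i j. \<rho> * sampled_matrix W x i j"
    let ?dev = "edge_deviation n (\<lambda>(i, j). ?p i j)"
    let ?P = "random_graph_pmf n ?p"
    define L where "L = real n * ln (real k) + (real k)\<^sup>2"
    \<comment> \<open>On the event for the sample, \<open>V\<close> bounds the expected number of
      edges, the variance proxy in the exponent.\<close>
    define V where "V = 2 * K1 * \<rho> * (real n)\<^sup>2"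
    have L1: "1 \<le> L"
    proof -
      have "1 \<le> (real k)\<^sup>2" "0 \<le> real n * ln (real k)" using adm_k(1) by auto
      then show ?thesis unfolding L_def by linarith
    qed
    have noise_L: "noise * (\<rho> * (real n)\<^sup>2) = L"
      unfolding noise_def L_def using n adm_\<rho> by (simp add: field_simps power2_eq_square)
    have p01: "0 \<le> ?p i j \<and> ?p i j \<le> 1" if "(i, j) \<in> vertex_pairs n" for i j
      using edge_probability_bounds[OF model x, of i j] that by (auto simp: vertex_pairs_def)
    have sumV: "(\<Sum>(i, j)\<in>vertex_pairs n. ?p i j) \<le> V"
    proof -
      have "edge_sum n W x \<le> (1 / 2 + K1) * (real n)\<^sup>2"
        by (rule edge_sum_le[OF _ K(1)]) (use xX in auto)
      also have "\<dots> \<le> (2 * K1) * (real n)\<^sup>2" using K(1) by (intro mult_right_mono) auto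
      finally have "\<rho> * edge_sum n W x \<le> \<rho> * ((2 * K1) * (real n)\<^sup>2)"
        using adm_\<rho> by (intro mult_left_mono) auto
      then show ?thesis by (simp add: V_def sum_distrib_left sampled_matrix_def case_prod_beta' mult_ac)
    qed
    \<comment> \<open>The one-point index set puts the single edge-count event into the form of the
      uniform tail bound.\<close>
    let ?A1 = "{G. \<forall>a\<in>{()}. \<bar>?dev (\<lambda>_. 1) G\<bar> < K * (sqrt \<rho> * real n)}"
    let ?I = "({..<n} \<rightarrow>\<^sub>E {..<k}) \<times> Pow ({..<k} \<times> {..<k})"
    let ?A2 = "{G. \<forall>a\<in>?I. \<bar>?dev (block_indicator (fst a) (snd a)) G\<bar> < K * (\<rho> * (real n)\<^sup>2 * sqrt noise)}"
    have A1: "measure_pmf.prob ?P ?A1 \<ge> 1 - \<eta> / 4"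
    proof -
      \<comment> \<open>With this choice the exponent is 2 K1 - K, so the summands 2 K1 and ln
        (8/\<eta>) of \<open>K\<close> give failure probability at most \<eta>/4.\<close>
      let ?s = "1 / (sqrt \<rho> * real n)"
      have "1 \<le> sqrt (\<rho> * (real n)\<^sup>2)" using adm_n(4) by simp
      then have rn1: "1 \<le> sqrt \<rho> * real n" by (simp add: real_sqrt_mult)
      then have s: "0 < ?s" "?s \<le> 1" by auto
      have "1 - real (card {()}) * (2 * exp (?s\<^sup>2 * V - ?s * (K * (sqrt \<rho> * real n)))) \<le> measure_pmf.prob ?P ?A1"
        by (rule edge_deviation_uniform_tail[OF p01 _ _ s sumV]) auto
      moreover have "?s\<^sup>2 * V = 2 * K1" using n adm_\<rho> by (simp add: V_def power_divide power_mult_distrib)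
      moreover have "?s * (K * (sqrt \<rho> * real n)) = K" using n adm_\<rho> by simp
      moreover have "2 * exp (2 * K1 - K) \<le> 2 * exp (- ln (8 / \<eta>))" unfolding K(3) by simp
      ultimately show ?thesis using exp_bound by simp
    qed
    have A2: "measure_pmf.prob ?P ?A2 \<ge> 1 - \<eta> / 4"
    proof -
      \<comment> \<open>With this choice the exponent is (2 K1 - K) L. The summand 1 in
        \<open>K\<close> cancels the number exp L of events, and L \<ge> 1 leaves at most
        \<eta>/4.\<close>
      let ?s = "sqrt noise" and ?t = "K * (\<rho> * (real n)\<^sup>2 * sqrt noise)"
      have s: "0 < ?s" "?s \<le> 1" using noise_bounds by auto
      have b: "\<bar>block_indicator (fst a) (snd a) e\<bar> \<le> 1" for a e by (simp add: block_indicator_def of_bool_def)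
      have tail: "1 - real (card ?I) * (2 * exp (?s\<^sup>2 * V - ?s * ?t)) \<le> measure_pmf.prob ?P ?A2"
        by (rule edge_deviation_uniform_tail[OF p01 _ b s sumV]) (auto intro!: finite_PiE)
      have e1: "?s\<^sup>2 * V = 2 * K1 * L" using noise_bounds(5) noise_L by (simp add: V_def mult_ac)
      have e2: "?s * ?t = K * L"
      proof -
        have "?s * ?t = K * ((?s * ?s) * (\<rho> * (real n)\<^sup>2))" by (simp only: mult_ac)
        then show ?thesis using noise_bounds(5) noise_L by simp
      qed
      have cI: "real (card ?I) \<le> exp L"
      proof -
        have "real (card ?I) = real k ^ n * 2 ^ (k * k)"
          by (simp add: card_cartesian_product card_PiE card_Pow)
        also have "real k ^ n = exp (real n * ln (real k))"
          using adm_k(1) by (simp add: exp_of_nat_mult)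
        \<comment> \<open>The number k^n 2^(k^2) of pairs is bounded by exp L through 2 \<le>
          e.\<close>
        also have "(2::real) ^ (k * k) \<le> exp 1 ^ (k * k)" using exp_ge_add_one_self[of 1] by (intro power_mono) auto
        also have "exp 1 ^ (k * k) = exp ((real k)\<^sup>2)" by (simp add: exp_of_nat_mult[symmetric] power2_eq_square)
        finally show ?thesis by (simp add: L_def exp_add)
      qed
      have bnd: "exp L * (2 * exp (2 * K1 * L - K * L)) \<le> 2 * exp (- ln (8 / \<eta>))"
      proof -
        have "exp L * (2 * exp (2 * K1 * L - K * L)) = 2 * exp (- (ln (8 / \<eta>) * L))"
          by (simp add: exp_add[symmetric] K(3) algebra_simps)
        moreover have "ln (8 / \<eta>) * 1 \<le> ln (8 / \<eta>) * L" using ln8 L1 by (intro mult_left_mono) auto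
        ultimately show ?thesis by simp
      qed
      have "real (card ?I) * (2 * exp (2 * K1 * L - K * L)) \<le> exp L * (2 * exp (2 * K1 * L - K * L))"
        by (rule mult_right_mono[OF cI]) simp
      then show ?thesis using tail bnd exp_bound unfolding e1 e2 by linarith
    qed
    have "1 - \<eta> / 4 - \<eta> / 4 \<le> measure_pmf.prob ?P (?A1 \<inter> ?A2)" by (rule prob_Int_ge[OF A1 A2])
    also have "\<dots> \<le> measure_pmf.prob ?P {G. (x, G) \<in> ?S}"
    proof (rule measure_pmf.finite_measure_mono_AE)
      show "AE G in ?P. G \<in> ?A1 \<inter> ?A2 \<longrightarrow> G \<in> {G. (x, G) \<in> ?S}"
      proof (rule AE_pmfI, rule impI)
        fix G assume "G \<in> set_pmf ?P" and A: "G \<in> ?A1 \<inter> ?A2"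
        then have G: "G \<subseteq> vertex_pairs n" using set_random_graph_pmf by blast
        have h1: "\<bar>edge_sum n W x - real (n choose 2)\<bar> \<le> K * (real n * sqrt (real n * \<Lambda>))"
        proof -
          have "?t \<le> K * (real n * sqrt (real n * \<Lambda>))" using KK1 n adm_\<Lambda> by (intro mult_right_mono) auto
          then show ?thesis using xX by auto
        qed
        have h2: "\<bar>?dev (\<lambda>_. 1) G\<bar> \<le> K * (sqrt \<rho> * real n)" using A by auto
        have h3: "\<bar>?dev (block_indicator \<pi> S) G\<bar> \<le> K * (\<rho> * (real n)\<^sup>2 * sqrt noise)"
          if "\<pi> \<in> {..<n} \<rightarrow>\<^sub>E {..<k}" "S \<subseteq> {..<k} \<times> {..<k}" for \<pi> S
        proof -
          have "(\<pi>, S) \<in> ?I" using that by auto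
          moreover have "\<forall>a\<in>?I. \<bar>?dev (block_indicator (fst a) (snd a)) G\<bar> < K * (\<rho> * (real n)\<^sup>2 * sqrt noise)"
            using A by blast
          ultimately show ?thesis by (metis fst_conv snd_conv less_imp_le)
        qed
        have "delta2 W (estimated_kernel n k G B) \<le> eps_oracle k W + 2 * eps_sample n W x + M * root 4 (rate n k \<rho> lam)"
          if "B \<in> least_squares n k (lam * edge_density n G) G" for B
        proof -
          have "(25 + 4 * K + (18 * K + 24) * (29 + 6 * K)) * R \<le> M * R" using M R_pos by (intro mult_right_mono) auto
          then show ?thesis
            using least_squares_bound[OF x G KK1(2) h1 h2 h3 large that] unfolding R_def by linarith
        qed
        then show "G \<in> {G. (x, G) \<in> ?S}" using x G by (simp add: space_graph_model[OF model])
      qed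
    qed auto
    finally show "1 - \<eta> / 2 \<le> measure_pmf.prob ?P {G. (x, G) \<in> ?S}" by simp
  qed (use \<eta> in auto)
  then show ?thesis by simp
qed

lemma least_squares_probability_small_n:
  assumes n: "sqrt (real n) \<le> c" "2 * c \<le> M" and \<eta>: "0 < \<eta>"
  shows "measure (graph_model n \<rho> W)
        (good_event n k W \<rho> lam M)
        \<ge> 1 - \<eta>"
proof -
  have \<rho>0: "0 \<le> \<rho>" using adm_\<rho> by simp
  interpret gm: prob_space "graph_model n \<rho> W"
    by (rule prob_space_graph_model[OF adm_graphon(1,3) \<rho>0 adm_\<rho>(2)])
  have c: "0 \<le> c" using n(1) by (meson order_trans real_sqrt_ge_zero of_nat_0_le_iff)
  have nc: "real n \<le> c\<^sup>2" using n(1) by (simp add: sqrt_le_D)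
  have "delta2 W (estimated_kernel n k G B) \<le> eps_oracle k W + 2 * eps_sample n W x + M * root 4 (rate n k \<rho> lam)"
    if "B \<in> least_squares n k (lam * edge_density n G) G" for B G x
  proof -
    have "2 * c * R \<le> M * R" using n(2) R_pos by (intro mult_right_mono) auto
    then show ?thesis
      using least_squares_bound_small_n[OF that nc c] eps_oracle_nonneg[of k W] eps_sample_nonneg[of n W x] unfolding R_def by linarith
  qed
  then have "(good_event n k W \<rho> lam M) = space (graph_model n \<rho> W)"
    by auto
  then show ?thesis using gm.prob_space \<eta> by simp
qed

end

lemma least_squares_rate:
  assumes \<eta>: "0 < \<eta>"
  shows "\<exists>M::real. \<forall>n k W \<Lambda> \<rho> lam. admissible n k W \<Lambda> \<rho> lam \<longrightarrow>
      measure (graph_model n \<rho> W)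
        (good_event n k W \<rho> lam M)
        \<ge> 1 - \<eta>"
proof -
  \<comment> \<open>Capping at 1 makes ln (8/\<eta>') nonnegative.\<close>
  define \<eta>' where "\<eta>' = min \<eta> 1"
  have \<eta>': "0 < \<eta>'" "\<eta>' \<le> 1" "\<eta>' \<le> \<eta>" using \<eta> by (auto simp: \<eta>'_def)
  \<comment> \<open>Then 8 / K1^2 is 8/9 of \<eta>'^2, hence at most \<eta>'.\<close>
  define K1 where "K1 = 3 / \<eta>'"
  define K where "K = 2 * K1 + 1 + ln (8 / \<eta>')"
  \<comment> \<open>The second entry serves the case n^(1/4) < 12 K, where sqrt n \<le> (12 K)^2 and
    the trivial bound is used.\<close>
  define M where "M = max (25 + 4 * K + (18 * K + 24) * (29 + 6 * K)) (2 * (12 * K)\<^sup>2)"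
  have K1: "1 \<le> K1" using \<eta>' by (simp add: K1_def field_simps)
  have K1': "8 / K1\<^sup>2 \<le> \<eta>'"
  proof -
    have "8 / K1\<^sup>2 = 8 / 9 * (\<eta>' * \<eta>')" using \<eta>' by (simp add: K1_def power2_eq_square)
    also have "\<dots> \<le> 1 * (\<eta>' * 1)" using \<eta>' by (intro mult_mono) auto
    finally show ?thesis by simp
  qed
  show ?thesis
  proof (intro exI[of _ M] allI impI)
    fix n k W \<Lambda> \<rho> lam assume adm: "admissible n k W \<Lambda> \<rho> lam"
    interpret least_squares_model n k W \<Lambda> \<rho> lam by (unfold_locales) (rule adm)
    let ?p = "measure (graph_model n \<rho> W)
        (good_event n k W \<rho> lam M)"
    have "1 - \<eta>' \<le> ?p"
    proof (cases "12 * K \<le> sqrt (sqrt (real n))")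
      case True
      then show ?thesis
        by (rule least_squares_probability[OF \<eta>'(1,2) K1 K1' K_def]) (simp add: M_def)
    next
      case False
      have "sqrt (real n) = (sqrt (sqrt (real n)))\<^sup>2" by simp
      also have "\<dots> \<le> (12 * K)\<^sup>2" using False by (intro power_mono) auto
      finally show ?thesis
        by (rule least_squares_probability_small_n[OF _ _ \<eta>'(1)]) (simp add: M_def)
    qed
    then show "1 - \<eta> \<le> ?p" using \<eta>'(3) by linarith
  qed
qed

section \<open>Consistency\<close>

lemma AE_unit_square:
  assumes "AE p in (lborel :: (real \<times> real) measure). P p"
  shows "AE p in unit_square. P p"
proof -
  obtain N where N: "N \<in> sets (lborel :: (real \<times> real) measure)" "emeasure lborel N = 0" "\<And>p. \<not> P p \<Longrightarrow> p \<in> N"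
    using assms unfolding eventually_ae_filter by (auto simp: null_sets_def)
  \<comment> \<open>\<open>unit_square\<close> is a product of restrictions, so the planar null set
    is transferred by slices: almost every slice is null on the line and remains so on the unit
    interval.\<close>
  have "AE p in lborel \<Otimes>\<^sub>M lborel. p \<notin> N"
    unfolding lborel_prod by (rule AE_not_in) (use N in \<open>auto simp: null_sets_def\<close>)
  then have "AE x in lborel. AE y in lborel. (x, y) \<notin> N" by (rule lborel_pair.AE_pair)
  moreover have ae: "AE x in unit_interval. Q x" if "AE x in lborel. Q x" for Q
    unfolding unit_interval_def using that by (subst AE_restrict_space_iff) auto
  ultimately have "AE x in unit_interval. AE y in lborel. (x, y) \<notin> N" by blast
  then have AE: "AE x in unit_interval. AE y in unit_interval. (x, y) \<notin> N"
    by (rule eventually_mono) (rule ae)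
  have m: "(\<lambda>p. p) \<in> unit_square \<rightarrow>\<^sub>M lborel \<Otimes>\<^sub>M lborel"
  proof -
    have [measurable]: "(\<lambda>x. x) \<in> unit_interval \<rightarrow>\<^sub>M lborel"
      unfolding unit_interval_def by (rule measurable_restrict_space1) simp
    have "(\<lambda>p. (fst p, snd p)) \<in> unit_square \<rightarrow>\<^sub>M lborel \<Otimes>\<^sub>M lborel"
      by (intro measurable_Pair measurable_compose[OF measurable_fst] measurable_compose[OF measurable_snd]) measurable
    then show ?thesis by simp
  qed
  have "(\<lambda>p. p) -` (- N) \<inter> space unit_square \<in> sets unit_square"
    by (rule measurable_sets[OF m]) (use N(1) in \<open>simp only: lborel_prod sets_lborel borel_comp\<close>)
  moreover have "(\<lambda>p. p) -` (- N) \<inter> space unit_square = {p \<in> space unit_square. p \<notin> N}"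
    by blast
  ultimately have "AE p in unit_square. p \<notin> N" by (intro UI2.AE_pair_measure[OF _ AE]) simp
  then show ?thesis by (rule eventually_mono) (use N(3) in blast)
qed

lemma measurable_unit_square_continuous:
  fixes h :: "real \<times> real \<Rightarrow> real"
  assumes "continuous_on UNIV h"
  shows "h \<in> borel_measurable unit_square"
proof -
  have [measurable]: "(\<lambda>x. x) \<in> borel_measurable unit_interval"
    by (rule measurable_unit_interval_borel) simp
  have "(\<lambda>p. (fst p, snd p)) \<in> unit_square \<rightarrow>\<^sub>M borel"
    unfolding borel_prod[symmetric]
    by (intro measurable_Pair measurable_compose[OF measurable_fst] measurable_compose[OF measurable_snd]) measurable
  from measurable_compose[OF this borel_measurable_continuous_onI[OF assms]] show ?thesis by simp
qed

text \<open>Lebesgue measurable functions on the plane are almost everywhere limits of continuous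
  ones, by \<open>measurable_on\<close>. Truncation at the bound \<open>C\<close> supplies a
  dominating constant, so almost everywhere convergence becomes convergence in L2.\<close>

lemma bounded_kernel_approx_continuous:
  assumes W: "bounded_kernel W" and e: "0 < e"
  obtains h where "continuous_on UNIV (\<lambda>p. h (fst p) (snd p))" "bounded_kernel h" "kernel_dist W h < e"
proof -
  obtain C where C: "0 \<le> C" "\<And>x y. x \<in> {0..1} \<Longrightarrow> y \<in> {0..1} \<Longrightarrow> \<bar>W x y\<bar> \<le> C"
    by (rule bounded_kernelE[OF W]) (rule that)
  \<comment> \<open>Clamping the coordinates extends \<open>W\<close> from the square to a Borel
    function on the whole plane.\<close>
  define c :: "real \<Rightarrow> real" where "c = (\<lambda>t. max 0 (min 1 t))"
  have c01: "c t \<in> {0..1}" for t by (simp add: c_def)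
  have c_id: "c t = t" if "t \<in> {0..1}" for t using that by (simp add: c_def)
  have cm: "c \<in> borel \<rightarrow>\<^sub>M unit_interval"
  proof -
    have "c \<in> borel \<rightarrow>\<^sub>M lborel" unfolding c_def by measurable
    moreover have "c \<in> space borel \<rightarrow> {0..1}" using c01 by blast
    ultimately show ?thesis unfolding unit_interval_def by (simp add: measurable_restrict_space2_iff)
  qed
  define f where "f = (\<lambda>p. W (c (fst p)) (c (snd p)))"
  have "(\<lambda>p. (c (fst p), c (snd p))) \<in> borel \<Otimes>\<^sub>M borel \<rightarrow>\<^sub>M unit_square"
    by (intro measurable_Pair measurable_compose[OF measurable_fst cm] measurable_compose[OF measurable_snd cm])
  from measurable_compose[OF this bounded_kernel_measurable[OF W]]
  have "f \<in> borel_measurable borel" unfolding f_def borel_prod by simp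
  then have "f \<in> borel_measurable lebesgue" by (intro measurable_completion) simp
  then have "f measurable_on UNIV" by (rule lebesgue_measurable_imp_measurable_on) simp
  then obtain N g where N: "negligible N" and g: "\<And>m. continuous_on UNIV (g m)"
    and lim: "\<And>p. p \<notin> N \<Longrightarrow> (\<lambda>m. g m p) \<longlonglongrightarrow> f p"
    unfolding measurable_on_def by auto
  define h where "h = (\<lambda>m p. max (- C) (min C (g m p)))"
  have hc: "continuous_on UNIV (h m)" for m
    unfolding h_def by (intro continuous_intros g)
  have hC: "\<bar>h m p\<bar> \<le> C" for m p using C(1) by (auto simp: h_def)
  have fC: "\<bar>f p\<bar> \<le> C" for p unfolding f_def by (intro C(2) c01)
  have hlim: "(\<lambda>m. h m p) \<longlonglongrightarrow> f p" if "p \<notin> N" for p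
  proof -
    have "(\<lambda>m. h m p) \<longlonglongrightarrow> max (- C) (min C (f p))"
      unfolding h_def by (intro tendsto_intros lim that)
    moreover have "max (- C) (min C (f p)) = f p" using fC[of p] by linarith
    ultimately show ?thesis by simp
  qed
  have bh: "bounded_kernel (\<lambda>x y. h m (x, y))" for m
    by (rule bounded_kernelI[of _ C]) (use measurable_unit_square_continuous[OF hc] hC in auto)
  have "AE p in lborel. p \<notin> N"
  proof -
    obtain N' where "N' \<in> null_sets lborel" "N \<subseteq> N'"
      using N unfolding negligible_iff_null_sets null_sets_completion_iff2 by blast
    then show ?thesis using AE_not_in[of N' lborel] by (auto elim!: eventually_mono)
  qed
  then have AEN: "AE p in unit_square. p \<notin> N" by (rule AE_unit_square)
  have "(\<lambda>m. \<integral>p. (W (fst p) (snd p) - h m (fst p, snd p))\<^sup>2 \<partial>unit_square) \<longlonglongrightarrow> (\<integral>p. 0 \<partial>unit_square)"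
  proof (rule integral_dominated_convergence[where w = "\<lambda>_. (2 * C)\<^sup>2"])
    show "(\<lambda>p. (W (fst p) (snd p) - h m (fst p, snd p))\<^sup>2) \<in> borel_measurable unit_square" for m
      using bounded_kernel_measurable[OF bounded_kernel_square[OF bounded_kernel_diff[OF W bh[of m]]]] .
    show "AE p in unit_square. norm ((W (fst p) (snd p) - h m (fst p, snd p))\<^sup>2) \<le> (2 * C)\<^sup>2" for m
    proof (rule AE_I2)
      fix p assume "p \<in> space unit_square"
      then have "\<bar>W (fst p) (snd p)\<bar> \<le> C" by (intro C(2)) (auto simp: space_pair_measure)
      then have "\<bar>W (fst p) (snd p) - h m (fst p, snd p)\<bar> \<le> \<bar>2 * C\<bar>" using hC[of m "(fst p, snd p)"] by linarith
      then show "norm ((W (fst p) (snd p) - h m (fst p, snd p))\<^sup>2) \<le> (2 * C)\<^sup>2"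
        by (simp only: real_norm_def abs_power2 abs_le_square_iff)
    qed
    show "AE p in unit_square. (\<lambda>m. (W (fst p) (snd p) - h m (fst p, snd p))\<^sup>2) \<longlonglongrightarrow> 0"
    proof (rule AE_mp[OF AEN], rule AE_I2, rule impI)
      fix p assume "p \<in> space unit_square" and pN: "p \<notin> N"
      then have "fst p \<in> {0..1}" "snd p \<in> {0..1}" by (auto simp: space_pair_measure)
      then have fp: "f p = W (fst p) (snd p)" by (simp add: f_def c_id)
      have "(\<lambda>m. (W (fst p) (snd p) - h m p)\<^sup>2) \<longlonglongrightarrow> (W (fst p) (snd p) - f p)\<^sup>2"
        by (intro tendsto_intros hlim pN)
      then show "(\<lambda>m. (W (fst p) (snd p) - h m (fst p, snd p))\<^sup>2) \<longlonglongrightarrow> 0" by (simp add: fp)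
    qed
  qed auto
  then have "(\<lambda>m. kernel_norm2 (\<lambda>x y. W x y - h m (x, y))) \<longlonglongrightarrow> 0"
    unfolding kernel_norm2_alt using tendsto_real_sqrt by fastforce
  then have "\<forall>\<^sub>F m in sequentially. kernel_norm2 (\<lambda>x y. W x y - h m (x, y)) < e" using e by (rule order_tendstoD)
  then obtain m where "kernel_norm2 (\<lambda>x y. W x y - h m (x, y)) < e" by (auto simp: eventually_sequentially)
  then show thesis using that[of "\<lambda>x y. h m (x, y)"] bh hc[of m] by simp
qed

lemma cell_approx:
  assumes "x \<in> {0..1}" "0 < m"
  shows "\<bar>x - real (cell m x) / real m\<bar> \<le> 1 / real m" "real (cell m x) / real m \<in> {0..1}"
proof -
  have "\<bar>real m * x - real (cell m x)\<bar> \<le> 1"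
  proof (cases "x < 1")
    case True
    then show ?thesis using cell_iff[of x m "cell m x"] assms by auto
  next
    case False
    then have "x = 1" using assms by simp
    then show ?thesis using assms by (simp add: cell_def of_nat_diff)
  qed
  then have "\<bar>real m * x - real (cell m x)\<bar> / real m \<le> 1 / real m" by (rule divide_right_mono) simp
  moreover have "x - real (cell m x) / real m = (real m * x - real (cell m x)) / real m" using assms by (simp add: diff_divide_distrib)
  ultimately show "\<bar>x - real (cell m x) / real m\<bar> \<le> 1 / real m" by simp
  show "real (cell m x) / real m \<in> {0..1}" using cell_less[OF assms(2), of x] by simp
qed

lemma eps_oracle_tendsto:
  assumes W: "graphon W"
  shows "(\<lambda>k. eps_oracle k W) \<longlonglongrightarrow> 0"
proof (rule tendstoI)
  fix e :: real assume e: "0 < e"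
  note bW = graphon_bounded_kernel[OF W]
  obtain h where hc: "continuous_on UNIV (\<lambda>p. h (fst p) (snd p))" and bh: "bounded_kernel h"
    and Wh: "kernel_dist W h < e / 2"
    by (rule bounded_kernel_approx_continuous[OF bW, of "e / 2"]) (use e in auto)
  have "continuous_on ({0..1} \<times> {0..1}) (\<lambda>p. h (fst p) (snd p))"
    by (rule continuous_on_subset[OF hc]) simp
  then have "uniformly_continuous_on ({0..1} \<times> {0..1}) (\<lambda>p. h (fst p) (snd p))"
    by (rule compact_uniformly_continuous) (intro compact_Times compact_Icc)
  then obtain d where d: "0 < d" "\<And>p q. p \<in> {0..1} \<times> {0..1} \<Longrightarrow> q \<in> {0..1} \<times> {0..1} \<Longrightarrow> dist q p < d \<Longrightarrow>
      dist (h (fst q) (snd q)) (h (fst p) (snd p)) < e / 2"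
    using e unfolding uniformly_continuous_on_def by (metis half_gt_zero)
  \<comment> \<open>Each coordinate of a point is within 1/k of the left end of its cell, so the
    distance to the grid point is at most 2/k, which is less than d.\<close>
  have "eps_oracle k W < e" if k: "2 / d < real k" for k
  proof -
    have k0: "0 < k" using k d(1) by (metis divide_pos_pos less_trans of_nat_0_less_iff zero_less_numeral)
    let ?S = "step_kernel k (\<lambda>i j. h (real i / real k) (real j / real k))"
    have "kernel_dist h ?S \<le> e / 2"
    proof (rule kernel_norm2_le_const[OF bounded_kernel_diff[OF bh bounded_kernel_step[OF k0]]])
      fix x y :: real assume x: "x \<in> {0..1}" and y: "y \<in> {0..1}"
      let ?x = "real (cell k x) / real k" and ?y = "real (cell k y) / real k"
      have "dist (x, y) (?x, ?y) \<le> \<bar>x - ?x\<bar> + \<bar>y - ?y\<bar>"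
        unfolding dist_prod_def by (simp add: dist_real_def sqrt_sum_squares_le_sum_abs)
      also have "\<dots> \<le> 1 / real k + 1 / real k" by (intro add_mono cell_approx x y k0)
      also have "\<dots> < d" using k k0 d(1) by (simp add: field_simps)
      finally have "dist (h x y) (h ?x ?y) < e / 2"
        using d(2)[of "(?x, ?y)" "(x, y)"] cell_approx(2)[OF x k0] cell_approx(2)[OF y k0] x y by auto
      then show "\<bar>h x y - ?S x y\<bar> \<le> e / 2" by (simp add: dist_real_def step_kernel_def)
    qed
    then have "kernel_dist W ?S < e"
      using kernel_norm2_dist_triangle[OF bW bh bounded_kernel_step[OF k0], of "\<lambda>i j. h (real i / real k) (real j / real k)"] Wh by linarith
    then show ?thesis using eps_oracle_le by (rule le_less_trans[rotated])
  qed
  moreover have "\<forall>\<^sub>F k in sequentially. 2 / d < real k" by real_asymp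
  ultimately show "\<forall>\<^sub>F k in sequentially. dist (eps_oracle k W) 0 < e"
    using eps_oracle_nonneg by (auto elim!: eventually_mono simp: dist_real_def)
qed

section \<open>Convergence of the sampling error\<close>

lemma integral_step_kernel:
  assumes "0 < m"
  shows "(\<integral>p. step_kernel m A (fst p) (snd p) \<partial>unit_square) = (\<Sum>i<m. \<Sum>j<m. A i j) / (real m)\<^sup>2"
proof -
  have "(\<integral>p. step_kernel m A (fst p) (snd p) \<partial>unit_square)
    = (\<integral>x. (\<integral>y. step_kernel m A x y \<partial>unit_interval) \<partial>unit_interval)"
    using UI2.integral_fst'[OF integrable_bounded_kernel[OF bounded_kernel_step[OF assms, of A]]]
    by (simp add: case_prod_beta')
  also have "\<dots> = (\<integral>x. (\<Sum>j<m. A (cell m x) j) / real m \<partial>unit_interval)"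
    unfolding step_kernel_def by (subst integral_cell[OF assms]) simp
  also have "\<dots> = (\<Sum>i<m. \<Sum>j<m. A i j) / (real m)\<^sup>2"
    by (subst integral_cell[OF assms, of "\<lambda>i. (\<Sum>j<m. A i j) / real m"])
      (simp add: sum_divide_distrib power2_eq_square)
  finally show ?thesis .
qed

text \<open>Off the diagonal every term has the integral of \<open>f\<close> as its mean. The n
  diagonal terms see \<open>f\<close> only on a null set, where the integral gives no control, hence
  the separate bound \<open>D\<close>.\<close>

lemma integral_sample_sum_le:
  assumes f: "bounded_kernel f" and D: "\<And>x. x \<in> {0..1} \<Longrightarrow> f x x \<le> D"
    and I: "0 \<le> (\<integral>p. f (fst p) (snd p) \<partial>unit_square)"
  shows "(\<integral>x. (\<Sum>u<n. \<Sum>v<n. f (x u) (x v)) \<partial>sample_space n)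
    \<le> (real n)\<^sup>2 * (\<integral>p. f (fst p) (snd p) \<partial>unit_square) + real n * D"
proof -
  interpret P: prob_space "sample_space n" by (rule prob_space_sample)
  let ?I = "\<integral>p. f (fst p) (snd p) \<partial>unit_square"
  have diag: "(\<integral>x. f (x u) (x u) \<partial>sample_space n) \<le> D" if u: "u < n" for u
  proof -
    have "(\<integral>x. f (x u) (x u) \<partial>sample_space n) \<le> (\<integral>x. D \<partial>sample_space n)"
      by (intro integral_mono integrable_kernel_sample[OF f u u]) (auto intro!: D sample_in_unit[OF _ u] simp del: atLeastAtMost_iff)
    then show ?thesis by (simp add: P.prob_space)
  qed
  have "(\<integral>x. (\<Sum>u<n. \<Sum>v<n. f (x u) (x v)) \<partial>sample_space n) = (\<Sum>u<n. \<Sum>v<n. (\<integral>x. f (x u) (x v) \<partial>sample_space n))"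
    by (subst Bochner_Integration.integral_sum, intro Bochner_Integration.integrable_sum integrable_kernel_sample[OF f], simp, simp,
        intro sum.cong refl Bochner_Integration.integral_sum integrable_kernel_sample[OF f], simp_all)
  also have "\<dots> \<le> (\<Sum>u<n. \<Sum>v<n. ?I + of_bool (u = v) * D)"
  proof (intro sum_mono)
    fix u v assume "u \<in> {..<n}" "v \<in> {..<n}"
    then have uv: "u < n" "v < n" by auto
    show "(\<integral>x. f (x u) (x v) \<partial>sample_space n) \<le> ?I + of_bool (u = v) * D"
    proof (cases "u = v")
      case True
      then show ?thesis using diag[OF uv(1)] I by simp
    next
      case False
      then show ?thesis using integral_sample_pair[OF f uv False] by simp
    qed
  qed
  also have "\<dots> = (real n)\<^sup>2 * ?I + real n * D"
  proof -
    have "(\<Sum>v<n. of_bool (u = v) * D) = D" if "u < n" for u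
      using that by (simp add: of_bool_def if_distrib[of "\<lambda>c. c * D"] cong: if_cong)
    then have "(\<Sum>u<n. \<Sum>v<n. of_bool (u = v) * D) = real n * D" by simp
    then show ?thesis by (simp add: sum.distrib power2_eq_square distrib_left)
  qed
  finally show ?thesis .
qed

text \<open>This is used twice: with \<open>f\<close> the squared difference of \<open>W\<close> and
  a step kernel, and with a rank-one kernel whose double sum is a squared centred cell count. Only
  the whole double sum, not \<open>f\<close>, is nonnegative in the second case.\<close>

lemma sample_sum_Markov:
  assumes f: "bounded_kernel f" and D: "\<And>x. x \<in> {0..1} \<Longrightarrow> f x x \<le> D"
    and I: "0 \<le> (\<integral>p. f (fst p) (snd p) \<partial>unit_square)"
    and nn: "\<And>x. x \<in> space (sample_space n) \<Longrightarrow> 0 \<le> (\<Sum>u<n. \<Sum>v<n. f (x u) (x v))" and t: "0 < t" and n: "0 < n"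
  shows "{x \<in> space (sample_space n). (\<Sum>u<n. \<Sum>v<n. f (x u) (x v)) < t * (real n)\<^sup>2} \<in> sets (sample_space n)"
    "measure (sample_space n) {x \<in> space (sample_space n). (\<Sum>u<n. \<Sum>v<n. f (x u) (x v)) < t * (real n)\<^sup>2}
      \<ge> 1 - ((\<integral>p. f (fst p) (snd p) \<partial>unit_square) + D / real n) / t"
proof -
  interpret P: prob_space "sample_space n" by (rule prob_space_sample)
  let ?S = "\<lambda>x. \<Sum>u<n. \<Sum>v<n. f (x u) (x v)" and ?I = "\<integral>p. f (fst p) (snd p) \<partial>unit_square"
  have int: "integrable (sample_space n) ?S"
    by (intro Bochner_Integration.integrable_sum integrable_kernel_sample[OF f]) auto
  then have [measurable]: "?S \<in> borel_measurable (sample_space n)" by simp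
  show s: "{x \<in> space (sample_space n). ?S x < t * (real n)\<^sup>2} \<in> sets (sample_space n)" by measurable
  have tn: "0 < t * (real n)\<^sup>2" using t n by simp
  have "measure (sample_space n) {x \<in> space (sample_space n). t * (real n)\<^sup>2 \<le> ?S x} \<le> (\<integral>x. ?S x \<partial>sample_space n) / (t * (real n)\<^sup>2)"
    by (rule integral_Markov_inequality_measure[OF int sets.top]) (use tn nn in auto)
  also have "\<dots> \<le> ((real n)\<^sup>2 * ?I + real n * D) / (t * (real n)\<^sup>2)"
    by (rule divide_right_mono[OF integral_sample_sum_le[OF f D I]]) (use tn in auto)
  also have "\<dots> = (?I + D / real n) / t" using n t by (simp add: field_simps power2_eq_square)
  also have "{x \<in> space (sample_space n). t * (real n)\<^sup>2 \<le> ?S x} = space (sample_space n) - {x \<in> space (sample_space n). ?S x < t * (real n)\<^sup>2}"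
    by auto
  finally show "measure (sample_space n) {x \<in> space (sample_space n). ?S x < t * (real n)\<^sup>2} \<ge> 1 - (?I + D / real n) / t"
    using P.prob_compl[OF s] by linarith
qed

text \<open>With \<open>a\<close> the centred indicator of cell i, the double sum of
  \<open>a p * a q\<close> over the sample is the squared deviation of the count. Its kernel has
  integral 0 and diagonal at most 1, so Markov becomes Chebyshev.\<close>

lemma cell_count_concentration:
  assumes k: "i < k" and g: "0 < \<gamma>" and n: "0 < n"
  shows "{x \<in> space (sample_space n). \<bar>real (card {v\<in>{..<n}. cell k (x v) = i}) - real n / real k\<bar> < \<gamma> * real n} \<in> sets (sample_space n)"
    "measure (sample_space n) {x \<in> space (sample_space n). \<bar>real (card {v\<in>{..<n}. cell k (x v) = i}) - real n / real k\<bar> < \<gamma> * real n}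
      \<ge> 1 - 1 / (real n * \<gamma>\<^sup>2)"
proof -
  have k0: "0 < k" using k by simp
  define a where "a = (\<lambda>j::nat. of_bool (j = i) - 1 / real k)"
  let ?f = "step_kernel k (\<lambda>p q. a p * a q)"
  have sa: "(\<Sum>j<k. a j) = 0" using k by (simp add: a_def sum_subtractf of_bool_def)
  have I: "(\<integral>p. ?f (fst p) (snd p) \<partial>unit_square) = 0"
    unfolding integral_step_kernel[OF k0] by (simp add: sum_distrib_left[symmetric] sa)
  have S: "(\<Sum>u<n. \<Sum>v<n. ?f (x u) (x v)) = (real (card {v\<in>{..<n}. cell k (x v) = i}) - real n / real k)\<^sup>2" for x
  proof -
    have "(\<Sum>u<n. a (cell k (x u))) = real (card {v\<in>{..<n}. cell k (x v) = i}) - real n / real k"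
      by (simp add: a_def sum_subtractf Int_def)
    then show ?thesis by (simp add: step_kernel_def sum_product[symmetric] power2_eq_square)
  qed
  have D: "?f x x \<le> 1" for x
  proof -
    have "1 / real k \<le> 1" "0 \<le> 1 / real k" using k0 by auto
    then have "\<bar>a (cell k x)\<bar> \<le> 1" by (auto simp: a_def of_bool_def)
    then have "(a (cell k x))\<^sup>2 \<le> 1" by (simp add: abs_square_le_1)
    then show ?thesis by (simp add: step_kernel_def power2_eq_square)
  qed
  have iff: "(\<Sum>u<n. \<Sum>v<n. ?f (x u) (x v)) < \<gamma>\<^sup>2 * (real n)\<^sup>2 \<longleftrightarrow> \<bar>real (card {v\<in>{..<n}. cell k (x v) = i}) - real n / real k\<bar> < \<gamma> * real n" for x
  proof -
    let ?d = "real (card {v\<in>{..<n}. cell k (x v) = i}) - real n / real k"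
    have "?d\<^sup>2 < (\<gamma> * real n)\<^sup>2 \<longleftrightarrow> \<bar>?d\<bar> < \<bar>\<gamma> * real n\<bar>" using abs_le_square_iff[of "\<gamma> * real n" ?d] by linarith
    moreover have "\<bar>\<gamma> * real n\<bar> = \<gamma> * real n" using g by simp
    ultimately show ?thesis unfolding S by (simp add: power_mult_distrib)
  qed
  have nn: "0 \<le> (\<Sum>u<n. \<Sum>v<n. ?f (x u) (x v))" for x unfolding S by simp
  have g2: "0 < \<gamma>\<^sup>2" using g by simp
  note M = sample_sum_Markov[OF bounded_kernel_step[OF k0, of "\<lambda>p q. a p * a q"] D _ nn g2 n, unfolded I iff]
  show "{x \<in> space (sample_space n). \<bar>real (card {v\<in>{..<n}. cell k (x v) = i}) - real n / real k\<bar> < \<gamma> * real n} \<in> sets (sample_space n)"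
    by (rule M(1)) simp
  show "measure (sample_space n) {x \<in> space (sample_space n). \<bar>real (card {v\<in>{..<n}. cell k (x v) = i}) - real n / real k\<bar> < \<gamma> * real n}
      \<ge> 1 - 1 / (real n * \<gamma>\<^sup>2)"
    using M(2) by simp
qed

text \<open>The permutation \<open>\<nu>\<close> moves the sample points of cell i to the i-th
  interval as far as the counts allow. The three terms compare sampled \<open>W\<close> with sampled
  \<open>B\<close>, sampled \<open>B\<close> with \<open>B\<close>, and \<open>B\<close> with
  \<open>W\<close>.\<close>

lemma eps_sample_le_step:
  assumes W: "graphon W" and n: "0 < n" and k: "0 < k" and B: "\<And>i j. \<bar>B i j\<bar> \<le> b" and b: "0 \<le> b" and \<gamma>: "0 \<le> \<gamma>"
    and cnt: "\<And>i. i < k \<Longrightarrow> \<bar>real (card {v\<in>{..<n}. cell k (x v) = i}) - real n / real k\<bar> < \<gamma> * real n"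
  shows "eps_sample n W x \<le> matrix_norm2 n (\<lambda>u v. W (x u) (x v) - step_kernel k B (x u) (x v))
     + real k * b * sqrt (8 * \<gamma> + 24 / real n) + kernel_dist W (step_kernel k B)"
proof -
  note bs = bounded_kernel_step[OF n] bounded_kernel_step[OF k] and bW = graphon_bounded_kernel[OF W]
  obtain \<nu> where \<nu>: "\<nu> permutes {..<n}"
    and m1: "\<And>i. card {v\<in>{..<n}. cell k (x (\<nu> v)) = i \<and> v * k div n \<noteq> i} \<le> card {v\<in>{..<n}. cell k (x v) = i} - card {v\<in>{..<n}. v * k div n = i}"
    and m2: "\<And>i. card {v\<in>{..<n}. v * k div n = i \<and> cell k (x (\<nu> v)) \<noteq> i} \<le> card {v\<in>{..<n}. v * k div n = i} - card {v\<in>{..<n}. cell k (x v) = i}"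
    by (rule exists_matching_permutation[of n "\<lambda>v. cell k (x v)" "\<lambda>v. v * k div n"]) (rule that)
  let ?p = "\<lambda>v. cell k (x (\<nu> v))"
  \<comment> \<open>The counts are off by at most \<gamma> n + 1 and the refinement adds 1; rounding
    up to 3 produces 24 = 8 * 3. Class sizes are bounded crudely by n k, which costs only a factor
    depending on the fixed k.\<close>
  let ?d = "real k * (\<gamma> * real n + 3)"
  have mis: "real (card {a\<in>{..<n * k}. ?p (a div k) = i \<and> a div n \<noteq> i}) \<le> ?d"
    "real (card {a\<in>{..<n * k}. a div n = i \<and> ?p (a div k) \<noteq> i}) \<le> ?d" if i: "i < k" for i
  proof -
    define D where "D = max (card {v\<in>{..<n}. cell k (x v) = i} - card {v\<in>{..<n}. v * k div n = i}) (card {v\<in>{..<n}. v * k div n = i} - card {v\<in>{..<n}. cell k (x v) = i})"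
    have "real D \<le> \<gamma> * real n + 1"
      using cnt[OF i] card_floor_partition[OF i n] unfolding D_def by linarith
    then have "real (D + 1) \<le> \<gamma> * real n + 3" by simp
    then have D: "real (k * (D + 1)) \<le> ?d" unfolding of_nat_mult by (rule mult_left_mono) simp
    note c = cell_mismatch_count[OF n k, of ?p i D]
    have "card {a\<in>{..<n * k}. ?p (a div k) = i \<and> a div n \<noteq> i} \<le> k * (D + 1)"
      by (rule c(1)) (use m1[of i] m2[of i] in \<open>auto simp: D_def le_max_iff_disj\<close>)
    then show "real (card {a\<in>{..<n * k}. ?p (a div k) = i \<and> a div n \<noteq> i}) \<le> ?d" using D by linarith
    have "card {a\<in>{..<n * k}. a div n = i \<and> ?p (a div k) \<noteq> i} \<le> k * (D + 1)"
      by (rule c(2)) (use m1[of i] m2[of i] in \<open>auto simp: D_def le_max_iff_disj\<close>)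
    then show "real (card {a\<in>{..<n * k}. a div n = i \<and> ?p (a div k) \<noteq> i}) \<le> ?d" using D by linarith
  qed
  have "(\<Sum>a<n * k. \<Sum>b'<n * k. (B (?p (a div k)) (?p (b' div k)) - B (a div n) (b' div n))\<^sup>2)
     \<le> 8 * real (n * k) * ?d * (\<Sum>i<k. \<Sum>j<k. (B i j)\<^sup>2)"
  proof (rule sum_square_block_diff_le)
    show "(\<lambda>a. ?p (a div k)) ` {..<n * k} \<subseteq> {..<k}" using cell_less[OF k] by auto
    show "(\<lambda>a. a div n) ` {..<n * k} \<subseteq> {..<k}"
      by (auto simp: less_mult_imp_div_less mult.commute)
    fix i assume i: "i < k"
    have "card {a\<in>{..<n * k}. Q a} \<le> n * k" for Q
      using card_mono[of "{..<n * k}" "{a\<in>{..<n * k}. Q a}"] by auto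
    then show "real (card {a\<in>{..<n * k}. ?p (a div k) = i}) \<le> real (n * k)" "real (card {a\<in>{..<n * k}. a div n = i}) \<le> real (n * k)"
      by (simp_all only: of_nat_le_iff)
  qed (rule mis; assumption)+
  also have "\<dots> \<le> 8 * real (n * k) * ?d * (\<Sum>i<k. \<Sum>j<k. b\<^sup>2)"
    using B b \<gamma> by (intro mult_left_mono sum_mono) (auto simp: abs_le_square_iff[symmetric])
  also have "\<dots> = (real k * b)\<^sup>2 * (8 * \<gamma> + 24 / real n) * (real (n * k))\<^sup>2"
    using n k by (simp add: power2_eq_square field_simps)
  finally have "(kernel_norm2 (\<lambda>u v. step_kernel n (\<lambda>u v. B (?p u) (?p v)) u v - step_kernel k B u v))\<^sup>2 \<le> (real k * b)\<^sup>2 * (8 * \<gamma> + 24 / real n)"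
    unfolding kernel_norm2_step_diff[OF n k] using n k by (simp add: divide_le_eq)
  also have "\<dots> = (real k * b * sqrt (8 * \<gamma> + 24 / real n))\<^sup>2" using \<gamma> by (simp add: power_mult_distrib)
  finally have 2: "kernel_norm2 (\<lambda>u v. step_kernel n (\<lambda>u v. B (?p u) (?p v)) u v - step_kernel k B u v) \<le> real k * b * sqrt (8 * \<gamma> + 24 / real n)"
    by (rule power2_le_imp_le) (use b \<gamma> in simp)
  let ?H = "\<lambda>i j. sampled_matrix W x (\<nu> i) (\<nu> j)" and ?B = "\<lambda>u v. B (?p u) (?p v)"
  have "eps_sample n W x \<le> kernel_dist (step_kernel n ?H) W" by (rule eps_sample_le[OF \<nu>])
  also have "\<dots> \<le> kernel_dist (step_kernel n ?H) (step_kernel n ?B) + kernel_dist (step_kernel n ?B) W"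
    by (rule kernel_norm2_dist_triangle[OF bs(1) bs(1) bW])
  also have "kernel_dist (step_kernel n ?B) W \<le> kernel_dist (step_kernel n ?B) (step_kernel k B) + kernel_dist (step_kernel k B) W"
    by (rule kernel_norm2_dist_triangle[OF bs(1) bs(2) bW])
  also have "kernel_dist (step_kernel k B) W = kernel_dist W (step_kernel k B)" by (rule kernel_norm2_minus_commute)
  also have "kernel_dist (step_kernel n ?H) (step_kernel n ?B) = matrix_norm2 n (\<lambda>u v. ?H u v - ?B u v)"
    unfolding kernel_norm2_step[OF n, symmetric] by (simp add: step_kernel_def[abs_def])
  also have "\<dots> = matrix_norm2 n (\<lambda>u v. W (x u) (x v) - step_kernel k B (x u) (x v))"
    using matrix_norm2_permute[OF \<nu>, of "\<lambda>u v. W (x u) (x v) - step_kernel k B (x u) (x v)"]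
    by (simp add: sampled_matrix_def step_kernel_def)
  finally show ?thesis using 2 by linarith
qed

lemma prob_ball_Int_ge:
  assumes "prob_space M" "finite I" "\<And>i. i \<in> I \<Longrightarrow> A i \<in> sets M" "X \<in> sets M"
    and "\<And>i. i \<in> I \<Longrightarrow> measure M (A i) \<ge> 1 - a" "measure M X \<ge> 1 - b"
  shows "measure M (X \<inter> {x \<in> space M. \<forall>i\<in>I. x \<in> A i}) \<ge> 1 - b - real (card I) * a"
proof -
  interpret prob_space M by fact
  let ?U = "(space M - X) \<union> (\<Union>i\<in>I. space M - A i)"
  have "prob ?U \<le> prob (space M - X) + prob (\<Union>i\<in>I. space M - A i)"
    by (rule measure_Un_le) (intro sets.compl_sets sets.finite_UN assms; assumption)+
  also have "prob (\<Union>i\<in>I. space M - A i) \<le> (\<Sum>i\<in>I. prob (space M - A i))"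
    by (rule measure_UNION_le[OF assms(2)]) (intro sets.compl_sets assms; assumption)
  also have "prob (space M - X) + (\<Sum>i\<in>I. prob (space M - A i)) \<le> b + (\<Sum>i\<in>I. a)"
  proof (intro add_mono sum_mono)
    show "prob (space M - X) \<le> b" using prob_compl[OF assms(4)] assms(6) by linarith
    show "prob (space M - A i) \<le> a" if "i \<in> I" for i using prob_compl[OF assms(3)[OF that]] assms(5)[OF that] by linarith
  qed
  finally have U: "prob ?U \<le> b + real (card I) * a" by simp
  have "?U \<in> events" by (intro sets.Un sets.compl_sets sets.finite_UN assms)
  from prob_compl[OF this] U have "prob (space M - ?U) \<ge> 1 - b - real (card I) * a" by linarith
  moreover have "space M - ?U = X \<inter> {x \<in> space M. \<forall>i\<in>I. x \<in> A i}"
    using sets.sets_into_space[OF assms(4)] by auto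
  ultimately show ?thesis by simp
qed

lemma eps_sample_tendsto:
  assumes W: "graphon W" and L: "\<forall>x\<in>{0..1}. \<forall>y\<in>{0..1}. W x y \<le> \<Lambda>" and e: "0 < e" and \<eta>: "0 < \<eta>"
  shows "\<forall>\<^sub>F n in sequentially. measure (sample_space n) {x \<in> space (sample_space n). eps_sample n W x < e} \<ge> 1 - \<eta>"
proof -
  note bW = graphon_bounded_kernel[OF W]
  have \<Lambda>: "0 \<le> \<Lambda>" using L[rule_format, of 0 0] graphon_pointwise(1)[OF W, of 0 0] by simp
  \<comment> \<open>Markov with this threshold bounds the distance of sampled \<open>W\<close> to
    sampled \<open>B\<close> by e/3.\<close>
  define t where "t = (e / 3)\<^sup>2"
  have t: "0 < t" using e by (simp add: t_def)
  \<comment> \<open>The first bound keeps the approximation of \<open>W\<close> within the budget e.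
    The second makes the expected squared distance small against \<open>t\<close>, so that Markov
    fails with probability at most \<eta>/2.\<close>
  define e1 where "e1 = min (e / 6) (sqrt (\<eta> * t / 4))"
  have e1: "0 < e1" "e1 < e / 3" "e1\<^sup>2 \<le> \<eta> * t / 4"
  proof -
    show 0: "0 < e1" using e \<eta> t by (simp add: e1_def)
    show "e1 < e / 3" using e by (simp add: e1_def)
    have "e1\<^sup>2 \<le> (sqrt (\<eta> * t / 4))\<^sup>2" using 0 by (intro power_mono) (auto simp: e1_def)
    then show "e1\<^sup>2 \<le> \<eta> * t / 4" using \<eta> t by simp
  qed
  have "\<forall>\<^sub>F k in sequentially. eps_oracle k W < e1 / 2 \<and> 0 < k"
    by (rule eventually_conj[OF order_tendstoD(2)[OF eps_oracle_tendsto[OF W]] eventually_gt_at_top]) (use e1(1) in simp)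
  then obtain k where k: "eps_oracle k W < e1 / 2" "0 < k" by (auto simp: eventually_sequentially)
  obtain B where B: "\<And>i j. 0 \<le> B i j \<and> B i j \<le> \<Lambda>"
    and near: "kernel_dist W (step_kernel k B) \<le> eps_oracle k W + e1 / 2"
    by (rule eps_oracle_near_minimizer[OF W L k(2), of "e1 / 2"]) (use e1 in auto)
  have near: "kernel_dist W (step_kernel k B) \<le> e1" using near k(1) by linarith
  \<comment> \<open>Chosen so that k \<Lambda> sqrt q \<le> e/6; adding 1 avoids division by zero.
    Half of \<open>q\<close> is spent on 8 \<gamma>, the other half on 24/n.\<close>
  define q where "q = (e / (6 * (real k * \<Lambda> + 1)))\<^sup>2"
  have kL: "0 \<le> real k * \<Lambda>" using \<Lambda> by simp
  have q: "0 < q" using e kL by (simp add: q_def)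
  define \<gamma> where "\<gamma> = q / 16"
  have \<gamma>: "0 < \<gamma>" using q by (simp add: \<gamma>_def)
  define f where "f = (\<lambda>x y. (W x y - step_kernel k B x y)\<^sup>2)"
  have bf: "bounded_kernel f" unfolding f_def by (rule bounded_kernel_square[OF bounded_kernel_diff[OF bW bounded_kernel_step[OF k(2)]]])
  have fI: "(\<integral>p. f (fst p) (snd p) \<partial>unit_square) = (kernel_dist W (step_kernel k B))\<^sup>2"
    unfolding f_def kernel_norm2_square ..
  have fI_le: "(kernel_dist W (step_kernel k B))\<^sup>2 \<le> \<eta> * t / 4"
    using power_mono[OF near, of 2] e1(3) by simp
  have fD: "f x x \<le> \<Lambda>\<^sup>2" if "x \<in> {0..1}" for x
  proof -
    have "0 \<le> W x x" "W x x \<le> \<Lambda>" using graphon_pointwise(1)[OF W that that] L that by auto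
    moreover have "0 \<le> step_kernel k B x x" "step_kernel k B x x \<le> \<Lambda>" using B by (auto simp: step_kernel_def)
    ultimately have "\<bar>W x x - step_kernel k B x x\<bar> \<le> \<bar>\<Lambda>\<bar>" by linarith
    then show ?thesis unfolding f_def by (simp only: abs_le_square_iff)
  qed
  have "\<forall>\<^sub>F n in sequentially. 0 < n \<and> 24 / real n \<le> q / 2 \<and> \<Lambda>\<^sup>2 / real n \<le> \<eta> * t / 4 \<and> real k * (1 / (real n * \<gamma>\<^sup>2)) \<le> \<eta> / 2"
  proof (intro eventually_conj)
    show "\<forall>\<^sub>F n::nat in sequentially. 0 < n" by (rule eventually_gt_at_top)
    have small: "\<forall>\<^sub>F n::nat in sequentially. c / real n \<le> d" if "0 < d" for c d :: real
    proof -
      have "(\<lambda>n. c / real n) \<longlonglongrightarrow> 0" by (rule lim_const_over_n)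
      from order_tendstoD(2)[OF this that] show ?thesis by (rule eventually_mono) simp
    qed
    show "\<forall>\<^sub>F n::nat in sequentially. 24 / real n \<le> q / 2" by (rule small) (use q in simp)
    show "\<forall>\<^sub>F n::nat in sequentially. \<Lambda>\<^sup>2 / real n \<le> \<eta> * t / 4" by (rule small) (use \<eta> t in simp)
    have "\<forall>\<^sub>F n::nat in sequentially. (real k / \<gamma>\<^sup>2) / real n \<le> \<eta> / 2" by (rule small) (use \<eta> in simp)
    then show "\<forall>\<^sub>F n::nat in sequentially. real k * (1 / (real n * \<gamma>\<^sup>2)) \<le> \<eta> / 2" by (simp add: mult.commute)
  qed
  then show ?thesis
  proof (rule eventually_mono)
    fix n assume "0 < n \<and> 24 / real n \<le> q / 2 \<and> \<Lambda>\<^sup>2 / real n \<le> \<eta> * t / 4 \<and> real k * (1 / (real n * \<gamma>\<^sup>2)) \<le> \<eta> / 2"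
    then have n: "0 < n" "24 / real n \<le> q / 2" "\<Lambda>\<^sup>2 / real n \<le> \<eta> * t / 4" "real k * (1 / (real n * \<gamma>\<^sup>2)) \<le> \<eta> / 2" by auto
    interpret P: prob_space "sample_space n" by (rule prob_space_sample)
    let ?X = "{x \<in> space (sample_space n). (\<Sum>u<n. \<Sum>v<n. f (x u) (x v)) < t * (real n)\<^sup>2}"
    let ?A = "\<lambda>i. {x \<in> space (sample_space n). \<bar>real (card {v\<in>{..<n}. cell k (x v) = i}) - real n / real k\<bar> < \<gamma> * real n}"
    have f0: "0 \<le> (\<Sum>u<n. \<Sum>v<n. f (x u) (x v))" for x by (simp add: f_def sum_nonneg)
    have fI0: "0 \<le> (\<integral>p. f (fst p) (snd p) \<partial>unit_square)" unfolding fI by simp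
    note MX = sample_sum_Markov[OF bf fD fI0 f0 t n(1), unfolded fI]
    have "((kernel_dist W (step_kernel k B))\<^sup>2 + \<Lambda>\<^sup>2 / real n) / t \<le> (\<eta> * t / 4 + \<eta> * t / 4) / t"
      using fI_le n(3) t by (intro divide_right_mono add_mono) auto
    also have "\<dots> = \<eta> / 2" using t by simp
    finally have X: "measure (sample_space n) ?X \<ge> 1 - \<eta> / 2" using MX(2) by linarith
    have "measure (sample_space n) (?X \<inter> {x \<in> space (sample_space n). \<forall>i\<in>{..<k}. x \<in> ?A i})
      \<ge> 1 - \<eta> / 2 - real (card {..<k}) * (1 / (real n * \<gamma>\<^sup>2))"
      by (rule prob_ball_Int_ge[OF prob_space_sample _ _ MX(1) _ X])
        (use cell_count_concentration[OF _ \<gamma> n(1), of _ k] in auto)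
    moreover have "measure (sample_space n) (?X \<inter> {x \<in> space (sample_space n). \<forall>i\<in>{..<k}. x \<in> ?A i})
      \<le> measure (sample_space n) {x \<in> space (sample_space n). eps_sample n W x < e}"
    proof (rule P.finite_measure_mono)
      show "{x \<in> space (sample_space n). eps_sample n W x < e} \<in> sets (sample_space n)"
        using measurable_eps_sample[OF W n(1)] by measurable
      show "?X \<inter> {x \<in> space (sample_space n). \<forall>i\<in>{..<k}. x \<in> ?A i} \<subseteq> {x \<in> space (sample_space n). eps_sample n W x < e}"
      proof
        fix x assume x: "x \<in> ?X \<inter> {x \<in> space (sample_space n). \<forall>i\<in>{..<k}. x \<in> ?A i}"
        then have cnt: "\<And>i. i < k \<Longrightarrow> \<bar>real (card {v\<in>{..<n}. cell k (x v) = i}) - real n / real k\<bar> < \<gamma> * real n" by auto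
        have Bb: "\<bar>B i j\<bar> \<le> \<Lambda>" for i j using B[of i j] by simp
        have "eps_sample n W x \<le> matrix_norm2 n (\<lambda>u v. W (x u) (x v) - step_kernel k B (x u) (x v))
           + real k * \<Lambda> * sqrt (8 * \<gamma> + 24 / real n) + kernel_dist W (step_kernel k B)"
          by (rule eps_sample_le_step[OF W n(1) k(2) Bb \<Lambda> less_imp_le[OF \<gamma>] cnt])
        moreover have "matrix_norm2 n (\<lambda>u v. W (x u) (x v) - step_kernel k B (x u) (x v)) \<le> e / 3"
        proof (rule power2_le_imp_le)
          have "(\<Sum>u<n. \<Sum>v<n. f (x u) (x v)) / (real n)\<^sup>2 \<le> t * (real n)\<^sup>2 / (real n)\<^sup>2"
            using x by (intro divide_right_mono) auto
          then show "(matrix_norm2 n (\<lambda>u v. W (x u) (x v) - step_kernel k B (x u) (x v)))\<^sup>2 \<le> (e / 3)\<^sup>2"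
            unfolding matrix_norm2_square t_def[symmetric] using n(1) by (simp add: f_def)
        qed (use e in simp)
        moreover have "real k * \<Lambda> * sqrt (8 * \<gamma> + 24 / real n) \<le> e / 6"
        proof -
          have "sqrt (8 * \<gamma> + 24 / real n) \<le> sqrt q" using n(2) by (intro real_sqrt_le_mono) (simp add: \<gamma>_def)
          also have "\<dots> = e / (6 * (real k * \<Lambda> + 1))" using e kL by (simp add: q_def)
          finally have "real k * \<Lambda> * sqrt (8 * \<gamma> + 24 / real n) \<le> real k * \<Lambda> * (e / (6 * (real k * \<Lambda> + 1)))"
            by (rule mult_left_mono[OF _ kL])
          also have "\<dots> \<le> (real k * \<Lambda> + 1) * (e / (6 * (real k * \<Lambda> + 1)))" using e kL by (intro mult_right_mono) auto
          also have "\<dots> = e / 6" using kL by (simp add: field_simps)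
          finally show ?thesis .
        qed
        ultimately have "eps_sample n W x < e" using near e1(2) e by linarith
        then show "x \<in> {x \<in> space (sample_space n). eps_sample n W x < e}" using x by simp
      qed
    qed
    ultimately show "1 - \<eta> \<le> measure (sample_space n) {x \<in> space (sample_space n). eps_sample n W x < e}"
      using n(4) by simp
  qed
qed

section \<open>Consistency of the estimate\<close>

lemma least_squares_consistent:
  fixes W \<Lambda> and \<rho> lam :: "nat \<Rightarrow> real" and k :: "nat \<Rightarrow> nat"
  assumes adm: "\<forall>\<^sub>F n in sequentially. admissible n (k n) W \<Lambda> (\<rho> n) (lam n)"
    and k: "filterlim k at_top sequentially"
    and rate: "(\<lambda>n. rate n (k n) (\<rho> n) (lam n)) \<longlonglongrightarrow> 0" and \<epsilon>: "0 < \<epsilon>"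
  shows "(\<lambda>n. measure (graph_model n (\<rho> n) W)
           {(x, G) \<in> space (graph_model n (\<rho> n) W).
              \<exists>B \<in> least_squares n (k n) (lam n * edge_density n G) G.
                delta2 W (estimated_kernel n (k n) G B) > \<epsilon>}) \<longlonglongrightarrow> 0"
proof (rule tendstoI)
  fix \<eta> :: real assume \<eta>: "0 < \<eta>"
  obtain n0 where "admissible n0 (k n0) W \<Lambda> (\<rho> n0) (lam n0)" using adm by (auto simp: eventually_sequentially)
  then have W: "graphon W" and L: "\<forall>x\<in>{0..1}. \<forall>y\<in>{0..1}. W x y \<le> \<Lambda>" by (auto simp: admissible_def)
  have \<eta>4: "0 < \<eta> / 4" using \<eta> by simp
  obtain M where M: "\<And>n k W \<Lambda> \<rho> lam. admissible n k W \<Lambda> \<rho> lam \<Longrightarrow>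
      measure (graph_model n \<rho> W)
        (good_event n k W \<rho> lam M) \<ge> 1 - \<eta> / 4"
    using least_squares_rate[OF \<eta>4] by blast
  have "(\<lambda>n. M * root 4 (rate n (k n) (\<rho> n) (lam n))) \<longlonglongrightarrow> M * root 4 0"
    by (intro tendsto_intros rate)
  \<comment> \<open>The oracle error and the rate term stay below \<epsilon>/4 each; twice the
    sampling error stays below \<epsilon>/2.\<close>
  then have ev1: "\<forall>\<^sub>F n in sequentially. M * root 4 (rate n (k n) (\<rho> n) (lam n)) < \<epsilon> / 4"
    using \<epsilon> by (intro order_tendstoD(2)) auto
  have ev2: "\<forall>\<^sub>F n in sequentially. eps_oracle (k n) W < \<epsilon> / 4"
    using order_tendstoD(2)[OF filterlim_compose[OF eps_oracle_tendsto[OF W] k], of "\<epsilon> / 4"] \<epsilon> by simp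
  have ev3: "\<forall>\<^sub>F n in sequentially. measure (sample_space n) {x \<in> space (sample_space n). eps_sample n W x < \<epsilon> / 4} \<ge> 1 - \<eta> / 4"
    by (rule eps_sample_tendsto[OF W L]) (use \<epsilon> \<eta> in auto)
  show "\<forall>\<^sub>F n in sequentially. dist (measure (graph_model n (\<rho> n) W)
           {(x, G) \<in> space (graph_model n (\<rho> n) W).
              \<exists>B \<in> least_squares n (k n) (lam n * edge_density n G) G.
                delta2 W (estimated_kernel n (k n) G B) > \<epsilon>}) 0 < \<eta>"
    using adm ev1 ev2 ev3
  proof eventually_elim
    case (elim n)
    interpret least_squares_model n "k n" W \<Lambda> "\<rho> n" "lam n" by unfold_locales (rule elim(1))
    have n: "0 < n" using adm_n(2) by simp
    have \<rho>0: "0 \<le> \<rho> n" using adm_\<rho> by simp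
    note model = adm_graphon(1,3) \<rho>0 adm_\<rho>(2)
    interpret gm: prob_space "graph_model n (\<rho> n) W" by (rule prob_space_graph_model[OF model])
    let ?bad = "{(x, G) \<in> space (graph_model n (\<rho> n) W).
              \<exists>B \<in> least_squares n (k n) (lam n * edge_density n G) G.
                delta2 W (estimated_kernel n (k n) G B) > \<epsilon>}"
    let ?S1 = "good_event n (k n) W (\<rho> n) (lam n) M"
    let ?X = "{x \<in> space (sample_space n). eps_sample n W x < \<epsilon> / 4}"
    let ?S2 = "{(x, G) \<in> space (graph_model n (\<rho> n) W). eps_sample n W x < \<epsilon> / 4}"
    have S1: "?S1 \<in> gm.events"
      by (rule sets_graph_modelI[OF model]) (rule sets_eps_sample_ge[OF W n], simp)
    have X: "?X \<in> sets (sample_space n)" using measurable_eps_sample[OF W n] by measurable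
    have S2: "?S2 \<in> gm.events" by (rule sets_graph_modelI[OF model]) (rule X)
    \<comment> \<open>The event depends on the sample alone, so its conditional probability given a
      good sample is 1 and nothing is lost in the second stage.\<close>
    have "gm.prob ?S2 \<ge> 1 - \<eta> / 4 - 0"
    proof (rule graph_model_prob_ge[OF model S2 X elim(4)])
      fix x assume x: "x \<in> ?X"
      have "measure_pmf.prob (graph_law n (\<rho> n) W x) {G. (x, G) \<in> ?S2} = 1"
        by (subst measure_pmf.prob_eq_1)
          (use x set_random_graph_pmf in \<open>auto simp: space_graph_model[OF model] intro!: AE_pmfI\<close>)
      then show "1 - 0 \<le> measure_pmf.prob (graph_law n (\<rho> n) W x) {G. (x, G) \<in> ?S2}" by simp
    qed (use \<eta> in auto)
    moreover have "gm.prob ?S1 \<ge> 1 - \<eta> / 4" by (rule M[OF elim(1)])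
    ultimately have U: "gm.prob (space (graph_model n (\<rho> n) W) - ?S1) \<le> \<eta> / 4" "gm.prob (space (graph_model n (\<rho> n) W) - ?S2) \<le> \<eta> / 4"
      unfolding gm.prob_compl[OF S1] gm.prob_compl[OF S2] by linarith+
    let ?C1 = "space (graph_model n (\<rho> n) W) - ?S1" and ?C2 = "space (graph_model n (\<rho> n) W) - ?S2"
    have "gm.prob ?bad \<le> gm.prob (?C1 \<union> ?C2)"
    proof (rule gm.finite_measure_mono)
      show "?C1 \<union> ?C2 \<in> gm.events" by (intro sets.Un sets.compl_sets S1 S2)
      show "?bad \<subseteq> ?C1 \<union> ?C2"
      proof
        fix p assume p: "p \<in> ?bad"
        then obtain x G B where xG: "p = (x, G)" "(x, G) \<in> space (graph_model n (\<rho> n) W)"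
          and B: "B \<in> least_squares n (k n) (lam n * edge_density n G) G" "delta2 W (estimated_kernel n (k n) G B) > \<epsilon>" by auto
        show "p \<in> ?C1 \<union> ?C2"
        proof (rule ccontr)
          assume "p \<notin> ?C1 \<union> ?C2"
          then have "(x, G) \<in> ?S1" "(x, G) \<in> ?S2" using xG by blast+
          then have "delta2 W (estimated_kernel n (k n) G B)
               \<le> eps_oracle (k n) W + 2 * eps_sample n W x + M * root 4 (rate n (k n) (\<rho> n) (lam n))" "eps_sample n W x < \<epsilon> / 4"
            using B(1) by auto
          with elim(2,3) B(2) show False by linarith
        qed
      qed
    qed
    also have "\<dots> \<le> gm.prob ?C1 + gm.prob ?C2" by (rule measure_Un_le) (intro sets.compl_sets S1 S2)+
    finally have "gm.prob ?bad < \<eta>" using U \<eta> by linarith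
    then show ?case by (simp add: dist_real_def)
  qed
qed

theorem theorem2:
  shows "(\<forall>\<eta>>0. \<exists>M::real. \<forall>n k W \<Lambda> \<rho> lam. admissible n k W \<Lambda> \<rho> lam \<longrightarrow>
      measure (graph_model n \<rho> W)
        {(x, G) \<in> space (graph_model n \<rho> W).
           \<forall>B \<in> least_squares n k (lam * edge_density n G) G.
             delta2 W (estimated_kernel n k G B)
               \<le> eps_oracle k W + 2 * eps_sample n W x + M * root 4 (rate n k \<rho> lam)}
        \<ge> 1 - \<eta>)
    \<and>
    (\<forall>W \<Lambda> (\<rho> :: nat \<Rightarrow> real) (lam :: nat \<Rightarrow> real) (k :: nat \<Rightarrow> nat).
      (\<forall>\<^sub>F n in sequentially. admissible n (k n) W \<Lambda> (\<rho> n) (lam n)) \<longrightarrow>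
      filterlim k at_top sequentially \<longrightarrow>
      (\<lambda>n. rate n (k n) (\<rho> n) (lam n)) \<longlonglongrightarrow> 0 \<longrightarrow>
      (\<forall>\<epsilon>>0.
        (\<lambda>n. measure (graph_model n (\<rho> n) W)
           {(x, G) \<in> space (graph_model n (\<rho> n) W).
              \<exists>B \<in> least_squares n (k n) (lam n * edge_density n G) G.
                delta2 W (estimated_kernel n (k n) G B) > \<epsilon>}) \<longlonglongrightarrow> 0))"
proof (intro conjI allI impI)
  fix \<eta> :: real assume "0 < \<eta>"
  then show "\<exists>M::real. \<forall>n k W \<Lambda> \<rho> lam. admissible n k W \<Lambda> \<rho> lam \<longrightarrow>
      measure (graph_model n \<rho> W)
        {(x, G) \<in> space (graph_model n \<rho> W).
           \<forall>B \<in> least_squares n k (lam * edge_density n G) G.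
             delta2 W (estimated_kernel n k G B)
               \<le> eps_oracle k W + 2 * eps_sample n W x + M * root 4 (rate n k \<rho> lam)}
        \<ge> 1 - \<eta>"
    by (rule least_squares_rate)
qed (rule least_squares_consistent)

end
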